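(* Let $I\subseteq\{1,\dots,2n\}$ with $|I|=n$ such that $i\in I$ implies $2n+1-i\notin I$, and let $C_I=B\cdot V_I\subseteq G/P$ be the corresponding Schubert cell, where $V_I=\mathrm{span}\{\mathbf e_i\mid i\in I\}$ and $G/P$ is identified with the Lagrangian Grassmannian via $gP\mapsto g\cdot\mathrm{span}\{\mathbf e_1,\dots,\mathbf e_n\}$. Let $\gamma_I=c_1\cdots c_{2n}$ be the clan with $c_i=+$ if $i\in I$ and $c_i=-$ if $i\notin I$, and let $\Sigma_I$ be the set of skew-symmetric $(n,n)$-clans whose base clan is $\gamma_I$. If $\pi:G/L\to G/P$ is the natural projection, then $$\pi^{-1}(C_I)=\bigsqcup_{\gamma\in\Sigma_I}R_\gamma.$$
   Context: An $(n,n)$-clan is a string $\gamma=c_1\cdots c_{2n}$ of symbols from $\mathbb{N}\cup\{+,-\}$ such that each natural number appearing appears exactly twice and the numbers of $+$'s and $-$'s are equal; clans are equal if they have the same $\pm$ symbols in the same positions and the same sets of positions of matching pairs. $\gamma$ is skew-symmetric if $\gamma=-rev(\gamma)$, where $rev$ reverses the string and $-$ interchanges $+$ and $-$. Let $J_n$ be the $n\times n$ antidiagonal matrix of $1$'s, $\Omega=\begin{pmatrix}0&J_n\\-J_n&0\end{pmatrix}$, $G=Sp_{2n}=\{g\in GL_{2n}(\mathbb{C})\mid g^t\Omega g=\Omega\}$, $B$ the upper triangular matrices in $G$, $P$ the elements of $G$ whose lower-left $n\times n$ block is zero (the stabilizer of $\mathrm{span}\{\mathbf e_1,\dots,\mathbf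 e_n\}$), and $L=\{\mathrm{diag}(A,J_n(A^{-1})^tJ_n)\mid A\in GL_n\}\cong GL_n$. Let $\mathbf e_1,\dots,\mathbf e_{2n}$ be the standard basis. Default signed clan: each $\pm$ symbol has itself as signature; if $c_i=c_j\in\mathbb{N}$ with $i<j$, $c_i$ gets signature $-$ and $c_j$ signature $+$. The base clan of $\gamma$ is obtained by replacing every natural number by its signature. Default permutation $\sigma\in\mathcal S_{2n}$: for $i\le n$, if $c_i$ has signature $+$ then $\sigma(i)=i$, $\sigma(2n+1-i)=2n+1-i$; if signature $-$ then $\sigma(i)=2n+1-i$, $\sigma(2n+1-i)=i$. Define vectors $\mathbf v_1,\dots,\mathbf v_{2n}$: if $c_i=-$, $\mathbf v_i=\mathbf e_{\sigma(i)}$; if $c_i=+$, $\mathbf v_i=\mathbf e_{\sigma(i)}$ for $i\le n$ and $-\mathbf e_{\sigma(i)}$ for $i>n$; if $c_i=c_j\in\mathbb N$ with $i<j$, $\mathbf v_i=\frac1{\sqrt2}(\mathbf e_{\sigma(i)}+\mathbf e_{\sigma(j)})$ if $i\le n$ and $-\frac1{\sqrt2}(\mathbf e_{\sigma(i)}+\mathbf e_{\sigma(j)})$ if $i>n$, and $\mathbf v_j=\frac1{\sqrt2}(\mathbf e_{\sigma(i)}-\mathbf e_{\sigma(j)})$. Let $g_\gamma\in G$ be the matrix with columns $\mathbf v_1,\dots,\mathbf v_{2n}$, and $R_\gamma:=Bg_\gamma^{-1}L/L$, the $B$-orbit in $G/L$ associated to $\gamma$; $\gamma\mapsto R_\gamma$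 is a bijection from skew-symmetric $(n,n)$-clans to $B$-orbits in $G/L$. *)

theory Defs
  imports
    "Jordan_Normal_Form.VS_Connect"
    "HOL-Algebra.Left_Coset"
    "HOL-Library.Disjoint_Sets"
begin

text \<open>
  All indices are shifted by one: rows, columns, basis vectors and positions in a clan run over
  \<open>0, \<dots>, 2n - 1\<close>. The reflection \<open>i \<mapsto> 2n + 1 - i\<close> becomes \<open>i \<mapsto> 2n - 1 - i\<close>, and
  \<open>i \<le> n\<close> becomes \<open>i < n\<close>.
\<close>

section \<open>Clans\<close>

datatype clan_symbol = Plus | Minus | Num nat

text \<open>Positions \<open>i < j\<close> carrying the same natural number.\<close>

definition word_pairs :: "clan_symbol list \<Rightarrow> (nat \<times> nat) set" where
  "word_pairs w = {(i, j). i < j \<and> j < length w \<and> w ! i = w ! j \<and> (\<exists>a. w ! i = Num a)}"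

definition word_positions :: "clan_symbol \<Rightarrow> clan_symbol list \<Rightarrow> nat set" where
  "word_positions c w = {i. i < length w \<and> w ! i = c}"

definition same_clan :: "clan_symbol list \<Rightarrow> clan_symbol list \<Rightarrow> bool" where
  "same_clan v w \<longleftrightarrow>
     length v = length w \<and>
     word_positions Plus v = word_positions Plus w \<and>
     word_positions Minus v = word_positions Minus w \<and>
     word_pairs v = word_pairs w"

text \<open>
  The type of arbitrary strings modulo equality of clans. The conditions on multiplicities of the
  symbols are imposed afterwards, in \<open>clans\<close> below.
\<close>

quotient_type clan = "clan_symbol list" / same_clan
  morphisms rep_clan clan_of_word
  by (rule equivpI) (auto simp: reflp_def symp_def transp_def same_clan_def)

definition is_clan_word :: "nat \<Rightarrow> clan_symbol list \<Rightarrow> bool" where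
  "is_clan_word n w \<longleftrightarrow>
     length w = 2 * n \<and>
     (\<forall>a. Num a \<in> set w \<longrightarrow> count_list w (Num a) = 2) \<and>
     count_list w Plus = count_list w Minus"

definition clans :: "nat \<Rightarrow> clan set" where
  "clans n = clan_of_word ` {w. is_clan_word n w}"

lift_definition plus_positions :: "clan \<Rightarrow> nat set" is "word_positions Plus"
  by (simp add: same_clan_def)

lift_definition minus_positions :: "clan \<Rightarrow> nat set" is "word_positions Minus"
  by (simp add: same_clan_def)

lift_definition clan_pairs :: "clan \<Rightarrow> (nat \<times> nat) set" is word_pairs
  by (simp add: same_clan_def)

fun neg_symbol :: "clan_symbol \<Rightarrow> clan_symbol" where
  "neg_symbol Plus = Minus"
| "neg_symbol Minus = Plus"
| "neg_symbol (Num a) = Num a"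

lemma neg_symbol_eq_iff [simp]:
  "neg_symbol c = Plus \<longleftrightarrow> c = Minus"
  "neg_symbol c = Minus \<longleftrightarrow> c = Plus"
  "neg_symbol c = Num a \<longleftrightarrow> c = Num a"
  "Num a = neg_symbol c \<longleftrightarrow> Num a = c"
  "neg_symbol c = neg_symbol d \<longleftrightarrow> c = d"
  by (cases c; cases d; auto)+

definition neg_rev_word :: "clan_symbol list \<Rightarrow> clan_symbol list" where
  "neg_rev_word w = map neg_symbol (rev w)"

lemma length_neg_rev_word [simp]: "length (neg_rev_word w) = length w"
  by (simp add: neg_rev_word_def)

lemma word_positions_neg_rev:
  "word_positions c (neg_rev_word w) =
     {i. i < length w \<and> length w - Suc i \<in> word_positions (neg_symbol c) w}"
  by (cases c) (auto simp: word_positions_def neg_rev_word_def rev_nth)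

lemma word_pairs_neg_rev:
  "word_pairs (neg_rev_word w) =
     {(i, j). i < j \<and> j < length w \<and> (length w - Suc j, length w - Suc i) \<in> word_pairs w}"
proof (rule Set.set_eqI, unfold split_paired_all)
  fix i j
  show "(i, j) \<in> word_pairs (neg_rev_word w) \<longleftrightarrow>
      (i, j) \<in> {(i, j). i < j \<and> j < length w \<and> (length w - Suc j, length w - Suc i) \<in> word_pairs w}"
  proof (cases "i < j \<and> j < length w")
    case True
    then have "length w - Suc j < length w - Suc i" "length w - Suc i < length w" by auto
    with True show ?thesis
      by (simp add: word_pairs_def neg_rev_word_def rev_nth eq_commute[of "w ! (length w - Suc i)"]
          cong: conj_cong)
  qed (auto simp: word_pairs_def)
qed

lift_definition neg_rev :: "clan \<Rightarrow> clan" is neg_rev_word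
  unfolding same_clan_def
  by (simp add: word_positions_neg_rev word_pairs_neg_rev)

definition skew_symmetric :: "clan \<Rightarrow> bool" where
  "skew_symmetric \<gamma> \<longleftrightarrow> \<gamma> = neg_rev \<gamma>"

text \<open>
  The default signature is \<open>+\<close> at the \<open>+\<close> symbols and at the second member of each pair, and
  \<open>-\<close> at the \<open>-\<close> symbols and at the first member of each pair.
\<close>

definition word_signature :: "clan_symbol list \<Rightarrow> nat \<Rightarrow> clan_symbol" where
  "word_signature w i =
     (if i \<in> fst ` word_pairs w then Minus
      else if i \<in> snd ` word_pairs w then Plus
      else w ! i)"

definition base_word :: "clan_symbol list \<Rightarrow> clan_symbol list" where
  "base_word w = map (word_signature w) [0..<length w]"

lemma length_base_word: "length (base_word w) = length w"
  by (simp add: base_word_def)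

lemma same_clan_base_word: "same_clan v w \<Longrightarrow> same_clan (base_word v) (base_word w)"
proof -
  have pairs: "word_pairs (base_word u) = {}" for u
  proof -
    have "(i, j) \<notin> word_pairs (base_word u)" for i j
    proof
      assume "(i, j) \<in> word_pairs (base_word u)"
      then obtain a where ij: "i < j" "j < length u"
        and sig: "word_signature u i = Num a" "word_signature u j = Num a"
        by (auto simp: word_pairs_def base_word_def dest: sym)
      then have "u ! i = Num a" "u ! j = Num a" "i \<notin> fst ` word_pairs u"
        unfolding word_signature_def by (auto split: if_splits)
      moreover from this have "(i, j) \<in> word_pairs u"
        unfolding word_pairs_def using ij by simp
      ultimately show False by (metis fst_conv image_eqI)
    qed
    then show ?thesis by auto
  qed
  have plus: "word_positions Plus (base_word u) =
      (word_positions Plus u \<union> {i. i < length u \<and> i \<in> snd ` word_pairs u}) - fst ` word_pairs u"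
    for u
    by (rule Set.set_eqI, simp add: word_positions_def base_word_def word_signature_def cong: conj_cong)
      (metis clan_symbol.distinct(1))
  have minus: "word_positions Minus (base_word u) =
      (word_positions Minus u - snd ` word_pairs u) \<union> {i. i < length u \<and> i \<in> fst ` word_pairs u}"
    for u
    by (rule Set.set_eqI, simp add: word_positions_def base_word_def word_signature_def cong: conj_cong)
      (metis clan_symbol.distinct(1))
  show "same_clan v w \<Longrightarrow> same_clan (base_word v) (base_word w)"
    unfolding same_clan_def using plus minus pairs length_base_word by simp
qed

lift_definition base_clan :: "clan \<Rightarrow> clan" is base_word
  by (rule same_clan_base_word)

definition sign_clan :: "nat \<Rightarrow> nat set \<Rightarrow> clan" where
  "sign_clan n I = clan_of_word (map (\<lambda>i. if i \<in> I then Plus else Minus) [0..<2 * n])"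

definition clans_over :: "nat \<Rightarrow> nat set \<Rightarrow> clan set" where
  "clans_over n I = {\<gamma> \<in> clans n. skew_symmetric \<gamma> \<and> base_clan \<gamma> = sign_clan n I}"

section \<open>The symplectic group and its subgroups\<close>

definition GL :: "nat \<Rightarrow> complex mat monoid" where
  "GL m = units_of (ring_mat TYPE(complex) m ())"

definition antidiag :: "nat \<Rightarrow> complex mat" where
  "antidiag n = mat n n (\<lambda>(i, j). if i + j + 1 = n then 1 else 0)"

definition symp_form :: "nat \<Rightarrow> complex mat" where
  "symp_form n = four_block_mat (0\<^sub>m n n) (antidiag n) (- antidiag n) (0\<^sub>m n n)"

definition Sp :: "nat \<Rightarrow> complex mat monoid" where
  "Sp n = (GL (2 * n))
     \<lparr>carrier := {g \<in> carrier (GL (2 * n)). transpose_mat g * symp_form n * g = symp_form n}\<rparr>"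

definition borel_subgroup :: "nat \<Rightarrow> complex mat set" where
  "borel_subgroup n = {g \<in> carrier (Sp n). upper_triangular g}"

definition siegel_parabolic :: "nat \<Rightarrow> complex mat set" where
  "siegel_parabolic n = {g \<in> carrier (Sp n). \<forall>i\<in>{n..<2 * n}. \<forall>j<n. g $$ (i, j) = 0}"

definition siegel_levi :: "nat \<Rightarrow> complex mat set" where
  "siegel_levi n =
     {four_block_mat A (0\<^sub>m n n) (0\<^sub>m n n)
        (antidiag n * transpose_mat (inv\<^bsub>GL n\<^esub> A) * antidiag n) | A. A \<in> carrier (GL n)}"

section \<open>Homogeneous spaces and Schubert cells\<close>

text \<open>\<open>coordinate_span n I\<close> is the span of the standard basis vectors \<open>e\<^sub>i\<close> with \<open>i \<in> I\<close>.\<close>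

definition coordinate_span :: "nat \<Rightarrow> nat set \<Rightarrow> complex vec set" where
  "coordinate_span n I =
     LinearCombinations.module.span class_ring (module_vec TYPE(complex) (2 * n))
       (unit_vec (2 * n) ` I)"

definition translate :: "complex mat \<Rightarrow> complex vec set \<Rightarrow> complex vec set" where
  "translate g W = (\<lambda>v. g *\<^sub>v v) ` W"

text \<open>
  \<open>lagrangian_of_coset\<close> is \<open>gP \<mapsto> g \<cdot> span{e\<^sub>0, \<dots>, e\<^bsub>n-1\<^esub>}\<close> and \<open>levi_projection\<close> is
  \<open>gL \<mapsto> gP\<close>, each taken as the common value over all representatives \<open>g\<close> of the coset.
  The value does not depend on the representative since \<open>P\<close> stabilizes the span and \<open>L \<subseteq> P\<close>.
\<close>

definition lagrangian_of_coset :: "nat \<Rightarrow> complex mat set \<Rightarrow> complex vec set" where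
  "lagrangian_of_coset n X = the_elem ((\<lambda>g. translate g (coordinate_span n {..<n})) ` X)"

definition levi_projection :: "nat \<Rightarrow> complex mat set \<Rightarrow> complex mat set" where
  "levi_projection n X = the_elem ((\<lambda>g. g <#\<^bsub>Sp n\<^esub> siegel_parabolic n) ` X)"

definition schubert_cell :: "nat \<Rightarrow> nat set \<Rightarrow> complex mat set set" where
  "schubert_cell n I =
     {X \<in> lcosets\<^bsub>Sp n\<^esub> siegel_parabolic n.
        lagrangian_of_coset n X \<in> (\<lambda>b. translate b (coordinate_span n I)) ` borel_subgroup n}"

section \<open>The orbit of a clan\<close>

text \<open>
  The default permutation: \<open>i\<close> and its mirror image are swapped iff the one of them lying in
  \<open>{..<n}\<close> has signature \<open>-\<close>, i.e. is a \<open>-\<close> of the base clan.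
\<close>

definition default_perm :: "nat \<Rightarrow> clan \<Rightarrow> nat \<Rightarrow> nat" where
  "default_perm n \<gamma> i =
     (if (if i < n then i else 2 * n - 1 - i) \<in> plus_positions (base_clan \<gamma>)
      then i else 2 * n - 1 - i)"

definition partner :: "clan \<Rightarrow> nat \<Rightarrow> nat" where
  "partner \<gamma> i = (THE j. (i, j) \<in> clan_pairs \<gamma> \<or> (j, i) \<in> clan_pairs \<gamma>)"

definition clan_vec :: "nat \<Rightarrow> clan \<Rightarrow> nat \<Rightarrow> complex vec" where
  "clan_vec n \<gamma> k =
     (let e = (\<lambda>i. unit_vec (2 * n) (default_perm n \<gamma> i));
          s = complex_of_real (1 / sqrt 2)
      in if k \<in> minus_positions \<gamma> then e k
         else if k \<in> plus_positions \<gamma> then (if k < n then e k else - e k)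
         else if k \<in> fst ` clan_pairs \<gamma> then
           (if k < n then s \<cdot>\<^sub>v (e k + e (partner \<gamma> k)) else - (s \<cdot>\<^sub>v (e k + e (partner \<gamma> k))))
         else s \<cdot>\<^sub>v (e (partner \<gamma> k) - e k))"

definition clan_mat :: "nat \<Rightarrow> clan \<Rightarrow> complex mat" where
  "clan_mat n \<gamma> = mat_of_cols (2 * n) (map (clan_vec n \<gamma>) [0..<2 * n])"

definition clan_orbit :: "nat \<Rightarrow> clan \<Rightarrow> complex mat set set" where
  "clan_orbit n \<gamma> =
     {(b \<otimes>\<^bsub>Sp n\<^esub> inv\<^bsub>Sp n\<^esub> clan_mat n \<gamma>) <#\<^bsub>Sp n\<^esub> siegel_levi n | b. b \<in> borel_subgroup n}"

end

theory Submission
  imports Defs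
begin

text \<open>
  Let \<open>D = diag(1, -1)\<close>. Since \<open>L\<close> is the centralizer of \<open>D\<close> in \<open>Sp\<close>, the coset \<open>g L\<close> is determined
  by \<open>g D g\<^sup>-\<^sup>1\<close>. A clan over \<open>I\<close> amounts to an involution \<open>p\<close> of the positions that commutes with the
  reflection and for which \<open>k < p k\<close> implies \<open>k \<notin> I\<close> and \<open>p k \<in> I\<close>; for \<open>g = g\<^sub>\<gamma>\<^sup>-\<^sup>1\<close> the matrix \<open>g D g\<^sup>-\<^sup>1\<close> is
  monomial with underlying permutation \<open>p\<close>. Hence the orbits are disjoint by the uniqueness part of the
  Bruhat decomposition.

  Let \<open>w\<close> be the inverse of the matrix of the clan without pairs, so that \<open>w\<close> maps the span of the first
  \<open>n\<close> basis vectors to \<open>V\<^sub>I\<close>. The fibre over \<open>C\<^sub>I\<close> consists of the cosets \<open>b w u\<^sub>S L\<close> with \<open>b \<in> B\<close> and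
  \<open>u\<^sub>S = (1 SJ; 0 1)\<close>, \<open>S\<close> symmetric. The Borel subgroup acts on \<open>S\<close> by triangular congruence (with
  respect to the order that \<open>w\<close> induces on the indices) and by translation in a staircase of entries.
  Gaussian elimination makes \<open>S\<close> monomial, and what remains of it outside the staircase is exactly a
  matching \<open>p\<close> as above.
\<close>

section \<open>The symplectic group\<close>

text \<open>The staircase is the order condition on pairs in disguise. Entry (k, l) of S corresponds
  to the positions j = \<sigma> k in I and i = 2n - 1 - \<sigma> l outside I, where \<sigma> is the
  default permutation. Here i < j means \<sigma> k + \<sigma> l \<ge> 2n, and the remaining entries
  are those that an upper triangular factor can absorb. Symmetry of S then says that the matching
  commutes with the reflection. The other obstacle is scalars: elimination controls the support of S
  but not its values, whereas a clan matrix carries fixed coefficients such as 1/sqrt 2. Over the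
  complex numbers a diagonal congruence adjusts all nonzero values of a symmetric S with at most one
  nonzero entry per row, with square roots for the diagonal entries. It is therefore enough to bring
  the inverse clan matrix to the form b w u_U l and to know the support of U. The same form shows
  that each orbit lies in the fibre.\<close>

definition form_sign :: "nat \<Rightarrow> nat \<Rightarrow> complex" where
  "form_sign n i = (if i < n then 1 else -1)"

lemma form_sign_square [simp]: "form_sign n i * form_sign n i = 1"
  by (simp add: form_sign_def)

lemma form_sign_nonzero [simp]: "form_sign n i \<noteq> 0"
  by (simp add: form_sign_def)

lemma form_sign_mirror:
  assumes "i < 2 * n"
  shows "form_sign n (2 * n - Suc i) = - form_sign n i"
  using assms by (auto simp: form_sign_def)

lemma antidiag_carrier [simp]: "antidiag n \<in> carrier_mat n n"
  by (simp add: antidiag_def)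

lemma antidiag_dim [simp]: "dim_row (antidiag n) = n" "dim_col (antidiag n) = n"
  by (simp_all add: antidiag_def)

lemma symp_form_carrier [simp]: "symp_form n \<in> carrier_mat (2 * n) (2 * n)"
  unfolding symp_form_def mult_2 by (rule four_block_carrier_mat) auto

lemma symp_form_dim [simp]: "dim_row (symp_form n) = 2 * n" "dim_col (symp_form n) = 2 * n"
  using symp_form_carrier by (rule carrier_matD)+

lemma symp_form_index:
  assumes "i < 2 * n" "j < 2 * n"
  shows "symp_form n $$ (i, j) = (if i = 2 * n - Suc j then form_sign n i else 0)"
  using assms by (auto simp: symp_form_def antidiag_def form_sign_def)

lemma index_mult_mat_sum:
  assumes "A \<in> carrier_mat a b" "B \<in> carrier_mat b c" "i < a" "j < c"
  shows "(A * B) $$ (i, j) = (\<Sum>k<b. A $$ (i, k) * B $$ (k, j))"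
  using assms by (auto simp: scalar_prod_def atLeast0LessThan intro!: sum.cong)

lemma index_mult_mat_vec_sum:
  assumes "A \<in> carrier_mat a b" "v \<in> carrier_vec b" "i < a"
  shows "(A *\<^sub>v v) $ i = (\<Sum>k<b. A $$ (i, k) * v $ k)"
  using assms by (auto simp: scalar_prod_def atLeast0LessThan intro!: sum.cong)

lemma symp_form_mult_index:
  assumes "A \<in> carrier_mat (2 * n) c" "i < 2 * n" "j < c"
  shows "(symp_form n * A) $$ (i, j) = form_sign n i * A $$ (2 * n - Suc i, j)"
proof -
  have "(symp_form n * A) $$ (i, j) = (\<Sum>k<2 * n. symp_form n $$ (i, k) * A $$ (k, j))"
    by (rule index_mult_mat_sum[OF symp_form_carrier]) (use assms in auto)
  also have "\<dots> = (\<Sum>k<2 * n. if k = 2 * n - Suc i then form_sign n i * A $$ (k, j) else 0)"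
    by (rule sum.cong) (use assms in \<open>auto simp: symp_form_index\<close>)
  finally show ?thesis using assms by simp
qed

text \<open>The sign is opposite to that of left multiplication because the nonzero entry of column
  j lies in row 2n - 1 - j, in the other half.\<close>

lemma mult_symp_form_index:
  assumes "A \<in> carrier_mat c (2 * n)" "i < c" "j < 2 * n"
  shows "(A * symp_form n) $$ (i, j) = - (form_sign n j * A $$ (i, 2 * n - Suc j))"
proof -
  have "(A * symp_form n) $$ (i, j) = (\<Sum>k<2 * n. A $$ (i, k) * symp_form n $$ (k, j))"
    by (rule index_mult_mat_sum[OF _ symp_form_carrier]) (use assms in auto)
  also have "\<dots> = (\<Sum>k<2 * n. if k = 2 * n - Suc j then - (form_sign n j * A $$ (i, k)) else 0)"
    by (rule sum.cong) (use assms in \<open>auto simp: symp_form_index form_sign_mirror\<close>)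
  finally show ?thesis using assms by simp
qed

lemma mult_carrier_square [simp]:
  "A \<in> carrier_mat m m \<Longrightarrow> B \<in> carrier_mat m m \<Longrightarrow> A * B \<in> carrier_mat m m"
  by (rule mult_carrier_mat)

lemma mult_assoc_square:
  "A \<in> carrier_mat m m \<Longrightarrow> B \<in> carrier_mat m m \<Longrightarrow> C \<in> carrier_mat m m \<Longrightarrow> A * B * C = A * (B * C)"
  by (rule assoc_mult_mat)

lemma mult_one_square [simp]:
  fixes A :: "'a :: semiring_1 mat"
  shows
  "A \<in> carrier_mat m m \<Longrightarrow> A * 1\<^sub>m m = A"
  "A \<in> carrier_mat m m \<Longrightarrow> 1\<^sub>m m * A = A"
  by auto

lemma uminus_mult_square:
  fixes A B :: "complex mat"
  assumes "A \<in> carrier_mat m m" "B \<in> carrier_mat m m"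
  shows "- A * B = - (A * B)" "A * - B = - (A * B)"
  using assms by simp_all

lemma symp_form_square: "symp_form n * symp_form n = - 1\<^sub>m (2 * n)"
proof (rule eq_matI)
  fix i j assume "i < dim_row (- 1\<^sub>m (2 * n) :: complex mat)" "j < dim_col (- 1\<^sub>m (2 * n) :: complex mat)"
  then show "(symp_form n * symp_form n) $$ (i, j) = (- 1\<^sub>m (2 * n)) $$ (i, j)"
    by (subst symp_form_mult_index) (auto simp: symp_form_index form_sign_mirror)
qed auto

lemma antidiag_square: "antidiag n * antidiag n = 1\<^sub>m n"
proof (rule eq_matI)
  fix i j assume "i < dim_row (1\<^sub>m n :: complex mat)" "j < dim_col (1\<^sub>m n :: complex mat)"
  then have ij: "i < n" "j < n" by auto
  have "(antidiag n * antidiag n) $$ (i, j) = (\<Sum>k<n. antidiag n $$ (i, k) * antidiag n $$ (k, j))"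
    by (rule index_mult_mat_sum) (use ij in auto)
  also have "\<dots> = (\<Sum>k<n. if k = n - 1 - i then (if i = j then 1 else 0) else 0)"
    by (rule sum.cong) (use ij in \<open>auto simp: antidiag_def\<close>)
  finally show "(antidiag n * antidiag n) $$ (i, j) = 1\<^sub>m n $$ (i, j)" using ij by auto
qed auto

lemma transpose_antidiag: "transpose_mat (antidiag n) = antidiag n"
  by (rule eq_matI) (auto simp: antidiag_def add.commute)

section \<open>Explicit inverses and the group structure\<close>

lemma carrier_GL:
  "g \<in> carrier (GL m) \<longleftrightarrow> g \<in> carrier_mat m m \<and> (\<exists>h \<in> carrier_mat m m. h * g = 1\<^sub>m m \<and> g * h = 1\<^sub>m m)"
  by (auto simp: GL_def units_of_carrier Units_def ring_mat_def)

text \<open>Solving g^t Omega g = Omega for the inverse gives Omega^{-1} g^t Omega, and Omega^{-1} =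
  -Omega.\<close>

definition symp_inv :: "nat \<Rightarrow> complex mat \<Rightarrow> complex mat" where
  "symp_inv n g = - (symp_form n * transpose_mat g * symp_form n)"

lemma symp_inv_carrier [simp]: "g \<in> carrier_mat (2 * n) (2 * n) \<Longrightarrow> symp_inv n g \<in> carrier_mat (2 * n) (2 * n)"
  by (simp add: symp_inv_def)

text \<open>Up to signs the inverse is the reflection of g in the antidiagonal. Shapes that are
  stable under this reflection, upper triangular or with vanishing lower left block, therefore pass
  to inverses by inspection of entries.\<close>

lemma symp_inv_index:
  assumes "g \<in> carrier_mat (2 * n) (2 * n)" "i < 2 * n" "j < 2 * n"
  shows "symp_inv n g $$ (i, j) = form_sign n i * form_sign n j * g $$ (2 * n - Suc j, 2 * n - Suc i)"
proof -
  have c: "symp_form n * transpose_mat g \<in> carrier_mat (2 * n) (2 * n)"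
    using assms by (meson mult_carrier_mat symp_form_carrier transpose_carrier_mat)
  have "(symp_form n * transpose_mat g * symp_form n) $$ (i, j) =
      - (form_sign n j * (symp_form n * transpose_mat g) $$ (i, 2 * n - Suc j))"
    by (rule mult_symp_form_index[OF c]) (use assms in auto)
  also have "(symp_form n * transpose_mat g) $$ (i, 2 * n - Suc j) =
      form_sign n i * transpose_mat g $$ (2 * n - Suc i, 2 * n - Suc j)"
    by (rule symp_form_mult_index[where c = "2 * n"]) (use assms in auto)
  finally show ?thesis using assms c by (simp add: symp_inv_def)
qed

lemma symp_inv_left:
  assumes g: "g \<in> carrier_mat (2 * n) (2 * n)"
    and s: "transpose_mat g * symp_form n * g = symp_form n"
  shows "symp_inv n g * g = 1\<^sub>m (2 * n)"
proof -
  let ?O = "symp_form n" and ?m = "2 * n"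
  have gt: "transpose_mat g \<in> carrier_mat ?m ?m" using g by simp
  have "?O * transpose_mat g * ?O * g = ?O * (transpose_mat g * ?O * g)"
    using g gt by (simp add: mult_assoc_square[of _ ?m])
  also have "\<dots> = - 1\<^sub>m ?m" by (simp add: s symp_form_square)
  finally show ?thesis
    using g gt unfolding symp_inv_def
    by (subst uminus_mult_left_mat) auto
qed

text \<open>Invertibility is automatic: the form is nondegenerate, so \<open>symp_inv\<close> is a
  left inverse, and for square matrices a left inverse is two-sided.\<close>

lemma carrier_Sp:
  "g \<in> carrier (Sp n) \<longleftrightarrow>
     g \<in> carrier_mat (2 * n) (2 * n) \<and> transpose_mat g * symp_form n * g = symp_form n"
proof -
  have "g \<in> carrier (GL (2 * n))"
    if g: "g \<in> carrier_mat (2 * n) (2 * n)" and s: "transpose_mat g * symp_form n * g = symp_form n"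
    unfolding carrier_GL using g symp_inv_left[OF g s]
      mat_mult_left_right_inverse[OF symp_inv_carrier[OF g] g] by auto
  then show ?thesis by (auto simp: Sp_def carrier_GL)
qed

lemma mult_Sp [simp]: "x \<otimes>\<^bsub>Sp n\<^esub> y = x * y"
  by (simp add: Sp_def GL_def units_of_def ring_mat_def)

lemma one_Sp [simp]: "\<one>\<^bsub>Sp n\<^esub> = 1\<^sub>m (2 * n)"
  by (simp add: Sp_def GL_def units_of_def ring_mat_def)

lemma Sp_carrier_mat: "g \<in> carrier (Sp n) \<Longrightarrow> g \<in> carrier_mat (2 * n) (2 * n)"
  by (simp add: carrier_Sp)

lemma symp_inv_right:
  assumes "g \<in> carrier (Sp n)"
  shows "g * symp_inv n g = 1\<^sub>m (2 * n)"
  using assms symp_inv_left mat_mult_left_right_inverse[OF symp_inv_carrier]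
  unfolding carrier_Sp by blast

lemma Sp_mult_closed:
  assumes "g \<in> carrier (Sp n)" "h \<in> carrier (Sp n)"
  shows "g * h \<in> carrier (Sp n)"
proof -
  let ?O = "symp_form n" and ?m = "2 * n"
  have c: "g \<in> carrier_mat ?m ?m" "h \<in> carrier_mat ?m ?m"
    "transpose_mat g \<in> carrier_mat ?m ?m" "transpose_mat h \<in> carrier_mat ?m ?m"
    using assms by (auto simp: carrier_Sp)
  have "transpose_mat (g * h) * ?O * (g * h) = transpose_mat h * (transpose_mat g * ?O * g) * h"
    using c by (simp add: transpose_mult[of _ ?m ?m _ ?m] mult_assoc_square[of _ ?m])
  then show ?thesis using assms c by (simp add: carrier_Sp)
qed

lemma symp_inv_closed:
  assumes "g \<in> carrier (Sp n)"
  shows "symp_inv n g \<in> carrier (Sp n)"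
proof -
  let ?O = "symp_form n" and ?m = "2 * n" and ?h = "symp_inv n g"
  have c: "g \<in> carrier_mat ?m ?m" "?h \<in> carrier_mat ?m ?m"
    "transpose_mat g \<in> carrier_mat ?m ?m" "transpose_mat ?h \<in> carrier_mat ?m ?m"
    using assms by (auto simp: carrier_Sp)
  have tr: "transpose_mat ?h * transpose_mat g = 1\<^sub>m ?m"
    using c by (simp add: transpose_mult[symmetric, of _ ?m ?m _ ?m] symp_inv_right[OF assms])
  have "transpose_mat ?h * ?O * ?h = transpose_mat ?h * (transpose_mat g * ?O * g) * ?h"
    using assms by (simp add: carrier_Sp)
  also have "\<dots> = (transpose_mat ?h * transpose_mat g) * ?O * (g * ?h)"
    using c by (simp add: mult_assoc_square[of _ ?m])
  also have "\<dots> = ?O" by (simp add: tr symp_inv_right[OF assms])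
  finally show ?thesis using c by (simp add: carrier_Sp)
qed

lemma group_Sp: "group (Sp n)"
proof (rule groupI)
  fix g assume g: "g \<in> carrier (Sp n)"
  then have "symp_inv n g * g = 1\<^sub>m (2 * n)" by (auto simp: carrier_Sp symp_inv_left)
  with symp_inv_closed[OF g] show "\<exists>h\<in>carrier (Sp n). h \<otimes>\<^bsub>Sp n\<^esub> g = \<one>\<^bsub>Sp n\<^esub>"
    by (metis mult_Sp one_Sp)
next
  fix x y z assume "x \<in> carrier (Sp n)" "y \<in> carrier (Sp n)" "z \<in> carrier (Sp n)"
  then show "x \<otimes>\<^bsub>Sp n\<^esub> y \<otimes>\<^bsub>Sp n\<^esub> z = x \<otimes>\<^bsub>Sp n\<^esub> (y \<otimes>\<^bsub>Sp n\<^esub> z)"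
    by (auto simp: carrier_Sp intro: assoc_mult_mat)
qed (auto simp: Sp_mult_closed, auto simp: carrier_Sp)

interpretation Sp: group "Sp n" for n
  by (rule group_Sp)

lemma inv_Sp: "g \<in> carrier (Sp n) \<Longrightarrow> inv\<^bsub>Sp n\<^esub> g = symp_inv n g"
  using symp_inv_closed symp_inv_left by (intro Sp.inv_equality) (auto simp: carrier_Sp)

section \<open>Borel, Siegel parabolic and Levi subgroups\<close>

lemma borel_index:
  "g \<in> borel_subgroup n \<longleftrightarrow>
     g \<in> carrier (Sp n) \<and> (\<forall>i<2 * n. \<forall>j<2 * n. g $$ (i, j) \<noteq> 0 \<longrightarrow> i \<le> j)"
proof -
  have "upper_triangular g \<longleftrightarrow> (\<forall>i<2 * n. \<forall>j<2 * n. g $$ (i, j) \<noteq> 0 \<longrightarrow> i \<le> j)"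
    if "g \<in> carrier_mat (2 * n) (2 * n)"
    using that unfolding upper_triangular_def
    by (metis carrier_matD(1) leD leI less_trans)
  then show ?thesis by (auto simp: borel_subgroup_def carrier_Sp)
qed

lemma subgroup_borel: "subgroup (borel_subgroup n) (Sp n)"
proof (rule Sp.subgroupI)
  have "1\<^sub>m (2 * n) \<in> borel_subgroup n" using Sp.one_closed[of n] by (auto simp: borel_index)
  then show "borel_subgroup n \<noteq> {}" by blast
next
  fix g assume g: "g \<in> borel_subgroup n"
  have "i \<le> j" if ij: "i < 2 * n" "j < 2 * n" "symp_inv n g $$ (i, j) \<noteq> 0" for i j
  proof -
    have "g $$ (2 * n - Suc j, 2 * n - Suc i) \<noteq> 0"
      using g ij by (simp add: symp_inv_index borel_index Sp_carrier_mat)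
    moreover have "2 * n - Suc j < 2 * n" "2 * n - Suc i < 2 * n" using ij by auto
    ultimately have "2 * n - Suc j \<le> 2 * n - Suc i" using g unfolding borel_index by blast
    with ij show ?thesis by linarith
  qed
  then show "inv\<^bsub>Sp n\<^esub> g \<in> borel_subgroup n"
    using g by (auto simp: borel_index inv_Sp symp_inv_closed)
next
  fix g h assume gh: "g \<in> borel_subgroup n" "h \<in> borel_subgroup n"
  have "i \<le> j" if ij: "i < 2 * n" "j < 2 * n" "(g * h) $$ (i, j) \<noteq> 0" for i j
  proof -
    have "(\<Sum>k<2 * n. g $$ (i, k) * h $$ (k, j)) \<noteq> 0"
      using index_mult_mat_sum[of g "2 * n" "2 * n" h "2 * n" i j] gh ij by (auto simp: borel_index carrier_Sp)
    then obtain k where "k < 2 * n" "g $$ (i, k) * h $$ (k, j) \<noteq> 0" by (metis (no_types, lifting) lessThan_iff sum.neutral)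
    then show ?thesis using gh ij unfolding borel_index by (metis le_trans mult_eq_0_iff)
  qed
  then show "g \<otimes>\<^bsub>Sp n\<^esub> h \<in> borel_subgroup n" using gh by (auto simp: borel_index Sp_mult_closed)
qed (auto simp: borel_index)

section \<open>Block matrices and the centralizer of the grading\<close>

lemma block_cases:
  assumes "g \<in> carrier_mat (2 * n) (2 * n)"
  obtains A B C E where "A \<in> carrier_mat n n" "B \<in> carrier_mat n n" "C \<in> carrier_mat n n" "E \<in> carrier_mat n n"
    "g = four_block_mat A B C E"
proof
  let ?sub = "\<lambda>a b. mat n n (\<lambda>(i, j). g $$ (a + i, b + j))"
  show "g = four_block_mat (?sub 0 0) (?sub 0 n) (?sub n 0) (?sub n n)"
    using assms by (intro eq_matI) auto
qed auto

lemma four_block_square_carrier [simp]: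
  "A \<in> carrier_mat n n \<Longrightarrow> E \<in> carrier_mat n n \<Longrightarrow> four_block_mat A B C E \<in> carrier_mat (2 * n) (2 * n)"
  unfolding mult_2 by (rule four_block_carrier_mat)

lemma four_block_mat_eq_iff:
  assumes "A \<in> carrier_mat n n" "B \<in> carrier_mat n n" "C \<in> carrier_mat n n" "E \<in> carrier_mat n n"
    "A' \<in> carrier_mat n n" "B' \<in> carrier_mat n n" "C' \<in> carrier_mat n n" "E' \<in> carrier_mat n n"
  shows "four_block_mat A B C E = four_block_mat A' B' C' E' \<longleftrightarrow> A = A' \<and> B = B' \<and> C = C' \<and> E = E'"
proof
  assume eq: "four_block_mat A B C E = four_block_mat A' B' C' E'"
  have idx: "four_block_mat A B C E $$ (i, j) = four_block_mat A' B' C' E' $$ (i, j)" for i j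
    by (simp add: eq)
  have "A $$ (i, j) = A' $$ (i, j) \<and> B $$ (i, j) = B' $$ (i, j) \<and> C $$ (i, j) = C' $$ (i, j) \<and>
      E $$ (i, j) = E' $$ (i, j)" if "i < n" "j < n" for i j
    using idx[of i j] idx[of i "n + j"] idx[of "n + i" j] idx[of "n + i" "n + j"] assms that by auto
  then show "A = A' \<and> B = B' \<and> C = C' \<and> E = E'"
    using assms by (intro conjI eq_matI) auto
qed simp

lemma mult_four_block_square:
  assumes "A \<in> carrier_mat n n" "B \<in> carrier_mat n n" "C \<in> carrier_mat n n" "E \<in> carrier_mat n n"
    "A' \<in> carrier_mat n n" "B' \<in> carrier_mat n n" "C' \<in> carrier_mat n n" "E' \<in> carrier_mat n n"
  shows "four_block_mat A B C E * four_block_mat A' B' C' E' =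
    four_block_mat (A * A' + B * C') (A * B' + B * E') (C * A' + E * C') (C * B' + E * E')"
  by (rule mult_four_block_mat) (use assms in auto)

lemma Sp_block_iff:
  fixes A B C E :: "complex mat"
  assumes c: "A \<in> carrier_mat n n" "B \<in> carrier_mat n n" "C \<in> carrier_mat n n" "E \<in> carrier_mat n n"
  defines "J \<equiv> antidiag n"
  shows "four_block_mat A B C E \<in> carrier (Sp n) \<longleftrightarrow>
    - (transpose_mat C * J) * A + transpose_mat A * J * C = 0\<^sub>m n n \<and>
    - (transpose_mat C * J) * B + transpose_mat A * J * E = J \<and>
    - (transpose_mat E * J) * A + transpose_mat B * J * C = - J \<and>
    - (transpose_mat E * J) * B + transpose_mat B * J * E = 0\<^sub>m n n"
proof -
  have J: "J \<in> carrier_mat n n" by (simp add: J_def)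
  have ct: "transpose_mat A \<in> carrier_mat n n" "transpose_mat B \<in> carrier_mat n n"
    "transpose_mat C \<in> carrier_mat n n" "transpose_mat E \<in> carrier_mat n n"
    using c by auto
  have "transpose_mat (four_block_mat A B C E) * symp_form n =
      four_block_mat (- (transpose_mat C * J)) (transpose_mat A * J) (- (transpose_mat E * J)) (transpose_mat B * J)"
    unfolding symp_form_def J_def[symmetric] transpose_four_block_mat[OF c]
    by (subst mult_four_block_square[where n = n]) (use c ct J in auto)
  then have "transpose_mat (four_block_mat A B C E) * symp_form n * four_block_mat A B C E =
      four_block_mat
       (- (transpose_mat C * J) * A + transpose_mat A * J * C) (- (transpose_mat C * J) * B + transpose_mat A * J * E)
       (- (transpose_mat E * J) * A + transpose_mat B * J * C) (- (transpose_mat E * J) * B + transpose_mat B * J * E)"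
    using c ct J by (simp add: mult_four_block_square[where n = n])
  then show ?thesis
    unfolding carrier_Sp using c ct J
    by (simp add: symp_form_def J_def[symmetric] four_block_mat_eq_iff[where n = n])
qed

lemma minus_add_zero_mat_iff:
  assumes "A \<in> carrier_mat a b" "B \<in> carrier_mat a b"
  shows "- A + B = 0\<^sub>m a b \<longleftrightarrow> A = (B :: complex mat)"
  using assms by (auto simp: mat_eq_iff)

lemma uminus_zero_mat: "- 0\<^sub>m a b = (0\<^sub>m a b :: complex mat)"
  by (auto simp: mat_eq_iff)

text \<open>With C = 0 the first of the four block equations is trivial, and the third is the
  negative transpose of the second.\<close>

lemma Sp_upper_block_iff:
  fixes A B E :: "complex mat"
  assumes c: "A \<in> carrier_mat n n" "B \<in> carrier_mat n n" "E \<in> carrier_mat n n"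
  defines "J \<equiv> antidiag n"
  shows "four_block_mat A B (0\<^sub>m n n) E \<in> carrier (Sp n) \<longleftrightarrow>
    transpose_mat A * J * E = J \<and> transpose_mat E * J * B = transpose_mat B * J * E"
proof -
  have J: "J \<in> carrier_mat n n" by (simp add: J_def)
  have "transpose_mat (transpose_mat A * J * E) = transpose_mat E * (J * A)"
    using c J by (simp add: transpose_mult[of _ n n _ n] J_def transpose_antidiag)
  then have tr: "transpose_mat A * J * E = J \<longleftrightarrow> transpose_mat E * J * A = J"
    using c J mult_assoc_square[of "transpose_mat E" n J A]
    by (metis J_def transpose_antidiag transpose_transpose transpose_carrier_mat)
  show ?thesis
    unfolding Sp_block_iff[OF c(1,2) zero_carrier_mat c(3)] J_def[symmetric] using tr c J
    by (simp add: uminus_zero_mat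
        minus_add_zero_mat_iff[where a = n and b = n])
qed

text \<open>Supplies the lower unipotent matrix \<open>H\<close> that straightens the block form in
  \<open>normal_form_coset\<close>.\<close>

lemma Sp_lower_unipotent:
  fixes Y :: "complex mat"
  assumes Y: "Y \<in> carrier_mat n n" and sym: "transpose_mat Y * antidiag n = antidiag n * Y"
  shows "four_block_mat (1\<^sub>m n) (0\<^sub>m n n) Y (1\<^sub>m n) \<in> carrier (Sp n)"
  unfolding Sp_block_iff[OF one_carrier_mat zero_carrier_mat Y one_carrier_mat]
  using Y by (simp add: sym minus_add_zero_mat_iff[where a = n and b = n])

definition grading :: "nat \<Rightarrow> complex mat" where
  "grading n = four_block_mat (1\<^sub>m n) (0\<^sub>m n n) (0\<^sub>m n n) (- 1\<^sub>m n)"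

lemma grading_carrier [simp]: "grading n \<in> carrier_mat (2 * n) (2 * n)"
  by (simp add: grading_def)

lemma uminus_eq_self_mat_iff: "A \<in> carrier_mat a b \<Longrightarrow> - A = A \<longleftrightarrow> A = (0\<^sub>m a b :: complex mat)"
  "A \<in> carrier_mat a b \<Longrightarrow> A = - A \<longleftrightarrow> A = (0\<^sub>m a b :: complex mat)"
  by (auto simp: mat_eq_iff)

text \<open>The two products differ by the sign of the off-diagonal blocks, and a complex matrix
  equal to its negative is zero.\<close>

lemma commute_grading_iff:
  fixes A B C E :: "complex mat"
  assumes c: "A \<in> carrier_mat n n" "B \<in> carrier_mat n n" "C \<in> carrier_mat n n" "E \<in> carrier_mat n n"
  shows "four_block_mat A B C E * grading n = grading n * four_block_mat A B C E \<longleftrightarrow>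
    B = 0\<^sub>m n n \<and> C = 0\<^sub>m n n"
  unfolding grading_def using c
  by (simp add: mult_four_block_square[where n = n] four_block_mat_eq_iff[where n = n]

      uminus_eq_self_mat_iff[where a = n and b = n])

lemma Sp_block_diag_iff:
  fixes A E :: "complex mat"
  assumes c: "A \<in> carrier_mat n n" "E \<in> carrier_mat n n"
  shows "four_block_mat A (0\<^sub>m n n) (0\<^sub>m n n) E \<in> carrier (Sp n) \<longleftrightarrow>
    transpose_mat A * antidiag n * E = antidiag n"
  using Sp_upper_block_iff[OF c(1) zero_carrier_mat c(2)] c by simp

lemma inv_GL:
  assumes "A \<in> carrier_mat n n" "A' \<in> carrier_mat n n" "A * A' = 1\<^sub>m n"
  shows "inv\<^bsub>GL n\<^esub> A = A'"
proof -
  have "A' * A = 1\<^sub>m n" by (rule mat_mult_left_right_inverse[OF assms])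
  interpret group "GL n" unfolding GL_def
    by (rule monoid.units_group) (rule ring.axioms(2)[OF ring_mat])
  show ?thesis
    by (rule inv_equality)
      (use assms \<open>A' * A = 1\<^sub>m n\<close> in \<open>auto simp: carrier_GL GL_def units_of_mult units_of_one ring_mat_simps units_of_carrier Units_def\<close>)
qed

text \<open>The symplectic condition A^t J E = J can be solved for E because J is its own inverse
  and A is invertible.\<close>

lemma Sp_levi_block_iff:
  fixes A A' E :: "complex mat"
  assumes c: "A \<in> carrier_mat n n" "A' \<in> carrier_mat n n" "E \<in> carrier_mat n n"
    and inv: "A * A' = 1\<^sub>m n"
  defines "J \<equiv> antidiag n"
  shows "four_block_mat A (0\<^sub>m n n) (0\<^sub>m n n) E \<in> carrier (Sp n) \<longleftrightarrow> E = J * transpose_mat A' * J"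
proof -
  have J: "J \<in> carrier_mat n n" and JJ: "J * J = 1\<^sub>m n" by (auto simp: J_def antidiag_square)
  have t: "transpose_mat A' * transpose_mat A = 1\<^sub>m n"
    using c inv by (simp add: transpose_mult[symmetric, of _ n n _ n])
  then have t': "transpose_mat A * transpose_mat A' = 1\<^sub>m n"
    using c mat_mult_left_right_inverse[of "transpose_mat A'" n "transpose_mat A"] by auto
  have "E = J * transpose_mat A' * J" if "transpose_mat A * J * E = J"
  proof -
    have "J * transpose_mat A' * J = J * transpose_mat A' * (transpose_mat A * J * E)" by (simp add: that)
    also have "\<dots> = J * ((transpose_mat A' * transpose_mat A) * J * E)"
      using c J by (simp add: mult_assoc_square[of _ n])
    also have "\<dots> = (J * J) * E" using c J by (simp add: t mult_assoc_square[of _ n])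
    finally show ?thesis using c by (simp add: JJ)
  qed
  moreover have "transpose_mat A * J * (J * transpose_mat A' * J) = J"
  proof -
    have "transpose_mat A * J * (J * transpose_mat A' * J) = transpose_mat A * (J * J) * transpose_mat A' * J"
      using c J by (simp add: mult_assoc_square[of _ n])
    then show ?thesis using c J by (simp add: JJ t')
  qed
  ultimately show ?thesis
    unfolding J_def using Sp_block_diag_iff[OF c(1,3)] by auto
qed

text \<open>Commuting with the grading removes the off-diagonal blocks, and the symplectic condition
  determines the second diagonal block from the first. Membership in L becomes a matrix equation,
  which makes cosets comparable.\<close>

lemma siegel_levi_centralizer:
  "siegel_levi n = {g \<in> carrier (Sp n). g * grading n = grading n * g}"
proof (rule Set.set_eqI, rule iffI)
  fix g assume "g \<in> siegel_levi n"
  then obtain A where A: "A \<in> carrier (GL n)"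
    and g: "g = four_block_mat A (0\<^sub>m n n) (0\<^sub>m n n) (antidiag n * transpose_mat (inv\<^bsub>GL n\<^esub> A) * antidiag n)"
    by (auto simp: siegel_levi_def)
  then obtain A' where A': "A' \<in> carrier_mat n n" "A * A' = 1\<^sub>m n" and Ac: "A \<in> carrier_mat n n"
    by (auto simp: carrier_GL)
  have c: "antidiag n * transpose_mat A' * antidiag n \<in> carrier_mat n n" using A' by simp
  from g show "g \<in> {g \<in> carrier (Sp n). g * grading n = grading n * g}"
    using Sp_levi_block_iff[OF Ac A'(1) c A'(2)] commute_grading_iff[OF Ac zero_carrier_mat zero_carrier_mat c]
    by (simp add: inv_GL[OF Ac A'])
next
  fix g assume "g \<in> {g \<in> carrier (Sp n). g * grading n = grading n * g}"
  then have g: "g \<in> carrier (Sp n)" "g * grading n = grading n * g" by auto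
  obtain A B C E where c: "A \<in> carrier_mat n n" "B \<in> carrier_mat n n" "C \<in> carrier_mat n n" "E \<in> carrier_mat n n"
    and gb: "g = four_block_mat A B C E"
    using Sp_carrier_mat[OF g(1)] by (rule block_cases)
  have gb: "g = four_block_mat A (0\<^sub>m n n) (0\<^sub>m n n) E"
    using g(2) unfolding gb commute_grading_iff[OF c] by simp
  let ?J = "antidiag n"
  \<comment> \<open>The transposed condition E^t J A = J, multiplied by J on the left, exhibits this
    matrix as a left inverse of A.\<close>
  define A' where "A' = ?J * transpose_mat E * ?J"
  have A'c: "A' \<in> carrier_mat n n" using c by (simp add: A'_def)
  have "transpose_mat A * ?J * E = ?J" using g(1) unfolding gb Sp_block_diag_iff[OF c(1,4)] .
  then have "transpose_mat (transpose_mat A * ?J * E) = ?J" by (simp add: transpose_antidiag)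
  then have "transpose_mat E * (?J * A) = ?J"
    using c by (simp add: transpose_mult[of _ n n _ n] transpose_antidiag)
  then have "A' * A = ?J * ?J"
    using c by (simp add: A'_def mult_assoc_square[of _ n])
  then have "A' * A = 1\<^sub>m n" by (simp add: antidiag_square)
  then have inv: "A * A' = 1\<^sub>m n" by (rule mat_mult_left_right_inverse[OF A'c c(1)])
  then have "E = ?J * transpose_mat A' * ?J"
    using g(1) Sp_levi_block_iff[OF c(1) A'c c(4)] unfolding gb by simp
  moreover have "A \<in> carrier (GL n)"
    using c A'c inv \<open>A' * A = 1\<^sub>m n\<close> by (auto simp: carrier_GL)
  ultimately show "g \<in> siegel_levi n"
    unfolding siegel_levi_def gb using inv_GL[OF c(1) A'c inv] by auto
qed

lemma siegel_parabolic_block_iff: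
  assumes "A \<in> carrier_mat n n" "B \<in> carrier_mat n n" "C \<in> carrier_mat n n" "E \<in> carrier_mat n n"
  shows "four_block_mat A B C E \<in> siegel_parabolic n \<longleftrightarrow>
    four_block_mat A B C E \<in> carrier (Sp n) \<and> C = 0\<^sub>m n n"
proof -
  have "(\<forall>i\<in>{n..<2 * n}. \<forall>j<n. four_block_mat A B C E $$ (i, j) = 0) \<longleftrightarrow> (\<forall>i<n. \<forall>j<n. C $$ (i, j) = 0)"
  proof safe
    fix i j assume *: "\<forall>i\<in>{n..<2 * n}. \<forall>j<n. four_block_mat A B C E $$ (i, j) = 0" "i < n" "j < n"
    then show "C $$ (i, j) = 0" using assms bspec[OF *(1), of "n + i"] by auto
  next
    fix i j assume *: "\<forall>i<n. \<forall>j<n. C $$ (i, j) = 0" "i \<in> {n..<2 * n}" "j < n"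
    then have "i - n < n" by auto
    with * assms show "four_block_mat A B C E $$ (i, j) = 0" by auto
  qed
  also have "\<dots> \<longleftrightarrow> C = 0\<^sub>m n n" using assms by (auto simp: mat_eq_iff)
  finally show ?thesis by (simp add: siegel_parabolic_def)
qed

lemma siegel_parabolic_Sp: "p \<in> siegel_parabolic n \<Longrightarrow> p \<in> carrier (Sp n)"
  by (simp add: siegel_parabolic_def)

lemma siegel_levi_Sp: "l \<in> siegel_levi n \<Longrightarrow> l \<in> carrier (Sp n)"
  by (simp add: siegel_levi_centralizer)

lemma borel_Sp: "b \<in> borel_subgroup n \<Longrightarrow> b \<in> carrier (Sp n)"
  by (simp add: borel_subgroup_def)

lemma siegel_parabolic_cases:
  assumes "p \<in> siegel_parabolic n"
  obtains A B E where "A \<in> carrier_mat n n" "B \<in> carrier_mat n n" "E \<in> carrier_mat n n"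
    "p = four_block_mat A B (0\<^sub>m n n) E"
  using block_cases[OF Sp_carrier_mat[OF siegel_parabolic_Sp[OF assms]]] siegel_parabolic_block_iff assms
  by metis

lemma subgroup_siegel_parabolic: "subgroup (siegel_parabolic n) (Sp n)"
proof (rule Sp.subgroupI)
  have "1\<^sub>m (2 * n) \<in> siegel_parabolic n" using Sp.one_closed[of n] by (auto simp: siegel_parabolic_def)
  then show "siegel_parabolic n \<noteq> {}" by blast
next
  fix g assume g: "g \<in> siegel_parabolic n"
  have "symp_inv n g $$ (i, j) = 0" if ij: "i \<in> {n..<2 * n}" "j < n" for i j
  proof -
    have "2 * n - Suc j \<in> {n..<2 * n}" "2 * n - Suc i < n" using ij by auto
    then show ?thesis
      using g ij by (simp add: symp_inv_index siegel_parabolic_def Sp_carrier_mat)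
  qed
  then show "inv\<^bsub>Sp n\<^esub> g \<in> siegel_parabolic n"
    using g symp_inv_closed by (auto simp: siegel_parabolic_def inv_Sp)
next
  fix g h assume gh: "g \<in> siegel_parabolic n" "h \<in> siegel_parabolic n"
  obtain A B E where c: "A \<in> carrier_mat n n" "B \<in> carrier_mat n n" "E \<in> carrier_mat n n"
    and g: "g = four_block_mat A B (0\<^sub>m n n) E"
    using gh(1) by (rule siegel_parabolic_cases)
  obtain A' B' E' where c': "A' \<in> carrier_mat n n" "B' \<in> carrier_mat n n" "E' \<in> carrier_mat n n"
    and h: "h = four_block_mat A' B' (0\<^sub>m n n) E'"
    using gh(2) by (rule siegel_parabolic_cases)
  have gh': "g * h = four_block_mat (A * A') (A * B' + B * E') (0\<^sub>m n n) (E * E')"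
    unfolding g h using c c' by (simp add: mult_four_block_square[where n = n])
  have "g * h \<in> carrier (Sp n)" using gh by (intro Sp_mult_closed siegel_parabolic_Sp)
  then show "g \<otimes>\<^bsub>Sp n\<^esub> h \<in> siegel_parabolic n"
    unfolding mult_Sp gh' using c c' by (simp add: siegel_parabolic_block_iff)
qed (auto simp: siegel_parabolic_def)

lemma siegel_levi_subset_parabolic: "siegel_levi n \<subseteq> siegel_parabolic n"
proof
  fix l assume l: "l \<in> siegel_levi n"
  then have ls: "l \<in> carrier (Sp n)" "l * grading n = grading n * l" by (auto simp: siegel_levi_centralizer)
  obtain A B C E where c: "A \<in> carrier_mat n n" "B \<in> carrier_mat n n" "C \<in> carrier_mat n n" "E \<in> carrier_mat n n"
    and lb: "l = four_block_mat A B C E"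
    using Sp_carrier_mat[OF ls(1)] by (rule block_cases)
  show "l \<in> siegel_parabolic n"
    using ls siegel_parabolic_block_iff[OF c] commute_grading_iff[OF c] unfolding lb by blast
qed

lemma subgroup_siegel_levi: "subgroup (siegel_levi n) (Sp n)"
proof (rule Sp.subgroupI)
  have "1\<^sub>m (2 * n) \<in> siegel_levi n"
    using Sp.one_closed[of n]
    by (simp add: siegel_levi_centralizer)
  then show "siegel_levi n \<noteq> {}" by blast
next
  fix g assume "g \<in> siegel_levi n"
  then have g: "g \<in> carrier (Sp n)" "g * grading n = grading n * g" by (auto simp: siegel_levi_centralizer)
  let ?h = "symp_inv n g" and ?D = "grading n" and ?m = "2 * n"
  have c: "g \<in> carrier_mat ?m ?m" "?h \<in> carrier_mat ?m ?m" "?D \<in> carrier_mat ?m ?m"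
    using g by (auto simp: Sp_carrier_mat)
  have inv: "?h * g = 1\<^sub>m ?m" "g * ?h = 1\<^sub>m ?m"
    using g(1) symp_inv_left[of g n] symp_inv_right[OF g(1)] by (auto simp: carrier_Sp)
  have "?h * ?D = ?h * (?D * g) * ?h" using c inv by (simp add: mult_assoc_square[of _ ?m])
  also have "\<dots> = (?h * g) * ?D * ?h" unfolding g(2)[symmetric] using c by (simp add: mult_assoc_square[of _ ?m])
  also have "\<dots> = ?D * ?h" using c by (simp add: inv)
  finally show "inv\<^bsub>Sp n\<^esub> g \<in> siegel_levi n"
    using g by (simp add: siegel_levi_centralizer inv_Sp symp_inv_closed)
next
  fix g h assume "g \<in> siegel_levi n" "h \<in> siegel_levi n"
  then have g: "g \<in> carrier (Sp n)" "g * grading n = grading n * g"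
    and h: "h \<in> carrier (Sp n)" "h * grading n = grading n * h" by (auto simp: siegel_levi_centralizer)
  let ?D = "grading n" and ?m = "2 * n"
  have c: "g \<in> carrier_mat ?m ?m" "h \<in> carrier_mat ?m ?m" "?D \<in> carrier_mat ?m ?m"
    using g h by (auto simp: Sp_carrier_mat)
  have "g * h * ?D = g * ?D * h" using c by (simp add: mult_assoc_square[of _ ?m] h(2))
  also have "\<dots> = ?D * (g * h)" using c by (simp add: g(2) mult_assoc_square[of _ ?m])
  finally show "g \<otimes>\<^bsub>Sp n\<^esub> h \<in> siegel_levi n"
    using g h by (simp add: siegel_levi_centralizer Sp_mult_closed)
qed (auto simp: siegel_levi_centralizer)

section \<open>Levi decomposition of the Siegel parabolic\<close>

text \<open>The factor J turns the symplectic condition on the upper right block into plain symmetry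
  of S, and conjugation by the Levi factor into congruence.\<close>

definition unip :: "nat \<Rightarrow> complex mat \<Rightarrow> complex mat" where
  "unip n S = four_block_mat (1\<^sub>m n) (S * antidiag n) (0\<^sub>m n n) (1\<^sub>m n)"

text \<open>The second matrix stands for the inverse of A. It is kept as an argument so that its
  triangularity can be assumed alongside that of A.\<close>

definition levi_mat :: "nat \<Rightarrow> complex mat \<Rightarrow> complex mat \<Rightarrow> complex mat" where
  "levi_mat n A A' = four_block_mat A (0\<^sub>m n n) (0\<^sub>m n n) (antidiag n * transpose_mat A' * antidiag n)"

lemma unip_Sp:
  assumes "S \<in> carrier_mat n n" "transpose_mat S = S"
  shows "unip n S \<in> carrier (Sp n)"
proof -
  have c: "S * antidiag n \<in> carrier_mat n n" using assms by simp
  show ?thesis unfolding unip_def Sp_upper_block_iff[OF one_carrier_mat c one_carrier_mat]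
    using assms by (simp add: transpose_mult[of _ n n _ n] transpose_antidiag mult_assoc_square[of _ n])
qed

lemma unip_carrier: "S \<in> carrier_mat n n \<Longrightarrow> unip n S \<in> carrier_mat (2 * n) (2 * n)"
  by (simp add: unip_def)

lemma unip_mult:
  assumes "S \<in> carrier_mat n n" "T \<in> carrier_mat n n"
  shows "unip n S * unip n T = unip n (S + T)"
proof -
  have "S * antidiag n + T * antidiag n = T * antidiag n + S * antidiag n"
    using assms by (intro comm_add_mat[of _ n n]) auto
  then show ?thesis
    unfolding unip_def using assms
    by (simp add: mult_four_block_square[where n = n] add_mult_distrib_mat[OF assms antidiag_carrier])
qed

lemma levi_mat_Sp:
  assumes "A \<in> carrier_mat n n" "A' \<in> carrier_mat n n" "A * A' = 1\<^sub>m n"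
  shows "levi_mat n A A' \<in> carrier (Sp n)"
  unfolding levi_mat_def using Sp_levi_block_iff[OF assms(1,2) _ assms(3)] assms by simp

lemma levi_mat_in_levi:
  assumes "A \<in> carrier_mat n n" "A' \<in> carrier_mat n n" "A * A' = 1\<^sub>m n"
  shows "levi_mat n A A' \<in> siegel_levi n"
proof -
  have "antidiag n * transpose_mat A' * antidiag n \<in> carrier_mat n n" using assms by simp
  then show ?thesis
    using levi_mat_Sp[OF assms] commute_grading_iff[OF assms(1) zero_carrier_mat zero_carrier_mat]
    unfolding siegel_levi_centralizer levi_mat_def by simp
qed

text \<open>Conjugation of the unipotent radical by the Levi factor: this is where the congruence
  action on S comes from.\<close>

lemma levi_mat_unip:
  assumes c: "A \<in> carrier_mat n n" "A' \<in> carrier_mat n n" and inv: "A * A' = 1\<^sub>m n" and S: "S \<in> carrier_mat n n"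
  shows "levi_mat n A A' * unip n S = unip n (A * S * transpose_mat A) * levi_mat n A A'"
proof -
  let ?J = "antidiag n"
  have JJ: "?J * (?J * X) = X" if "X \<in> carrier_mat n n" for X
    using that by (simp add: mult_assoc_square[of _ n, symmetric] antidiag_square)
  have "A' * A = 1\<^sub>m n" by (rule mat_mult_left_right_inverse[OF c inv])
  then have t: "transpose_mat A * transpose_mat A' = 1\<^sub>m n"
    using c by (simp add: transpose_mult[symmetric, of _ n n _ n])
  then have t': "transpose_mat A * (transpose_mat A' * X) = X" if "X \<in> carrier_mat n n" for X
    using c that by (simp add: mult_assoc_square[of _ n, symmetric])
  show ?thesis
    unfolding levi_mat_def unip_def using c S
    by (simp add: mult_four_block_square[where n = n] four_block_mat_eq_iff[where n = n]
        mult_assoc_square[of _ n] JJ t')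
qed

lemma siegel_parabolic_decomp:
  assumes "p \<in> siegel_parabolic n"
  obtains S l where "S \<in> carrier_mat n n" "transpose_mat S = S" "l \<in> siegel_levi n" "p = unip n S * l"
proof -
  obtain A B E where c: "A \<in> carrier_mat n n" "B \<in> carrier_mat n n" "E \<in> carrier_mat n n"
    and p: "p = four_block_mat A B (0\<^sub>m n n) E"
    using assms by (rule siegel_parabolic_cases)
  let ?J = "antidiag n" and ?T = transpose_mat
  have eqs: "?T A * ?J * E = ?J" "?T E * ?J * B = ?T B * ?J * E"
    using siegel_parabolic_Sp[OF assms] unfolding p Sp_upper_block_iff[OF c] by auto
  have J: "?J \<in> carrier_mat n n" by simp
  have ct: "?T A \<in> carrier_mat n n" "?T B \<in> carrier_mat n n" "?T E \<in> carrier_mat n n" using c by auto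
  note ac = mult_assoc_square[of _ n]
  have JJ: "?J * (?J * X) = X" if "X \<in> carrier_mat n n" for X
    using that by (simp add: ac[symmetric] antidiag_square)
  have tAE: "?T E * (?J * A) = ?J"
    using arg_cong[OF eqs(1), of ?T] c by (simp add: transpose_mult[of _ n n _ n] transpose_antidiag)
  have "?J * ?T A * ?J * E = 1\<^sub>m n"
    using c J ct eqs(1) by (simp add: ac antidiag_square)
  then have "E * (?J * ?T A * ?J) = 1\<^sub>m n"
    by (rule mat_mult_left_right_inverse[rotated 2]) (use c J ct in auto)
  then have "?J * (E * (?J * ?T A * ?J)) * ?J = ?J * 1\<^sub>m n * ?J" by simp
  then have EA: "?J * (E * (?J * ?T A)) = 1\<^sub>m n"
    using c J ct by (simp add: ac antidiag_square)
  have "?T E * (?J * A * ?J) = 1\<^sub>m n"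
    using c J ct arg_cong[OF tAE, of "\<lambda>X. X * ?J"] by (simp add: ac antidiag_square)
  then have "?J * A * ?J * ?T E = 1\<^sub>m n"
    by (rule mat_mult_left_right_inverse[rotated 2]) (use c J ct in auto)
  then have "?J * (?J * A * ?J * ?T E) = ?J * 1\<^sub>m n" by simp
  then have AE: "A * (?J * ?T E) = ?J"
    using c J ct by (simp add: ac JJ)
  \<comment> \<open>Splitting off the diagonal part forces S J = B E^{-1}, and A^t J E = J gives
    E^{-1} = J A^t J.\<close>
  define S where "S = B * ?J * ?T A"
  have Sc: "S \<in> carrier_mat n n" using c J ct by (simp add: S_def)
  have "?T S = A * (?J * ?T B)"
    using c J ct by (simp add: S_def transpose_mult[of _ n n _ n] transpose_antidiag)
  \<comment> \<open>Inserting J E J A^t = 1 produces the factor B^t J E, which the symplectic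
    relation exchanges for E^t J B; the relation A J E^t = J then removes A.\<close>
  also have "\<dots> = A * (?J * ?T B) * (?J * (E * (?J * ?T A)))"
    unfolding EA using c J ct by simp
  also have "\<dots> = A * ?J * (?T B * ?J * E) * (?J * ?T A)"
    using c J ct by (simp add: ac)
  also have "\<dots> = (A * (?J * ?T E)) * ?J * B * (?J * ?T A)"
    unfolding eqs(2)[symmetric] using c J ct by (simp add: ac)
  also have "\<dots> = S"
    unfolding AE using c J ct by (simp add: S_def ac JJ)
  finally have "?T S = S" .
  moreover have "four_block_mat A (0\<^sub>m n n) (0\<^sub>m n n) E \<in> siegel_levi n"
    using eqs(1) commute_grading_iff[OF c(1) zero_carrier_mat zero_carrier_mat c(3)]
    by (simp add: siegel_levi_centralizer Sp_block_diag_iff[OF c(1,3)])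
  moreover have "S * (?J * E) = B"
    using c J ct eqs(1) by (simp add: S_def ac antidiag_square)
  then have "p = unip n S * four_block_mat A (0\<^sub>m n n) (0\<^sub>m n n) E"
    unfolding p unip_def using c J Sc
    by (simp add: mult_four_block_square[where n = n] ac)
  ultimately show ?thesis using that Sc by blast
qed

section \<open>Coordinate subspaces and the stabilizer of the base Lagrangian\<close>

lemma coordinate_span_eq:
  assumes "I \<subseteq> {..<2 * n}"
  shows "coordinate_span n I = {v \<in> carrier_vec (2 * n). \<forall>i<2 * n. i \<notin> I \<longrightarrow> v $ i = 0}"
proof -
  interpret V: vec_space "TYPE(complex)" "2 * n" .
  let ?u = "unit_vec (2 * n) :: nat \<Rightarrow> complex vec"
  have fin: "finite (?u ` I)" using assms finite_subset by blast
  have car: "?u ` I \<subseteq> carrier_vec (2 * n)" by auto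
  \<comment> \<open>Coefficients of a linear combination are functions of the vector and not of its
    index, so they have to be carried along this injection.\<close>
  have inj: "inj_on ?u I"
  proof (rule inj_onI)
    fix i j assume "i \<in> I" "j \<in> I" "?u i = ?u j"
    moreover from this have "?u i $ i = ?u j $ i" by simp
    ultimately show "i = j" using assms by (auto split: if_splits)
  qed
  have idx: "V.lincomb a (?u ` I) $ i = (if i \<in> I then a (?u i) else 0)" if "i < 2 * n" for a i
  proof -
    have "V.lincomb a (?u ` I) $ i = (\<Sum>x\<in>?u ` I. a x * x $ i)"
      by (rule V.lincomb_index[OF that car])
    also have "\<dots> = (\<Sum>j\<in>I. a (?u j) * ?u j $ i)" by (simp add: sum.reindex[OF inj])
    also have "\<dots> = (\<Sum>j\<in>I. if j = i then a (?u i) else 0)"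
      by (rule sum.cong) (use that assms in auto)
    finally show ?thesis using assms finite_subset[OF assms] by (simp add: sum.delta)
  qed
  have span: "coordinate_span n I = {V.lincomb a (?u ` I) | a. True}"
    unfolding coordinate_span_def using V.finite_span[OF fin] car by auto
  show ?thesis
  proof safe
    fix v assume v: "v \<in> coordinate_span n I"
    then obtain a where a: "v = V.lincomb a (?u ` I)" unfolding span by blast
    show "v \<in> carrier_vec (2 * n)" unfolding a by (rule V.lincomb_closed) (use car in auto)
    show "v $ i = 0" if "i < 2 * n" "i \<notin> I" for i using that by (simp add: a idx)
  next
    fix v :: "complex vec" assume v: "v \<in> carrier_vec (2 * n)" "\<forall>i<2 * n. i \<notin> I \<longrightarrow> v $ i = 0"
    let ?a = "\<lambda>x. v $ the_inv_into I ?u x"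
    have "v = V.lincomb ?a (?u ` I)"
    proof (rule eq_vecI)
      show "dim_vec v = dim_vec (V.lincomb ?a (?u ` I))"
        using V.lincomb_dim[OF fin car] v(1) by simp
      fix i assume "i < dim_vec (V.lincomb ?a (?u ` I))"
      then have "i < 2 * n" using V.lincomb_dim[OF fin car] by simp
      then show "v $ i = V.lincomb ?a (?u ` I) $ i"
        using v(2) by (simp add: idx the_inv_into_f_f[OF inj])
    qed
    then show "v \<in> coordinate_span n I" unfolding span by blast
  qed
qed

lemma translate_mult:
  assumes "g \<in> carrier_mat (2 * n) (2 * n)" "h \<in> carrier_mat (2 * n) (2 * n)" "W \<subseteq> carrier_vec (2 * n)"
  shows "translate (g * h) W = translate g (translate h W)"
  unfolding translate_def image_image using assms
  by (intro image_cong) (auto simp: assoc_mult_mat_vec[of _ "2 * n" "2 * n" _ "2 * n"])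

lemma coordinate_span_carrier: "I \<subseteq> {..<2 * n} \<Longrightarrow> coordinate_span n I \<subseteq> carrier_vec (2 * n)"
  by (auto simp: coordinate_span_eq)

lemma translate_siegel_iff:
  assumes p: "p \<in> carrier (Sp n)"
  shows "translate p (coordinate_span n {..<n}) = coordinate_span n {..<n} \<longleftrightarrow> p \<in> siegel_parabolic n"
proof
  have sub: "{..<n} \<subseteq> {..<2 * n}" by auto
  {
    assume eq: "translate p (coordinate_span n {..<n}) = coordinate_span n {..<n}"
    have "p $$ (i, j) = 0" if ij: "i \<in> {n..<2 * n}" "j < n" for i j
    proof -
      have "unit_vec (2 * n) j \<in> coordinate_span n {..<n}"
        using ij by (auto simp: coordinate_span_eq[OF sub])
      then have "p *\<^sub>v unit_vec (2 * n) j \<in> coordinate_span n {..<n}"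
        using eq unfolding translate_def by blast
      then have "(p *\<^sub>v unit_vec (2 * n) j) $ i = 0"
        using ij by (auto simp: coordinate_span_eq[OF sub])
      then show ?thesis using p ij by (auto simp: carrier_Sp)
    qed
    then show "p \<in> siegel_parabolic n" using p by (simp add: siegel_parabolic_def)
  }
  have incl: "q *\<^sub>v v \<in> coordinate_span n {..<n}"
    if q: "q \<in> siegel_parabolic n" and v: "v \<in> coordinate_span n {..<n}" for q v
  proof -
    have qc: "q \<in> carrier_mat (2 * n) (2 * n)" using q by (simp add: siegel_parabolic_def carrier_Sp)
    have vc: "v \<in> carrier_vec (2 * n)" using v coordinate_span_carrier[OF sub] by auto
    have "(q *\<^sub>v v) $ i = 0" if "i < 2 * n" "i \<ge> n" for i
    proof -
      have "(q *\<^sub>v v) $ i = (\<Sum>j<2 * n. q $$ (i, j) * v $ j)"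
        by (rule index_mult_mat_vec_sum[OF qc vc that(1)])
      also have "\<dots> = 0"
      proof (rule sum.neutral, rule ballI)
        fix j assume "j \<in> {..<2 * n}"
        then show "q $$ (i, j) * v $ j = 0"
          using q v that by (cases "j < n") (auto simp: siegel_parabolic_def coordinate_span_eq[OF sub])
      qed
      finally show ?thesis .
    qed
    then show ?thesis using qc vc by (auto simp: coordinate_span_eq[OF sub])
  qed
  assume pp: "p \<in> siegel_parabolic n"
  show "translate p (coordinate_span n {..<n}) = coordinate_span n {..<n}"
  proof
    show "translate p (coordinate_span n {..<n}) \<subseteq> coordinate_span n {..<n}"
      using incl[OF pp] by (auto simp: translate_def)
    show "coordinate_span n {..<n} \<subseteq> translate p (coordinate_span n {..<n})"
    proof
      fix v assume v: "v \<in> coordinate_span n {..<n}"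
      let ?q = "symp_inv n p"
      \<comment> \<open>The inverse also preserves the span, which upgrades the inclusion to an
        equality.\<close>
      have "?q \<in> siegel_parabolic n"
        using subgroup.m_inv_closed[OF subgroup_siegel_parabolic pp] by (simp add: inv_Sp p)
      then have "?q *\<^sub>v v \<in> coordinate_span n {..<n}" using incl v by blast
      moreover have "p *\<^sub>v (?q *\<^sub>v v) = v"
        using p v coordinate_span_carrier[OF sub] symp_inv_right[OF p]
        by (subst assoc_mult_mat_vec[symmetric, of _ "2 * n" "2 * n" _ "2 * n"]) (auto simp: carrier_Sp)
      ultimately show "v \<in> translate p (coordinate_span n {..<n})"
        unfolding translate_def by (metis image_eqI)
    qed
  qed
qed

section \<open>Cosets of the Levi subgroup and Schubert cells\<close>

lemma lcos_eq_iff: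
  assumes "group G" "subgroup H G" "g \<in> carrier G" "h \<in> carrier G"
  shows "g <#\<^bsub>G\<^esub> H = h <#\<^bsub>G\<^esub> H \<longleftrightarrow> (\<exists>l\<in>H. g = h \<otimes>\<^bsub>G\<^esub> l)"
proof -
  interpret group G by fact
  show ?thesis
  proof
    assume "g <#\<^bsub>G\<^esub> H = h <#\<^bsub>G\<^esub> H"
    then have "g \<in> h <#\<^bsub>G\<^esub> H" using lcos_self[OF assms(3,2)] by simp
    then show "\<exists>l\<in>H. g = h \<otimes>\<^bsub>G\<^esub> l" by (auto simp: l_coset_def)
  next
    assume "\<exists>l\<in>H. g = h \<otimes>\<^bsub>G\<^esub> l"
    then have "g \<in> h <#\<^bsub>G\<^esub> H" by (auto simp: l_coset_def)
    then show "g <#\<^bsub>G\<^esub> H = h <#\<^bsub>G\<^esub> H" using l_repr_independence assms by metis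
  qed
qed

lemmas levi_coset_eq_iff = lcos_eq_iff[OF group_Sp subgroup_siegel_levi, unfolded mult_Sp]
lemmas parabolic_coset_eq_iff = lcos_eq_iff[OF group_Sp subgroup_siegel_parabolic, unfolded mult_Sp]

text \<open>The hypotheses say X = g D g^{-1} = h D h^{-1} without mentioning inverses. Then h^{-1}
  g commutes with D, so it lies in L.\<close>

lemma levi_coset_eqI:
  assumes g: "g \<in> carrier (Sp n)" and h: "h \<in> carrier (Sp n)" and X: "X \<in> carrier_mat (2 * n) (2 * n)"
    and gX: "X * g = g * grading n" and hX: "X * h = h * grading n"
  shows "g <#\<^bsub>Sp n\<^esub> siegel_levi n = h <#\<^bsub>Sp n\<^esub> siegel_levi n"
proof -
  let ?k = "symp_inv n h" and ?D = "grading n" and ?m = "2 * n"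
  have c: "g \<in> carrier_mat ?m ?m" "h \<in> carrier_mat ?m ?m" "?k \<in> carrier_mat ?m ?m" "?D \<in> carrier_mat ?m ?m"
    using g h by (auto simp: Sp_carrier_mat)
  note ac = mult_assoc_square[of _ ?m]
  have inv: "?k * h = 1\<^sub>m ?m" "h * ?k = 1\<^sub>m ?m"
    using h symp_inv_left[of h n] symp_inv_right[OF h] by (auto simp: carrier_Sp)
  have kX: "?k * X = ?D * ?k"
  proof -
    have "?k * X = ?k * (X * h) * ?k" using c X by (simp add: ac inv)
    also have "\<dots> = (?k * h) * ?D * ?k" unfolding hX using c by (simp add: ac)
    finally show ?thesis using c by (simp add: inv)
  qed
  have "?k * g * ?D = ?k * (X * g)" using c by (simp add: ac gX)
  also have "\<dots> = (?k * X) * g" using c X by (simp add: ac)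
  also have "\<dots> = ?D * (?k * g)" using c by (simp add: kX ac)
  finally have "?k * g \<in> siegel_levi n"
    using Sp_mult_closed[OF symp_inv_closed[OF h] g] by (simp add: siegel_levi_centralizer)
  moreover have "g = h * (?k * g)"
    using c by (simp add: ac[symmetric] inv)
  ultimately show ?thesis using levi_coset_eq_iff[OF g h] by blast
qed

text \<open>Converse direction: changing the representative by an element commuting with D leaves
  the conjugate of D unchanged.\<close>

lemma levi_coset_eqD:
  assumes g: "g \<in> carrier (Sp n)" and h: "h \<in> carrier (Sp n)" and X: "X \<in> carrier_mat (2 * n) (2 * n)"
    and eq: "g <#\<^bsub>Sp n\<^esub> siegel_levi n = h <#\<^bsub>Sp n\<^esub> siegel_levi n" and hX: "X * h = h * grading n"
  shows "X * g = g * grading n"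
proof -
  obtain l where l: "l \<in> siegel_levi n" "g = h * l" using eq levi_coset_eq_iff[OF g h] by auto
  have c: "h \<in> carrier_mat (2 * n) (2 * n)" "l \<in> carrier_mat (2 * n) (2 * n)"
    using h l by (auto simp: Sp_carrier_mat siegel_levi_Sp)
  have "l * grading n = grading n * l" using l by (simp add: siegel_levi_centralizer)
  have "X * g = (X * h) * l" unfolding l using c X by (simp add: mult_assoc_square[of _ "2 * n"])
  also have "\<dots> = h * (l * grading n)"
    unfolding hX \<open>l * grading n = grading n * l\<close> using c by (simp add: mult_assoc_square[of _ "2 * n"])
  finally show ?thesis unfolding l using c by (simp add: mult_assoc_square[of _ "2 * n"])
qed

section \<open>The projection to G/P and the Schubert cell condition\<close>

lemma levi_projection_coset:
  assumes g: "g \<in> carrier (Sp n)"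
  shows "levi_projection n (g <#\<^bsub>Sp n\<^esub> siegel_levi n) = g <#\<^bsub>Sp n\<^esub> siegel_parabolic n"
proof -
  have "h <#\<^bsub>Sp n\<^esub> siegel_parabolic n = g <#\<^bsub>Sp n\<^esub> siegel_parabolic n"
    if h: "h \<in> g <#\<^bsub>Sp n\<^esub> siegel_levi n" for h
  proof -
    obtain l where "l \<in> siegel_levi n" "h = g * l" using h by (auto simp: l_coset_def)
    then show ?thesis
      using parabolic_coset_eq_iff[OF _ g, of h] siegel_levi_subset_parabolic g
      by (auto intro: Sp_mult_closed siegel_levi_Sp)
  qed
  moreover have "g <#\<^bsub>Sp n\<^esub> siegel_levi n \<noteq> {}"
    using Sp.lcos_self[OF g subgroup_siegel_levi] by blast
  ultimately show ?thesis
    unfolding levi_projection_def by (intro the_elem_image_unique)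
qed

abbreviation base_lagrangian :: "nat \<Rightarrow> complex vec set" where
  "base_lagrangian n \<equiv> coordinate_span n {..<n}"

lemma base_lagrangian_carrier: "base_lagrangian n \<subseteq> carrier_vec (2 * n)"
  by (rule coordinate_span_carrier) auto

lemma lagrangian_of_coset_eq:
  assumes g: "g \<in> carrier (Sp n)"
  shows "lagrangian_of_coset n (g <#\<^bsub>Sp n\<^esub> siegel_parabolic n) = translate g (base_lagrangian n)"
proof -
  have "translate h (base_lagrangian n) = translate g (base_lagrangian n)"
    if h: "h \<in> g <#\<^bsub>Sp n\<^esub> siegel_parabolic n" for h
  proof -
    obtain p where p: "p \<in> siegel_parabolic n" "h = g * p" using h by (auto simp: l_coset_def)
    from p(1) have "translate h (base_lagrangian n) = translate g (translate p (base_lagrangian n))"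
      unfolding p(2)
      by (intro translate_mult[OF Sp_carrier_mat[OF g] Sp_carrier_mat] base_lagrangian_carrier siegel_parabolic_Sp)
    then show ?thesis using p translate_siegel_iff[OF siegel_parabolic_Sp[OF p(1)]] by simp
  qed
  moreover have "g <#\<^bsub>Sp n\<^esub> siegel_parabolic n \<noteq> {}"
    using Sp.lcos_self[OF g subgroup_siegel_parabolic] by blast
  ultimately show ?thesis
    unfolding lagrangian_of_coset_def by (intro the_elem_image_unique)
qed

lemma translate_eq_iff:
  assumes g: "g \<in> carrier (Sp n)" and h: "h \<in> carrier (Sp n)"
  shows "translate g (base_lagrangian n) = translate h (base_lagrangian n) \<longleftrightarrow>
    (\<exists>p\<in>siegel_parabolic n. g = h * p)"
proof
  let ?k = "symp_inv n h" and ?m = "2 * n" and ?V = "base_lagrangian n"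
  have c: "g \<in> carrier_mat ?m ?m" "h \<in> carrier_mat ?m ?m" "?k \<in> carrier_mat ?m ?m"
    using g h by (auto simp: Sp_carrier_mat)
  have inv: "?k * h = 1\<^sub>m ?m" "h * ?k = 1\<^sub>m ?m"
    using h symp_inv_left[of h n] symp_inv_right[OF h] by (auto simp: carrier_Sp)
  {
    assume eq: "translate g ?V = translate h ?V"
    have "translate (?k * g) ?V = translate ?k (translate g ?V)"
      by (rule translate_mult[OF c(3,1) base_lagrangian_carrier])
    also have "\<dots> = translate (?k * h) ?V"
      unfolding eq by (rule translate_mult[OF c(3,2) base_lagrangian_carrier, symmetric])
    also have "\<dots> = ?V" using base_lagrangian_carrier[of n] by (force simp: inv translate_def)
    finally have "?k * g \<in> siegel_parabolic n"
      using translate_siegel_iff[OF Sp_mult_closed[OF symp_inv_closed[OF h] g]] by simp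
    moreover have "g = h * (?k * g)"
      using c by (simp add: mult_assoc_square[of _ ?m, symmetric] inv)
    ultimately show "\<exists>p\<in>siegel_parabolic n. g = h * p" by blast
  }
  assume "\<exists>p\<in>siegel_parabolic n. g = h * p"
  then obtain p where p: "p \<in> siegel_parabolic n" "g = h * p" by blast
  from p(1) have "translate g ?V = translate h (translate p ?V)"
    unfolding p(2)
    by (intro translate_mult[OF Sp_carrier_mat[OF h] Sp_carrier_mat] base_lagrangian_carrier siegel_parabolic_Sp)
  then show "translate g ?V = translate h ?V" using p translate_siegel_iff[OF siegel_parabolic_Sp[OF p(1)]] by simp
qed

text \<open>Turns the geometric condition into membership of g in the double coset B w P, so that
  the remaining work concerns matrices only.\<close>

lemma levi_projection_schubert_iff:
  assumes g: "g \<in> carrier (Sp n)" and w: "w \<in> carrier (Sp n)"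
    and wI: "translate w (base_lagrangian n) = coordinate_span n I"
  shows "levi_projection n (g <#\<^bsub>Sp n\<^esub> siegel_levi n) \<in> schubert_cell n I \<longleftrightarrow>
    (\<exists>b\<in>borel_subgroup n. \<exists>p\<in>siegel_parabolic n. g = b * w * p)"
proof -
  have "g <#\<^bsub>Sp n\<^esub> siegel_parabolic n \<in> lcosets\<^bsub>Sp n\<^esub> siegel_parabolic n"
    using g by (auto simp: LCOSETS_def)
  then have "levi_projection n (g <#\<^bsub>Sp n\<^esub> siegel_levi n) \<in> schubert_cell n I \<longleftrightarrow>
      (\<exists>b\<in>borel_subgroup n. translate g (base_lagrangian n) = translate b (coordinate_span n I))"
    by (auto simp: schubert_cell_def levi_projection_coset[OF g] lagrangian_of_coset_eq[OF g])
  also have "\<dots> \<longleftrightarrow> (\<exists>b\<in>borel_subgroup n. \<exists>p\<in>siegel_parabolic n. g = b * w * p)"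
  proof (rule bex_cong[OF refl])
    fix b assume "b \<in> borel_subgroup n"
    then have b: "b \<in> carrier (Sp n)" by (rule borel_Sp)
    have "translate b (coordinate_span n I) = translate (b * w) (base_lagrangian n)"
      unfolding wI[symmetric] using b w base_lagrangian_carrier
      by (intro translate_mult[symmetric] Sp_carrier_mat)
    then show "translate g (base_lagrangian n) = translate b (coordinate_span n I) \<longleftrightarrow>
        (\<exists>p\<in>siegel_parabolic n. g = b * w * p)"
      using translate_eq_iff[OF g Sp_mult_closed[OF b w]] by simp
  qed
  finally show ?thesis .
qed

section \<open>Triangular congruence of symmetric matrices\<close>

text \<open>Upper triangularity after the indices are ordered by r. The ranking stays abstract here
  and is later the default permutation \<open>\<sigma>\<close>.\<close>

definition rank_triangular :: "nat \<Rightarrow> (nat \<Rightarrow> nat) \<Rightarrow> complex mat \<Rightarrow> bool" where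
  "rank_triangular n r A \<longleftrightarrow>
     A \<in> carrier_mat n n \<and> (\<forall>k<n. \<forall>l<n. A $$ (k, l) \<noteq> 0 \<longrightarrow> r k \<le> r l)"

text \<open>Triangularity of the inverse is part of the definition because a Levi element contains A
  in one block and a reflected copy of its inverse in the other.\<close>

definition triangular_congruent :: "nat \<Rightarrow> (nat \<Rightarrow> nat) \<Rightarrow> complex mat \<Rightarrow> complex mat \<Rightarrow> bool" where
  "triangular_congruent n r S T \<longleftrightarrow>
     (\<exists>A A'. rank_triangular n r A \<and> rank_triangular n r A' \<and> A * A' = 1\<^sub>m n \<and> T = A * S * transpose_mat A)"

lemma rank_triangular_mult:
  assumes "rank_triangular n r A" "rank_triangular n r B"
  shows "rank_triangular n r (A * B)"
proof -
  have c: "A \<in> carrier_mat n n" "B \<in> carrier_mat n n" using assms by (auto simp: rank_triangular_def)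
  have "r k \<le> r l" if kl: "k < n" "l < n" "(A * B) $$ (k, l) \<noteq> 0" for k l
  proof -
    have "(\<Sum>m<n. A $$ (k, m) * B $$ (m, l)) \<noteq> 0"
      using index_mult_mat_sum[OF c kl(1,2)] kl(3) by simp
    then obtain m where m: "m < n" "A $$ (k, m) * B $$ (m, l) \<noteq> 0"
      by (metis (no_types, lifting) lessThan_iff sum.neutral)
    then have "r k \<le> r m" "r m \<le> r l" using assms kl by (auto simp: rank_triangular_def)
    then show ?thesis by simp
  qed
  then show ?thesis using c by (simp add: rank_triangular_def)
qed

lemma triangular_congruent_refl:
  "S \<in> carrier_mat n n \<Longrightarrow> triangular_congruent n r S S"
  unfolding triangular_congruent_def
  by (intro exI[of _ "1\<^sub>m n"]) (auto simp: rank_triangular_def)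

lemma triangular_congruent_trans:
  assumes S: "S \<in> carrier_mat n n" and "triangular_congruent n r S T" "triangular_congruent n r T U"
  shows "triangular_congruent n r S U"
proof -
  obtain A A' where A: "rank_triangular n r A" "rank_triangular n r A'" "A * A' = 1\<^sub>m n"
    and T: "T = A * S * transpose_mat A"
    using assms(2) by (auto simp: triangular_congruent_def)
  obtain B B' where B: "rank_triangular n r B" "rank_triangular n r B'" "B * B' = 1\<^sub>m n"
    and U: "U = B * T * transpose_mat B"
    using assms(3) by (auto simp: triangular_congruent_def)
  have c: "A \<in> carrier_mat n n" "A' \<in> carrier_mat n n" "B \<in> carrier_mat n n" "B' \<in> carrier_mat n n"
    using A B by (auto simp: rank_triangular_def)
  have "(B * A) * (A' * B') = B * (A * A') * B'" using c by (simp add: mult_assoc_square[of _ n])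
  then have "(B * A) * (A' * B') = 1\<^sub>m n" using c by (simp add: A B)
  moreover have "U = (B * A) * S * transpose_mat (B * A)"
    unfolding U T using c S by (simp add: transpose_mult[of _ n n _ n] mult_assoc_square[of _ n])
  ultimately show ?thesis
    unfolding triangular_congruent_def using A B rank_triangular_mult by blast
qed

text \<open>Adding multiples of row p, and likewise of column p, to those of smaller rank. The
  strict inequality forces x p = 0, so the elementary matrix of -x is the inverse of that of
  x.\<close>

lemma triangular_congruent_transvection:
  fixes x :: "nat \<Rightarrow> complex"
  assumes S: "S \<in> carrier_mat n n" and p: "p < n"
    and x: "\<And>k. x k \<noteq> 0 \<Longrightarrow> r k < r p"
  shows "triangular_congruent n r S
    (mat n n (\<lambda>(k, l). S $$ (k, l) + x k * S $$ (p, l) + x l * S $$ (k, p) + x k * x l * S $$ (p, p)))"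
proof -
  define E where "E y = mat n n (\<lambda>(k, l). (if k = l then 1 else 0) + (if l = p then y k else 0))"
    for y :: "nat \<Rightarrow> complex"
  have c: "E y \<in> carrier_mat n n" for y by (simp add: E_def)
  have xp: "x p = 0" using x[of p] by auto
  have left: "(E y * B) $$ (k, l) = B $$ (k, l) + y k * B $$ (p, l)"
    if "B \<in> carrier_mat n n" "k < n" "l < n" for y B k l
  proof -
    have "(E y * B) $$ (k, l) = (\<Sum>m<n. E y $$ (k, m) * B $$ (m, l))"
      by (rule index_mult_mat_sum[OF c]) (use that in auto)
    also have "\<dots> = (\<Sum>m<n. (if m = k then B $$ (k, l) else 0) + (if m = p then y k * B $$ (p, l) else 0))"
      by (rule sum.cong) (use that in \<open>auto simp: E_def algebra_simps\<close>)
    finally show ?thesis using that p by (simp add: sum.distrib)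
  qed
  have right: "(B * transpose_mat (E y)) $$ (k, l) = B $$ (k, l) + y l * B $$ (k, p)"
    if "B \<in> carrier_mat n n" "k < n" "l < n" for y B k l
  proof -
    have "B * transpose_mat (E y) = transpose_mat (E y * transpose_mat B)"
      using that c by (simp add: transpose_mult[of _ n n _ n])
    then show ?thesis using left[of "transpose_mat B" l k] that c p
      by (simp add: carrier_matD[OF c] carrier_matD[OF that(1)])
  qed
  have "E x * E (\<lambda>k. - x k) = 1\<^sub>m n"
    by (rule eq_matI) (use c xp p in \<open>auto simp: left, auto simp: E_def\<close>)
  moreover have "rank_triangular n r (E x)" "rank_triangular n r (E (\<lambda>k. - x k))"
    using x by (auto simp: rank_triangular_def E_def less_imp_le split: if_splits)
  moreover have "mat n n (\<lambda>(k, l). S $$ (k, l) + x k * S $$ (p, l) + x l * S $$ (k, p) + x k * x l * S $$ (p, p))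
      = E x * S * transpose_mat (E x)"
  proof (rule eq_matI)
    fix k l assume "k < dim_row (E x * S * transpose_mat (E x))" "l < dim_col (E x * S * transpose_mat (E x))"
    then have kl: "k < n" "l < n" using c by (auto simp: E_def)
    show "mat n n (\<lambda>(k, l). S $$ (k, l) + x k * S $$ (p, l) + x l * S $$ (k, p) + x k * x l * S $$ (p, p)) $$ (k, l)
        = (E x * S * transpose_mat (E x)) $$ (k, l)"
      using kl p S by (subst right) (auto simp: c left algebra_simps)
  qed (auto simp: E_def)
  ultimately show ?thesis unfolding triangular_congruent_def by blast
qed

lemma triangular_congruent_diagonal:
  fixes d :: "nat \<Rightarrow> complex"
  assumes S: "S \<in> carrier_mat n n" and d: "\<And>k. k < n \<Longrightarrow> d k \<noteq> 0"
  shows "triangular_congruent n r S (mat n n (\<lambda>(k, l). d k * d l * S $$ (k, l)))"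
proof -
  define E where "E y = mat n n (\<lambda>(k, l). if k = l then y k else 0)" for y :: "nat \<Rightarrow> complex"
  have c: "E y \<in> carrier_mat n n" for y by (simp add: E_def)
  have left: "(E y * B) $$ (k, l) = y k * B $$ (k, l)"
    if "B \<in> carrier_mat n n" "k < n" "l < n" for y B k l
  proof -
    have "(E y * B) $$ (k, l) = (\<Sum>m<n. E y $$ (k, m) * B $$ (m, l))"
      by (rule index_mult_mat_sum[OF c]) (use that in auto)
    also have "\<dots> = (\<Sum>m<n. if m = k then y k * B $$ (k, l) else 0)"
      by (rule sum.cong) (use that in \<open>auto simp: E_def\<close>)
    finally show ?thesis using that by simp
  qed
  have right: "(B * transpose_mat (E y)) $$ (k, l) = y l * B $$ (k, l)"
    if "B \<in> carrier_mat n n" "k < n" "l < n" for y B k l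
  proof -
    have "B * transpose_mat (E y) = transpose_mat (E y * transpose_mat B)"
      using that c by (simp add: transpose_mult[of _ n n _ n])
    then show ?thesis using left[of "transpose_mat B" l k] that c
      by (simp add: carrier_matD[OF c] carrier_matD[OF that(1)])
  qed
  have "E d * E (\<lambda>k. inverse (d k)) = 1\<^sub>m n"
    by (rule eq_matI) (use c d in \<open>auto simp: left, auto simp: E_def\<close>)
  moreover have "rank_triangular n r (E d)" "rank_triangular n r (E (\<lambda>k. inverse (d k)))"
    by (auto simp: rank_triangular_def E_def split: if_splits)
  moreover have "mat n n (\<lambda>(k, l). d k * d l * S $$ (k, l)) = E d * S * transpose_mat (E d)"
  proof (rule eq_matI)
    fix k l assume "k < dim_row (E d * S * transpose_mat (E d))" "l < dim_col (E d * S * transpose_mat (E d))"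
    then have kl: "k < n" "l < n" using c by (auto simp: E_def)
    show "mat n n (\<lambda>(k, l). d k * d l * S $$ (k, l)) $$ (k, l) = (E d * S * transpose_mat (E d)) $$ (k, l)"
      using kl S by (subst right) (auto simp: c left algebra_simps)
  qed (auto simp: E_def)
  ultimately show ?thesis unfolding triangular_congruent_def by blast
qed

section \<open>Symmetric Gaussian elimination\<close>

text \<open>\<open>R\<close> is the set of rows that the elimination has not treated yet.\<close>

definition reduced_off :: "nat \<Rightarrow> nat set \<Rightarrow> complex mat \<Rightarrow> bool" where
  "reduced_off n R S \<longleftrightarrow>
     S \<in> carrier_mat n n \<and> (\<forall>k<n. \<forall>l<n. S $$ (k, l) = S $$ (l, k)) \<and>
     (\<forall>k<n. k \<notin> R \<longrightarrow> (\<forall>l<n. S $$ (k, l) \<noteq> 0 \<longrightarrow> l \<notin> R \<and> (\<forall>l'<n. S $$ (k, l') \<noteq> 0 \<longrightarrow> l' = l)))"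

text \<open>A pivot row may only be added to rows of smaller rank, so untreated rows are taken by
  decreasing rank. The top row m is zero, or has a diagonal pivot, or is paired with the row c of
  largest rank that meets column m. In the last case row c clears column m, after which row m, now
  having a single entry, clears column c. One or two rows leave R, whence the strong
  induction.\<close>

lemma reduced_off_congruent:
  assumes "inj_on r {..<n}" "R \<subseteq> {..<n}" "reduced_off n R S"
  shows "\<exists>T. triangular_congruent n r S T \<and> reduced_off n {} T"
  using assms(2,3)
proof (induction "card R" arbitrary: R S rule: less_induct)
  case less
  note R = less.prems(1) and red = less.prems(2)
  have finR: "finite R" using R finite_subset by blast
  have S: "S \<in> carrier_mat n n" and sym: "\<And>k l. k < n \<Longrightarrow> l < n \<Longrightarrow> S $$ (k, l) = S $$ (l, k)"
    and off: "\<And>k l. k < n \<Longrightarrow> l < n \<Longrightarrow> k \<notin> R \<Longrightarrow> S $$ (k, l) \<noteq> 0 \<Longrightarrow> l \<notin> R"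
    and uniq: "\<And>k l l'. k < n \<Longrightarrow> l < n \<Longrightarrow> l' < n \<Longrightarrow> k \<notin> R \<Longrightarrow> S $$ (k, l) \<noteq> 0 \<Longrightarrow> S $$ (k, l') \<noteq> 0 \<Longrightarrow> l' = l"
    using red unfolding reduced_off_def by blast+
  have zero: "S $$ (k, l) = 0" "S $$ (l, k) = 0" if "k < n" "k \<notin> R" "l \<in> R" for k l
    using off[of k l] sym[of l k] that subsetD[OF R that(3)] by auto
  \<comment> \<open>Serves both pivot choices; injectivity of r makes the maximal rank
    strict.\<close>
  have maximum: "\<exists>m\<in>Q. \<forall>k\<in>Q. k \<noteq> m \<longrightarrow> r k < r m" if Q: "Q \<subseteq> R" "Q \<noteq> {}" for Q
  proof -
    have fin: "finite Q" using Q finR finite_subset by blast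
    then have "Max (r ` Q) \<in> r ` Q" using Q by (intro Max_in) auto
    then obtain m where m: "m \<in> Q" "r m = Max (r ` Q)" by auto
    have "r k < r m" if k: "k \<in> Q" "k \<noteq> m" for k
    proof -
      have "r k \<le> r m" using m k fin by simp
      moreover have "r k \<noteq> r m" using assms(1) k m Q R by (meson inj_onD subsetD)
      ultimately show ?thesis by simp
    qed
    with m show ?thesis by blast
  qed
  show ?case
  proof (cases "R = {}")
    case True
    then show ?thesis using red triangular_congruent_refl[OF S] by blast
  next
    case False
    then obtain m where m: "m \<in> R" and m_max: "\<And>k. k \<in> R \<Longrightarrow> k \<noteq> m \<Longrightarrow> r k < r m"
      using maximum[of R] by blast
    have mn: "m < n" using m R by auto
    have card: "card (R - {m}) < card R" "card (R - {m, c}) < card R" for c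
      using m by (intro psubset_card_mono[OF finR]; blast)+
    have step: ?thesis
      if T: "triangular_congruent n r S T" "reduced_off n R' T" and R': "R' \<subseteq> R" "card R' < card R" for T R'
      using less.hyps[OF R'(2) _ T(2)] R R' triangular_congruent_trans[OF S T(1)] by blast
    consider (null) "\<forall>l\<in>R. S $$ (l, m) = 0" | (diag) "S $$ (m, m) \<noteq> 0"
      | (off_diag) "S $$ (m, m) = 0" "{l \<in> R. S $$ (l, m) \<noteq> 0} \<noteq> {}" by blast
    then show ?thesis
    proof cases
      case null
      have "S $$ (m, l) = 0" if "l < n" for l
        using null zero[of l m] sym[of m l] that mn m by (cases "l \<in> R") auto
      then have "reduced_off n (R - {m}) S"
        unfolding reduced_off_def using S sym off uniq by blast
      then show ?thesis using step[OF triangular_congruent_refl[OF S]] card by blast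
    next
      case diag
      \<comment> \<open>This multiplier annihilates entry (k, m). It vanishes off R, and S vanishes
        between R and its complement, so treated rows do not change.\<close>
      define x where "x k = (if k \<in> R - {m} then - (S $$ (k, m) / S $$ (m, m)) else 0)" for k
      define T where "T = mat n n (\<lambda>(k, l). S $$ (k, l) + x k * S $$ (m, l) + x l * S $$ (k, m) + x k * x l * S $$ (m, m))"
      have con: "triangular_congruent n r S T"
        unfolding T_def by (rule triangular_congruent_transvection[OF S mn]) (use m_max in \<open>auto simp: x_def split: if_splits\<close>)
      have T: "T $$ (k, l) = S $$ (k, l) + x k * S $$ (m, l) + x l * S $$ (k, m) + x k * x l * S $$ (m, m)"
        if "k < n" "l < n" for k l using that by (simp add: T_def)
      have x0: "x k = 0" if "k \<notin> R" for k using that by (simp add: x_def)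
      have old: "T $$ (k, l) = S $$ (k, l)" if "k < n" "l < n" "k \<notin> R" for k l
        using that zero[of k m] m by (simp add: T x0)
      have new: "T $$ (m, l) = 0" if "l < n" "l \<noteq> m" for l
        using that mn m diag zero[of l m] sym[of m l] by (auto simp: T x_def)
      have Tsym: "T $$ (k, l) = T $$ (l, k)" if "k < n" "l < n" for k l
        using that mn by (simp add: T sym[of k l] sym[of k m] sym[of l m])
      have "reduced_off n (R - {m}) T"
        unfolding reduced_off_def
      proof (intro conjI allI impI)
        show "T \<in> carrier_mat n n" by (simp add: T_def)
        fix k l assume kl: "k < n" "l < n"
        show "T $$ (k, l) = T $$ (l, k)" using Tsym kl .
        assume k: "k \<notin> R - {m}" and nz: "T $$ (k, l) \<noteq> 0"
        show "l \<notin> R - {m}"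
          using k nz kl old[of k l] new[of l] off[of k l] by (cases "k = m") auto
        fix l' assume "l' < n" "T $$ (k, l') \<noteq> 0"
        then show "l' = l"
          using k nz kl old[of k l] old[of k l'] new[of l] new[of l'] uniq[of k l l'] by (cases "k = m") auto
      qed
      then show ?thesis using step[OF con] card by blast
    next
      case off_diag
      \<comment> \<open>Largest rank, so that row c may be added to every other row that meets
        column m.\<close>
      then obtain c where c: "c \<in> R" "S $$ (c, m) \<noteq> 0"
        and c_max: "\<And>k. k \<in> R \<Longrightarrow> S $$ (k, m) \<noteq> 0 \<Longrightarrow> k \<noteq> c \<Longrightarrow> r k < r c"
        using maximum[of "{l \<in> R. S $$ (l, m) \<noteq> 0}"] by blast
      have cn: "c < n" and cm: "c \<noteq> m" using c R off_diag by auto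
      define x where "x k = (if k \<in> R - {c} then - (S $$ (k, m) / S $$ (c, m)) else 0)" for k
      define T where "T = mat n n (\<lambda>(k, l). S $$ (k, l) + x k * S $$ (c, l) + x l * S $$ (k, c) + x k * x l * S $$ (c, c))"
      have con: "triangular_congruent n r S T"
        unfolding T_def by (rule triangular_congruent_transvection[OF S cn]) (use c_max in \<open>auto simp: x_def split: if_splits\<close>)
      have Tc: "T \<in> carrier_mat n n" by (simp add: T_def)
      have T: "T $$ (k, l) = S $$ (k, l) + x k * S $$ (c, l) + x l * S $$ (k, c) + x k * x l * S $$ (c, c)"
        if "k < n" "l < n" for k l using that by (simp add: T_def)
      have x0: "x k = 0" if "k \<notin> R" for k using that by (simp add: x_def)
      have xm: "x m = 0" using off_diag by (simp add: x_def)
      have T_old: "T $$ (k, l) = S $$ (k, l)" if "k < n" "l < n" "k \<notin> R" for k l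
        using that zero[of k c] c by (simp add: T x0)
      have Tm: "T $$ (k, m) = (if k = c then S $$ (c, m) else 0)" if "k < n" for k
        using that mn m c zero[of k m] off_diag(1) by (auto simp: T x_def)
      have Tsym: "T $$ (k, l) = T $$ (l, k)" if "k < n" "l < n" for k l
        using that cn by (simp add: T sym[of k l] sym[of k c] sym[of l c])
      have Tm': "T $$ (m, k) = (if k = c then S $$ (c, m) else 0)" if "k < n" for k
        using Tm Tsym mn that by simp
      \<comment> \<open>Entry (c, c) is hit by the row operation and by the column operation, hence
        the factor 2 there; the other entries of column c are corrected once.\<close>
      define y where "y k = (if k = c then - (T $$ (c, c) / (2 * S $$ (c, m)))
        else if k \<in> R - {m} then - (T $$ (k, c) / S $$ (c, m)) else 0)" for k
      define U where "U = mat n n (\<lambda>(k, l). T $$ (k, l) + y k * T $$ (m, l) + y l * T $$ (k, m) + y k * y l * T $$ (m, m))"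
      have "triangular_congruent n r T U"
        unfolding U_def
        by (rule triangular_congruent_transvection[OF Tc mn]) (use m_max c cm in \<open>auto simp: y_def split: if_splits\<close>)
      then have con2: "triangular_congruent n r S U" using con triangular_congruent_trans[OF S] by blast
      have U: "U $$ (k, l) = T $$ (k, l) + (if l = c then y k * S $$ (c, m) else 0) + (if k = c then y l * S $$ (c, m) else 0)"
        if "k < n" "l < n" for k l using that mn cm by (simp add: U_def Tm Tm')
      have y0: "y k = 0" if "k \<notin> R" for k using that c by (auto simp: y_def)
      have ym: "y m = 0" using cm by (simp add: y_def)
      have old: "U $$ (k, l) = S $$ (k, l)" if "k < n" "l < n" "k \<notin> R" for k l
        using that c by (auto simp: U y0 T_old)
      have new_m: "U $$ (m, l) = (if l = c then S $$ (c, m) else 0)" if "l < n" for l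
        using that mn cm by (simp add: U ym Tm')
      have Usym: "U $$ (k, l) = U $$ (l, k)" if "k < n" "l < n" for k l
        using that by (simp add: U Tsym[of k l])
      have new_c: "U $$ (c, l) = 0" if l: "l < n" "l \<noteq> m" for l
      proof (cases "l \<in> R")
        case True
        show ?thesis
        proof (cases "l = c")
          case True
          then show ?thesis using cn c by (simp add: U y_def)
        next
          case False
          with True show ?thesis using l cn c Tsym[of c l] by (simp add: U y_def)
        qed
      next
        case False
        then show ?thesis using l cn c old[of l c] Usym[of c l] zero[of l c] by simp
      qed
      have "reduced_off n (R - {m, c}) U"
        unfolding reduced_off_def
      proof (intro conjI allI impI)
        show "U \<in> carrier_mat n n" by (simp add: U_def)
        fix k l assume kl: "k < n" "l < n"
        show "U $$ (k, l) = U $$ (l, k)" using Usym kl .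
        assume k: "k \<notin> R - {m, c}" and nz: "U $$ (k, l) \<noteq> 0"
        have pos: "k = m \<and> l = c \<or> k = c \<and> l = m \<or> k \<notin> R \<and> l \<notin> R \<and> S $$ (k, l) \<noteq> 0"
          if "l < n" "U $$ (k, l) \<noteq> 0" for l
          using k that kl(1) new_m[of l] new_c[of l] old[of k l] off[of k l] by (auto split: if_splits)
        show "l \<notin> R - {m, c}" using pos[OF kl(2) nz] by auto
        fix l' assume "l' < n" "U $$ (k, l') \<noteq> 0"
        then show "l' = l"
          using pos[OF kl(2) nz] pos[of l'] uniq[of k l l'] kl cm m c by auto
      qed
      then show ?thesis using step[OF con2] card by blast
    qed
  qed
qed

text \<open>Each row of T has at most one nonzero entry, so the scaling equations decouple. For an
  entry off the diagonal the smaller index takes the whole ratio and the larger one takes 1; a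
  diagonal entry needs a complex square root of the ratio.\<close>

lemma reduced_scaling:
  assumes T: "reduced_off n {} T" and U: "U \<in> carrier_mat n n"
    and sym: "\<And>k l. k < n \<Longrightarrow> l < n \<Longrightarrow> U $$ (k, l) = U $$ (l, k)"
    and supp: "\<And>k l. k < n \<Longrightarrow> l < n \<Longrightarrow> U $$ (k, l) \<noteq> 0 \<longleftrightarrow> T $$ (k, l) \<noteq> 0"
  shows "triangular_congruent n r T U"
proof -
  have Tc: "T \<in> carrier_mat n n" and Tsym: "\<And>k l. k < n \<Longrightarrow> l < n \<Longrightarrow> T $$ (k, l) = T $$ (l, k)"
    and uniq: "\<And>k l l'. k < n \<Longrightarrow> l < n \<Longrightarrow> l' < n \<Longrightarrow> T $$ (k, l) \<noteq> 0 \<Longrightarrow> T $$ (k, l') \<noteq> 0 \<Longrightarrow> l' = l"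
    using T unfolding reduced_off_def by blast+
  define q where "q k = (SOME l. l < n \<and> T $$ (k, l) \<noteq> 0)" for k
  define d where "d k = (if \<exists>l<n. T $$ (k, l) \<noteq> 0
      then if k < q k then U $$ (k, q k) / T $$ (k, q k)
        else if k = q k then csqrt (U $$ (k, k) / T $$ (k, k)) else 1
      else 1)" for k
  have q: "q k = l" if "k < n" "l < n" "T $$ (k, l) \<noteq> 0" for k l
  proof -
    have "q k < n \<and> T $$ (k, q k) \<noteq> 0" unfolding q_def by (rule someI[of _ l]) (use that in auto)
    then show ?thesis using uniq[of k l "q k"] that by blast
  qed
  have d: "d k = (if k < l then U $$ (k, l) / T $$ (k, l) else if k = l then csqrt (U $$ (k, k) / T $$ (k, k)) else 1)"
    if "k < n" "l < n" "T $$ (k, l) \<noteq> 0" for k l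
    using q[OF that] that unfolding d_def by auto
  have nz: "d k \<noteq> 0" if "k < n" for k
  proof (cases "\<exists>l<n. T $$ (k, l) \<noteq> 0")
    case True
    then obtain l where l: "l < n" "T $$ (k, l) \<noteq> 0" by blast
    then show ?thesis using d[OF that l] supp[OF that l(1)] by auto
  next
    case False
    then have "d k = 1" unfolding d_def by (rule if_not_P)
    then show ?thesis by simp
  qed
  have "U = mat n n (\<lambda>(k, l). d k * d l * T $$ (k, l))"
  proof (rule eq_matI)
    fix k l assume "k < dim_row (mat n n (\<lambda>(k, l). d k * d l * T $$ (k, l)))"
      "l < dim_col (mat n n (\<lambda>(k, l). d k * d l * T $$ (k, l)))"
    then have kl: "k < n" "l < n" by auto
    show "U $$ (k, l) = mat n n (\<lambda>(k, l). d k * d l * T $$ (k, l)) $$ (k, l)"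
    proof (cases "T $$ (k, l) = 0")
      case True
      then show ?thesis using supp[OF kl] kl by simp
    next
      case False
      then have lk: "T $$ (l, k) \<noteq> 0" using Tsym kl by simp
      consider "k < l" | "k = l" | "l < k" by linarith
      then show ?thesis
      proof cases
        case 2
        have "d k * d k = U $$ (k, k) / T $$ (k, k)"
          using d[OF kl False] 2 power2_csqrt[of "U $$ (k, k) / T $$ (k, k)"] by (simp add: power2_eq_square)
        then show ?thesis using kl False 2 by simp
      qed (use d[OF kl False] d[OF kl(2,1) lk] kl False lk sym[OF kl] Tsym[OF kl] in auto)
    qed
  qed (use U in auto)
  then show ?thesis using triangular_congruent_diagonal[OF Tc nz] by simp
qed

section \<open>Clans over a fixed base clan\<close>

text \<open>I and its reflection are disjoint and have n elements each, so together they exhaust all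
  2n positions.\<close>

lemma complementary_mirror:
  fixes n :: nat and I :: "nat set"
  assumes "I \<subseteq> {..<2 * n}" "card I = n" "\<And>i. i \<in> I \<Longrightarrow> 2 * n - Suc i \<notin> I"
  assumes "i < 2 * n" "i \<notin> I"
  shows "2 * n - Suc i \<in> I"
proof -
  let ?f = "\<lambda>i. 2 * n - Suc i"
  have fin: "finite I" using assms(1) finite_subset by blast
  have "inj_on ?f I"
  proof (rule inj_onI)
    fix i j assume "i \<in> I" "j \<in> I" "?f i = ?f j"
    moreover from this have "i < 2 * n" "j < 2 * n" using assms(1) by auto
    ultimately show "i = j" by linarith
  qed
  then have "card (?f ` I) = n" by (simp add: card_image assms(2))
  moreover have "I \<inter> ?f ` I = {}" using assms(3) by auto
  ultimately have "card (I \<union> ?f ` I) = card {..<2 * n}"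
    using fin assms(2) by (simp add: card_Un_disjoint)
  moreover have "I \<union> ?f ` I \<subseteq> {..<2 * n}" using assms(1) by auto
  ultimately have "I \<union> ?f ` I = {..<2 * n}" by (metis card_subset_eq finite_lessThan)
  then obtain j where "j \<in> I" "i = ?f j" using assms(4,5) by blast
  then show ?thesis using assms(1) by auto
qed

lemma count_list_word_positions: "count_list w c = card (word_positions c w)"
  unfolding count_list_eq_length_filter length_filter_conv_card word_positions_def
  by (rule arg_cong[of _ _ card]) auto

text \<open>The cardinality condition is replaced by its useful form: I contains exactly one
  position of each mirror pair.\<close>

locale isotropic_set =
  fixes n :: nat and I :: "nat set"
  assumes subset: "I \<subseteq> {..<2 * n}"
    and mirror_iff: "\<And>i. i < 2 * n \<Longrightarrow> 2 * n - Suc i \<in> I \<longleftrightarrow> i \<notin> I"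
begin

abbreviation mir :: "nat \<Rightarrow> nat" where
  "mir i \<equiv> 2 * n - Suc i"

lemma mir_mir: "i < 2 * n \<Longrightarrow> mir (mir i) = i"
  by auto

lemma mir_less: "i < 2 * n \<Longrightarrow> mir i < 2 * n"
  by auto

lemma mir_eq_iff: "i < 2 * n \<Longrightarrow> j < 2 * n \<Longrightarrow> mir i = mir j \<longleftrightarrow> i = j"
  by (metis mir_mir)

text \<open>The default permutation depends only on the base clan, so all clans over I share this
  one. It is an involution that commutes with the reflection and exchanges I with the first
  half.\<close>

definition \<sigma> :: "nat \<Rightarrow> nat" where
  "\<sigma> i = (if (if i < n then i else 2 * n - 1 - i) \<in> I then i else 2 * n - 1 - i)"

lemma \<sigma>_less: "i < 2 * n \<Longrightarrow> \<sigma> i < 2 * n"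
  by (auto simp: \<sigma>_def)

lemma \<sigma>_less_half_iff: "i < 2 * n \<Longrightarrow> \<sigma> i < n \<longleftrightarrow> i \<in> I"
  using mirror_iff[of i] by (auto simp: \<sigma>_def)

lemma \<sigma>_\<sigma>: "i < 2 * n \<Longrightarrow> \<sigma> (\<sigma> i) = i"
  by (auto simp: \<sigma>_def split: if_splits)

lemma \<sigma>_mir: "i < 2 * n \<Longrightarrow> \<sigma> (mir i) = mir (\<sigma> i)"
  by (auto simp: \<sigma>_def)

lemma \<sigma>_in_iff: "i < 2 * n \<Longrightarrow> \<sigma> i \<in> I \<longleftrightarrow> i < n"
  using \<sigma>_less_half_iff[OF \<sigma>_less] by (simp add: \<sigma>_\<sigma>)

lemma \<sigma>_eq_iff: "i < 2 * n \<Longrightarrow> j < 2 * n \<Longrightarrow> \<sigma> i = \<sigma> j \<longleftrightarrow> i = j"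
  by (metis \<sigma>_\<sigma>)

section \<open>Clans over I as matchings of positions\<close>

text \<open>The last clause is the default signature: the first member of a pair becomes a minus of
  the base clan, the second a plus.\<close>

definition skew_matching :: "(nat \<Rightarrow> nat) \<Rightarrow> bool" where
  "skew_matching p \<longleftrightarrow> (\<forall>k<2 * n. p k < 2 * n \<and> p (p k) = k \<and> p (mir k) = mir (p k) \<and>
     (k < p k \<longrightarrow> k \<notin> I \<and> p k \<in> I))"

definition clan_matching :: "clan \<Rightarrow> (nat \<Rightarrow> nat) \<Rightarrow> bool" where
  "clan_matching \<gamma> p \<longleftrightarrow>
     plus_positions \<gamma> = {k. k < 2 * n \<and> p k = k \<and> k \<in> I} \<and>
     minus_positions \<gamma> = {k. k < 2 * n \<and> p k = k \<and> k \<notin> I} \<and>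
     clan_pairs \<gamma> = {(k, l). k < l \<and> l < 2 * n \<and> l = p k}"

abbreviation sign_word :: "clan_symbol list" where
  "sign_word \<equiv> map (\<lambda>i. if i \<in> I then Plus else Minus) [0..<2 * n]"

lemma sign_word_positions:
  "word_positions Plus sign_word = I" "word_positions Minus sign_word = {..<2 * n} - I"
  using subset by (auto simp: word_positions_def split: if_splits)

lemma default_perm_eq:
  assumes "\<gamma> \<in> clans_over n I"
  shows "default_perm n \<gamma> = \<sigma>"
proof -
  have "base_clan \<gamma> = clan_of_word sign_word"
    using assms by (simp add: clans_over_def sign_clan_def)
  then have "plus_positions (base_clan \<gamma>) = word_positions Plus sign_word"
    by (simp add: plus_positions.abs_eq)
  also have "\<dots> = I" by (rule sign_word_positions)
  finally show ?thesis by (auto simp: default_perm_def \<sigma>_def fun_eq_iff)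
qed

text \<open>Equality in the quotient type means equal length, equal sign positions and equal pairs;
  the matching fixes the latter two and membership in \<open>clans n\<close> fixes the
  length.\<close>

lemma clan_matching_unique:
  assumes "\<gamma> \<in> clans n" "\<delta> \<in> clans n" "clan_matching \<gamma> p" "clan_matching \<delta> p"
  shows "\<gamma> = \<delta>"
proof -
  obtain v w where "\<gamma> = clan_of_word v" "\<delta> = clan_of_word w" "length v = length w"
    using assms(1,2) by (auto simp: clans_def is_clan_word_def)
  then show ?thesis
    using assms(3,4) unfolding clan_matching_def
    by (simp add: clan.abs_eq_iff same_clan_def plus_positions.abs_eq minus_positions.abs_eq clan_pairs.abs_eq)
qed

text \<open>The involution exchanges the two occurrences of each number. Skew-symmetry makes it
  commute with the reflection, and the base clan provides the signs.\<close>

lemma clan_matching_exists: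
  assumes \<gamma>: "\<gamma> \<in> clans_over n I"
  shows "\<exists>p. skew_matching p \<and> clan_matching \<gamma> p"
proof -
  obtain w where w: "is_clan_word n w" and \<gamma>w: "\<gamma> = clan_of_word w"
    using \<gamma> by (auto simp: clans_over_def clans_def)
  have len: "length w = 2 * n" using w by (simp add: is_clan_word_def)
  have skew: "same_clan w (neg_rev_word w)"
    using \<gamma> by (simp add: clans_over_def skew_symmetric_def \<gamma>w neg_rev.abs_eq clan.abs_eq_iff)
  have base: "same_clan (base_word w) sign_word"
    using \<gamma> by (simp add: clans_over_def \<gamma>w sign_clan_def base_clan.abs_eq clan.abs_eq_iff)
  have pos: "k \<in> word_positions c (base_word w) \<longleftrightarrow> word_signature w k = c" if "k < 2 * n" for k c
    using that len by (simp add: word_positions_def base_word_def)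
  have plus: "word_signature w k = Plus \<longleftrightarrow> k \<in> I" if "k < 2 * n" for k
    using base pos[OF that, of Plus] by (simp add: same_clan_def sign_word_positions)
  have minus: "word_signature w k = Minus \<longleftrightarrow> k \<notin> I" if "k < 2 * n" for k
    using base pos[OF that, of Minus] that by (simp add: same_clan_def sign_word_positions)
  have twice: "\<exists>!l. l < 2 * n \<and> l \<noteq> k \<and> w ! l = w ! k" if k: "k < 2 * n" "w ! k = Num a" for k a
  proof -
    have "Num a \<in> set w" using k len by (metis nth_mem)
    then have "count_list w (Num a) = 2" using w by (simp add: is_clan_word_def)
    then have "card {i. i < 2 * n \<and> w ! i = Num a} = 2"
      by (simp add: count_list_word_positions word_positions_def len)
    then obtain x y where xy: "{i. i < 2 * n \<and> w ! i = Num a} = {x, y}" "x \<noteq> y"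
      by (auto simp: card_2_iff)
    have "k \<in> {x, y}" using k unfolding xy(1)[symmetric] by simp
    then obtain z where z: "{i. i < 2 * n \<and> w ! i = Num a} = {k, z}" "z \<noteq> k"
      using xy by (metis insert_commute insert_iff singletonD)
    have "z \<in> {i. i < 2 * n \<and> w ! i = Num a}" unfolding z(1) by simp
    moreover have "l = k \<or> l = z" if "l < 2 * n" "w ! l = Num a" for l
    proof -
      have "l \<in> {k, z}" using that unfolding z(1)[symmetric] by simp
      then show ?thesis by simp
    qed
    ultimately show ?thesis using k z(2) by (intro ex1I[of _ z]) auto
  qed
  define p where "p k = (if \<exists>a. w ! k = Num a then THE l. l < 2 * n \<and> l \<noteq> k \<and> w ! l = w ! k else k)" for k
  have p_num: "p k < 2 * n \<and> p k \<noteq> k \<and> w ! p k = w ! k" if "k < 2 * n" "w ! k = Num a" for k a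
    using theI'[OF twice[OF that]] that by (simp add: p_def)
  have p_fix: "p k = k" if "\<nexists>a. w ! k = Num a" for k using that by (simp add: p_def)
  have p_eq: "p k = l" if "k < 2 * n" "l < 2 * n" "l \<noteq> k" "w ! l = w ! k" "w ! k = Num a" for k l a
    using twice[OF that(1,5)] p_num[OF that(1,5)] that by blast
  have pairs: "word_pairs w = {(k, l). k < l \<and> l < 2 * n \<and> l = p k}"
  proof (rule Set.set_eqI, unfold split_paired_all)
    fix k l
    show "(k, l) \<in> word_pairs w \<longleftrightarrow> (k, l) \<in> {(k, l). k < l \<and> l < 2 * n \<and> l = p k}"
    proof
      assume "(k, l) \<in> word_pairs w"
      then obtain a where "k < l" "l < 2 * n" "w ! l = w ! k" "w ! k = Num a"
        unfolding word_pairs_def len by fastforce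
      then show "(k, l) \<in> {(k, l). k < l \<and> l < 2 * n \<and> l = p k}"
        using p_eq[of k l a] by auto
    next
      assume "(k, l) \<in> {(k, l). k < l \<and> l < 2 * n \<and> l = p k}"
      then have l: "k < l" "l < 2 * n" "l = p k" by auto
      then obtain a where "w ! k = Num a" using p_fix[of k] by fastforce
      then show "(k, l) \<in> word_pairs w"
        using l p_num[of k a] len by (auto simp: word_pairs_def)
    qed
  qed
  have p_less: "p k < 2 * n" if "k < 2 * n" for k
    using that p_num[of k] p_fix[of k] by (cases "w ! k") auto
  have p_p: "p (p k) = k" if k: "k < 2 * n" for k
  proof (cases "\<exists>a. w ! k = Num a")
    case True
    then obtain a where a: "w ! k = Num a" by blast
    from p_num[OF k a] show ?thesis using p_eq[of "p k" k a] k a by auto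
  qed (simp add: p_fix)
  have p_mir: "p (mir k) = mir (p k)" if k: "k < 2 * n" for k
  proof -
    have pn: "(k, l) \<in> word_pairs w \<longleftrightarrow> k < l \<and> l < 2 * n \<and> (mir l, mir k) \<in> word_pairs w" for k l
      using skew word_pairs_neg_rev[of w] by (auto simp: same_clan_def len)
    \<comment> \<open>Skew-symmetry speaks only of ordered pairs, hence directly only of first
      members. Second members follow by applying p, and for a fixed point both strict inequalities
      at its mirror image are excluded.\<close>
    have lt: "p (mir k) = mir (p k)" if k: "k < 2 * n" "k < p k" for k
    proof -
      have "(k, p k) \<in> word_pairs w" using k p_less unfolding pairs by auto
      then have "(mir (p k), mir k) \<in> word_pairs w" using pn by blast
      then have "mir k = p (mir (p k))" unfolding pairs by auto
      then show ?thesis using p_p[of "mir (p k)"] p_less[OF k(1)] by simp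
    qed
    consider "k < p k" | "p k < k" | "p k = k" by linarith
    then show ?thesis
    proof cases
      case 2
      then have "p (mir (p k)) = mir k" using lt[of "p k"] p_p[OF k] p_less[OF k] by simp
      then show ?thesis using p_p[of "mir (p k)"] p_less[OF k] by simp
    next
      case 3
      have mk: "mir k < 2 * n" using k by auto
      have "\<not> mir k < p (mir k)"
        using lt[of "mir k"] 3 mir_mir[OF k] mk mir_mir[OF p_less[OF mk]] by auto
      moreover have "\<not> p (mir k) < mir k"
      proof
        assume less: "p (mir k) < mir k"
        then have "p (mir (p (mir k))) = k"
          using lt[OF p_less[OF mk]] p_p[OF mk] mir_mir[OF k] by simp
        then have "mir (p (mir k)) = k"
          using p_p[OF mir_less[OF p_less[OF mk]]] 3 by simp
        then show False using less mir_mir[OF p_less[OF mk]] by simp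
      qed
      ultimately show ?thesis using 3 by simp
    qed (use lt k in auto)
  qed
  have sgn: "k \<notin> I \<and> p k \<in> I" if k: "k < 2 * n" "k < p k" for k
  proof -
    have kp: "(k, p k) \<in> word_pairs w" using k p_less unfolding pairs by auto
    then have "word_signature w k = Minus" by (force simp: word_signature_def)
    moreover have "p k \<notin> fst ` word_pairs w" using k p_p[OF k(1)] unfolding pairs by auto
    then have "word_signature w (p k) = Plus" using kp by (force simp: word_signature_def)
    ultimately show ?thesis using plus[OF p_less[OF k(1)]] minus[OF k(1)] by simp
  qed
  have unpaired: "word_signature w k = w ! k" if k: "k < 2 * n" "p k = k" for k
  proof -
    have "k \<notin> fst ` word_pairs w" "k \<notin> snd ` word_pairs w"
      using k p_p[of "p k"] p_p unfolding pairs by fastforce+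
    then show ?thesis by (simp add: word_signature_def)
  qed
  have plus_fix: "w ! k = Plus \<longleftrightarrow> p k = k \<and> k \<in> I" if "k < 2 * n" for k
    using plus[OF that] unpaired[OF that] p_fix[of k] by auto
  have minus_fix: "w ! k = Minus \<longleftrightarrow> p k = k \<and> k \<notin> I" if "k < 2 * n" for k
    using minus[OF that] unpaired[OF that] p_fix[of k] by auto
  have "word_positions Plus w = {k. k < 2 * n \<and> p k = k \<and> k \<in> I}"
    using plus_fix by (auto simp: word_positions_def len)
  moreover have "word_positions Minus w = {k. k < 2 * n \<and> p k = k \<and> k \<notin> I}"
    using minus_fix by (auto simp: word_positions_def len)
  ultimately have "clan_matching \<gamma> p"
    unfolding clan_matching_def \<gamma>w by (simp add: plus_positions.abs_eq minus_positions.abs_eq clan_pairs.abs_eq pairs)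
  moreover have "skew_matching p"
    unfolding skew_matching_def using p_less p_p p_mir sgn by blast
  ultimately show ?thesis by blast
qed

lemma clan_of_matching:
  assumes p: "skew_matching p"
  shows "\<exists>\<gamma>\<in>clans_over n I. clan_matching \<gamma> p"
proof -
  \<comment> \<open>Labelling a pair by its smaller position keeps the labels of different pairs
    distinct.\<close>
  define w where "w = map (\<lambda>k. if p k = k then if k \<in> I then Plus else Minus else Num (min k (p k))) [0..<2 * n]"
  have len: "length w = 2 * n" by (simp add: w_def)
  have nth: "w ! k = (if p k = k then if k \<in> I then Plus else Minus else Num (min k (p k)))" if "k < 2 * n" for k
    using that by (simp add: w_def)
  have p_less: "p k < 2 * n" and p_p: "p (p k) = k" and p_mir: "p (mir k) = mir (p k)" if "k < 2 * n" for k
    using p that by (auto simp: skew_matching_def)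
  have sgn: "k \<notin> I \<and> p k \<in> I" if "k < 2 * n" "k < p k" for k
    using p that by (auto simp: skew_matching_def)
  have plus: "word_positions Plus w = {k. k < 2 * n \<and> p k = k \<and> k \<in> I}"
    by (auto simp: word_positions_def len nth split: if_splits)
  have minus: "word_positions Minus w = {k. k < 2 * n \<and> p k = k \<and> k \<notin> I}"
    by (auto simp: word_positions_def len nth split: if_splits)
  have num_iff: "w ! k = Num a \<longleftrightarrow> p a \<noteq> a \<and> a < p a \<and> (k = a \<or> k = p a)" if "k < 2 * n" "a < 2 * n" for k a
    using that p_p[of k] p_p[of a] by (auto simp: nth min_def)
  have pairs: "word_pairs w = {(k, l). k < l \<and> l < 2 * n \<and> l = p k}"
  proof (rule Set.set_eqI, unfold split_paired_all)
    fix k l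
    show "(k, l) \<in> word_pairs w \<longleftrightarrow> (k, l) \<in> {(k, l). k < l \<and> l < 2 * n \<and> l = p k}"
    proof
      assume "(k, l) \<in> word_pairs w"
      then obtain a where kl: "k < l" "l < 2 * n" "w ! k = Num a" "w ! l = Num a"
        unfolding word_pairs_def len by fastforce
      then have "a \<le> k" by (auto simp: nth split: if_splits)
      then have "a < 2 * n" using kl by simp
      then have "k = a \<or> k = p a" "l = a \<or> l = p a" "a < p a" using kl num_iff[of k a] num_iff[of l a] by auto
      then show "(k, l) \<in> {(k, l). k < l \<and> l < 2 * n \<and> l = p k}" using kl by auto
    next
      assume "(k, l) \<in> {(k, l). k < l \<and> l < 2 * n \<and> l = p k}"
      then show "(k, l) \<in> word_pairs w"
        using num_iff[of k k] num_iff[of l k] by (auto simp: word_pairs_def len)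
    qed
  qed
  \<comment> \<open>The reflection exchanges the unpaired positions inside I with those outside, so
    plus and minus symbols are equally many.\<close>
  have "bij_betw mir {k. k < 2 * n \<and> p k = k \<and> k \<in> I} {k. k < 2 * n \<and> p k = k \<and> k \<notin> I}"
    by (rule bij_betw_byWitness[where f' = mir]) (use mirror_iff p_mir mir_mir in auto)
  then have "count_list w Plus = count_list w Minus"
    unfolding count_list_word_positions plus minus by (rule bij_betw_same_card)
  moreover have "count_list w (Num a) = 2" if a: "Num a \<in> set w" for a
  proof -
    obtain k where k: "k < 2 * n" "w ! k = Num a" using a len by (metis in_set_conv_nth)
    then have "a \<le> k" by (auto simp: nth split: if_splits)
    then have an: "a < 2 * n" using k by simp
    then have "a < p a" using num_iff k by blast
    then have "word_positions (Num a) w = {a, p a}"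
      using an p_less[OF an] num_iff[OF _ an] by (auto simp: word_positions_def len)
    then show ?thesis using \<open>a < p a\<close> by (simp add: count_list_word_positions)
  qed
  ultimately have "is_clan_word n w" by (simp add: is_clan_word_def len)
  then have "clan_of_word w \<in> clans n" by (auto simp: clans_def)
  moreover have "skew_symmetric (clan_of_word w)"
  proof -
    have fixed: "p (mir k) = mir k \<longleftrightarrow> p k = k" if "k < 2 * n" for k
      unfolding p_mir[OF that] using p_less[OF that] that by auto
    have "word_positions Plus w = word_positions Plus (neg_rev_word w)"
      unfolding word_positions_neg_rev len using mirror_iff by (auto simp: plus minus fixed mir_less)
    moreover have "word_positions Minus w = word_positions Minus (neg_rev_word w)"
      unfolding word_positions_neg_rev len using mirror_iff by (auto simp: plus minus fixed mir_less)
    moreover have "word_pairs w = word_pairs (neg_rev_word w)"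
    proof (rule Set.set_eqI, unfold split_paired_all)
      fix k l
      have "l = p k \<longleftrightarrow> mir k = p (mir l)" if "k < l" "l < 2 * n"
        unfolding p_mir[OF that(2)] using that p_p[of l] p_p[of k] p_less[of l] mir_eq_iff[of k "p l"] by auto
      then show "(k, l) \<in> word_pairs w \<longleftrightarrow> (k, l) \<in> word_pairs (neg_rev_word w)"
        unfolding word_pairs_neg_rev len by (auto simp: pairs)
    qed
    ultimately show ?thesis
      by (simp add: skew_symmetric_def neg_rev.abs_eq clan.abs_eq_iff same_clan_def)
  qed
  moreover have "base_word w = sign_word"
  proof (rule nth_equalityI)
    fix k assume "k < length (base_word w)"
    then have k: "k < 2 * n" by (simp add: base_word_def len)
    have "k \<in> fst ` word_pairs w \<longleftrightarrow> k < p k"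
      using p_less[OF k] unfolding pairs by (force simp: image_iff)
    moreover have "k \<in> snd ` word_pairs w \<longleftrightarrow> p k < k"
    proof
      assume "k \<in> snd ` word_pairs w"
      then show "p k < k" using p_p unfolding pairs by (auto simp: image_iff)
    next
      assume "p k < k"
      then have "(p k, k) \<in> word_pairs w" using p_p[OF k] k unfolding pairs by auto
      then show "k \<in> snd ` word_pairs w" by force
    qed
    ultimately have "word_signature w k = (if k \<in> I then Plus else Minus)"
      using sgn[OF k] sgn[of "p k"] p_p[OF k] p_less[OF k] nth[OF k] by (auto simp: word_signature_def)
    then show "base_word w ! k = sign_word ! k" using k by (simp add: base_word_def len)
  qed (simp add: base_word_def len)
  ultimately have "clan_of_word w \<in> clans_over n I"
    by (simp add: clans_over_def base_clan.abs_eq sign_clan_def)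
  moreover have "clan_matching (clan_of_word w) p"
    unfolding clan_matching_def by (simp add: plus_positions.abs_eq minus_positions.abs_eq clan_pairs.abs_eq pairs plus minus)
  ultimately show ?thesis by blast
qed

end

section \<open>The matrix of a clan\<close>

lemma borel_mult: "a \<in> borel_subgroup n \<Longrightarrow> b \<in> borel_subgroup n \<Longrightarrow> a * b \<in> borel_subgroup n"
  using subgroup.m_closed[OF subgroup_borel] by simp

lemma borel_symp_inv: "b \<in> borel_subgroup n \<Longrightarrow> symp_inv n b \<in> borel_subgroup n"
  using subgroup.m_inv_closed[OF subgroup_borel] by (simp add: inv_Sp borel_Sp)

lemma symp_inv_mult:
  assumes "g \<in> carrier (Sp n)"
  shows "symp_inv n g * g = 1\<^sub>m (2 * n)" "g * symp_inv n g = 1\<^sub>m (2 * n)"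
  using assms symp_inv_left symp_inv_right by (auto simp: carrier_Sp)

text \<open>In the (j, j) entry of b times its inverse, both triangular, only the product of
  diagonal entries survives.\<close>

lemma borel_diagonal_nonzero:
  assumes b: "b \<in> borel_subgroup n" and j: "j < 2 * n"
  shows "b $$ (j, j) \<noteq> 0"
proof
  assume zero: "b $$ (j, j) = 0"
  let ?c = "symp_inv n b"
  have c: "?c \<in> borel_subgroup n" using b by (rule borel_symp_inv)
  have car: "b \<in> carrier_mat (2 * n) (2 * n)" "?c \<in> carrier_mat (2 * n) (2 * n)"
    using b c by (auto intro: borel_Sp Sp_carrier_mat)
  have "(b * ?c) $$ (j, j) = (\<Sum>k<2 * n. b $$ (j, k) * ?c $$ (k, j))"
    by (rule index_mult_mat_sum[OF car j j])
  also have "\<dots> = 0"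
  proof (rule sum.neutral, rule ballI)
    fix k assume k: "k \<in> {..<2 * n}"
    have "b $$ (j, k) = 0 \<or> ?c $$ (k, j) = 0 \<or> k = j"
      using b c k j unfolding borel_index by (metis lessThan_iff le_antisym)
    then show "b $$ (j, k) * ?c $$ (k, j) = 0" using zero by auto
  qed
  finally show False using symp_inv_mult(2)[OF borel_Sp[OF b]] j by simp
qed

lemma grading_index:
  assumes "i < 2 * n" "j < 2 * n"
  shows "grading n $$ (i, j) = (if i = j then form_sign n i else 0)"
  using assms by (auto simp: grading_def form_sign_def)

lemma grading_mult_index:
  assumes "g \<in> carrier_mat (2 * n) (2 * n)" "i < 2 * n" "j < 2 * n"
  shows "(grading n * g) $$ (i, j) = form_sign n i * g $$ (i, j)"
proof -
  have "(grading n * g) $$ (i, j) = (\<Sum>k<2 * n. grading n $$ (i, k) * g $$ (k, j))"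
    by (rule index_mult_mat_sum[OF grading_carrier assms])
  also have "\<dots> = (\<Sum>k<2 * n. if k = i then form_sign n i * g $$ (i, j) else 0)"
    by (rule sum.cong) (use assms in \<open>auto simp: grading_index\<close>)
  finally show ?thesis using assms by simp
qed

definition half_root :: complex where
  "half_root = complex_of_real (1 / sqrt 2)"

lemma half_root_square: "half_root * half_root = 1 / 2"
proof -
  have "(1 / sqrt 2) * (1 / sqrt 2) = (1 / 2 :: real)" by (simp add: field_simps)
  then show ?thesis unfolding half_root_def by (metis of_real_mult of_real_divide of_real_1 of_real_numeral)
qed

context isotropic_set
begin

text \<open>The eigenvalue of the grading on the basis vector with index \<open>\<sigma> k\<close>,
  as \<open>form_sign_\<sigma>\<close> records.\<close>

definition base_sign :: "nat \<Rightarrow> complex" where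
  "base_sign k = (if k \<in> I then 1 else -1)"

text \<open>In the k-th clan vector this is the coefficient of the basis vector at
  \<open>\<sigma> k\<close>, and \<open>partner_coeff\<close> is the one at
  \<open>\<sigma> (p k)\<close>. Second members of pairs have a negative own coefficient.\<close>

definition own_coeff :: "(nat \<Rightarrow> nat) \<Rightarrow> nat \<Rightarrow> complex" where
  "own_coeff p k = (if p k = k then if n \<le> k \<and> k \<in> I then -1 else 1
     else if k < p k then form_sign n k * half_root else - half_root)"

definition partner_coeff :: "(nat \<Rightarrow> nat) \<Rightarrow> nat \<Rightarrow> complex" where
  "partner_coeff p k = (if p k = k then 0 else if k < p k then form_sign n k * half_root else half_root)"

definition matching_mat :: "(nat \<Rightarrow> nat) \<Rightarrow> complex mat" where
  "matching_mat p = mat (2 * n) (2 * n) (\<lambda>(i, k).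
     (if i = \<sigma> k then own_coeff p k else 0) + (if i = \<sigma> (p k) then partner_coeff p k else 0))"

text \<open>The conjugate of the grading by the inverse of the clan matrix is monomial.\<close>

definition involution_coeff :: "(nat \<Rightarrow> nat) \<Rightarrow> nat \<Rightarrow> complex" where
  "involution_coeff p k = (if p k = k then base_sign k else - form_sign n (min k (p k)))"

definition involution_mat :: "(nat \<Rightarrow> nat) \<Rightarrow> complex mat" where
  "involution_mat p = mat (2 * n) (2 * n) (\<lambda>(l, k). if l = p k then involution_coeff p k else 0)"

lemma form_sign_\<sigma>: "k < 2 * n \<Longrightarrow> form_sign n (\<sigma> k) = base_sign k"
  using \<sigma>_less_half_iff[of k] by (simp add: form_sign_def base_sign_def)

lemma involution_coeff_nonzero [simp]: "involution_coeff p k \<noteq> 0"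
  by (simp add: involution_coeff_def base_sign_def)

lemma matching_mat_carrier [simp]: "matching_mat p \<in> carrier_mat (2 * n) (2 * n)"
  by (simp add: matching_mat_def)

lemma involution_mat_carrier [simp]: "involution_mat p \<in> carrier_mat (2 * n) (2 * n)"
  by (simp add: involution_mat_def)

lemma skew_matchingD:
  assumes "skew_matching p" "k < 2 * n"
  shows "p k < 2 * n" "p (p k) = k" "p (mir k) = mir (p k)"
    "k < p k \<Longrightarrow> k \<notin> I" "k < p k \<Longrightarrow> p k \<in> I"
  using assms by (auto simp: skew_matching_def)

lemma skew_matching_greater:
  assumes "skew_matching p" "k < 2 * n" "p k < k"
  shows "k \<in> I" "p k \<notin> I"
  using skew_matchingD[OF assms(1), of "p k"] skew_matchingD(1,2)[OF assms(1,2)] assms(3) by auto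

lemma skew_matching_in_iff:
  assumes "skew_matching p" "k < 2 * n" "p k \<noteq> k"
  shows "p k \<in> I \<longleftrightarrow> k \<notin> I"
  using skew_matchingD[OF assms(1,2)] skew_matching_greater[OF assms(1,2)] assms(3)
  by (cases "k < p k") auto

lemma matching_mat_index:
  assumes "skew_matching p" "j < 2 * n" "k < 2 * n"
  shows "matching_mat p $$ (\<sigma> j, k) =
    (if j = k then own_coeff p k else 0) + (if j = p k then partner_coeff p k else 0)"
  using assms skew_matchingD(1)[OF assms(1,3)]
  by (simp add: matching_mat_def \<sigma>_less \<sigma>_eq_iff)

lemma clan_vec_index:
  assumes p: "skew_matching p" and \<gamma>: "clan_matching \<gamma> p" "\<gamma> \<in> clans_over n I" and ik: "i < 2 * n" "k < 2 * n"
  shows "clan_vec n \<gamma> k $ i =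
    (if i = \<sigma> k then own_coeff p k else 0) + (if i = \<sigma> (p k) then partner_coeff p k else 0)"
proof -
  have perm: "default_perm n \<gamma> = \<sigma>" by (rule default_perm_eq[OF \<gamma>(2)])
  have sets: "k \<in> minus_positions \<gamma> \<longleftrightarrow> p k = k \<and> k \<notin> I" "k \<in> plus_positions \<gamma> \<longleftrightarrow> p k = k \<and> k \<in> I"
    using \<gamma>(1) ik by (auto simp: clan_matching_def)
  have pairs: "(a, b) \<in> clan_pairs \<gamma> \<longleftrightarrow> a < b \<and> b < 2 * n \<and> b = p a" for a b
    using \<gamma>(1) by (simp add: clan_matching_def)
  have first: "k \<in> fst ` clan_pairs \<gamma> \<longleftrightarrow> k < p k"
  proof
    assume "k < p k"
    then have "(k, p k) \<in> clan_pairs \<gamma>" using pairs skew_matchingD(1)[OF p ik(2)] by blast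
    then show "k \<in> fst ` clan_pairs \<gamma>" by force
  qed (auto simp: pairs)
  have partner: "partner \<gamma> k = p k" if "p k \<noteq> k"
    unfolding partner_def
  proof (rule the_equality)
    show "(k, p k) \<in> clan_pairs \<gamma> \<or> (p k, k) \<in> clan_pairs \<gamma>"
      using that skew_matchingD(1,2)[OF p ik(2)] ik unfolding pairs by linarith
    show "j = p k" if j: "(k, j) \<in> clan_pairs \<gamma> \<or> (j, k) \<in> clan_pairs \<gamma>" for j
      using j skew_matchingD(2)[OF p, of j] ik unfolding pairs by auto
  qed
  note lt = \<sigma>_less[OF ik(2)] \<sigma>_less[OF skew_matchingD(1)[OF p ik(2)]]
  consider "p k = k" | "k < p k" | "p k < k" by linarith
  then show ?thesis
  proof cases
    case 1
    then show ?thesis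
      using ik lt by (auto simp: clan_vec_def Let_def perm sets own_coeff_def partner_coeff_def)
  next
    case 2
    then have "\<sigma> k \<noteq> \<sigma> (p k)" using \<sigma>_eq_iff[OF ik(2) skew_matchingD(1)[OF p ik(2)]] by simp
    with 2 show ?thesis
      using ik lt by (auto simp: clan_vec_def Let_def perm sets first partner half_root_def own_coeff_def partner_coeff_def form_sign_def)
  next
    case 3
    then have "\<sigma> k \<noteq> \<sigma> (p k)" using \<sigma>_eq_iff[OF ik(2) skew_matchingD(1)[OF p ik(2)]] by simp
    with 3 show ?thesis
      using ik lt by (auto simp: clan_vec_def Let_def perm sets first partner half_root_def own_coeff_def partner_coeff_def)
  qed
qed

lemma clan_mat_eq:
  assumes "skew_matching p" "clan_matching \<gamma> p" "\<gamma> \<in> clans_over n I"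
  shows "clan_mat n \<gamma> = matching_mat p"
proof (rule eq_matI)
  fix i k assume "i < dim_row (matching_mat p)" "k < dim_col (matching_mat p)"
  then have ik: "i < 2 * n" "k < 2 * n" by (auto simp: matching_mat_def)
  then have "clan_mat n \<gamma> $$ (i, k) = clan_vec n \<gamma> k $ i"
    unfolding clan_mat_def by (subst mat_of_cols_index) auto
  then show "clan_mat n \<gamma> $$ (i, k) = matching_mat p $$ (i, k)"
    using ik by (simp add: clan_vec_index[OF assms ik] matching_mat_def)
qed (auto simp: clan_mat_def matching_mat_def)

text \<open>The pairing of columns k and \<open>mir k\<close> under the form. Reflection exchanges
  first and second members of pairs, and the extra minus signs in the second half are what produces
  \<open>form_sign n k\<close>.\<close>

lemma own_coeff_mirror:
  assumes p: "skew_matching p" and k: "k < 2 * n"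
  shows "base_sign k * own_coeff p k * own_coeff p (mir k) +
    base_sign (p k) * partner_coeff p k * partner_coeff p (mir k) = form_sign n k"
proof -
  note pk = skew_matchingD[OF p k]
  have mk: "mir k < 2 * n" "mir (p k) < 2 * n" using k by auto
  have s: "form_sign n (mir k) = - form_sign n k" by (rule form_sign_mirror[OF k])
  have sq1: "x * half_root * half_root = x / 2" "half_root * (x * half_root) = x / 2" for x
    using half_root_square by (simp_all add: mult.assoc mult.left_commute[of half_root x])
  note sq = sq1 half_root_square
  consider "p k = k" | "k < p k" | "p k < k" by linarith
  then show ?thesis
  proof cases
    case 1
    then show ?thesis
      using mirror_iff[OF k] pk k by (auto simp: own_coeff_def partner_coeff_def base_sign_def form_sign_def)
  next
    case 2
    then have "mir (p k) < mir k" using pk(1) by auto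
    then show ?thesis
      using 2 pk by (simp add: own_coeff_def partner_coeff_def base_sign_def s sq)
  next
    case 3
    then have "mir k < mir (p k)" using k by auto
    then show ?thesis
      using 3 pk skew_matching_greater[OF p k] by (simp add: own_coeff_def partner_coeff_def base_sign_def s sq)
  qed
qed

text \<open>Columns k and \<open>mir (p k)\<close> have to be orthogonal. The two members of a pair
  have opposite base signs, so orthogonality becomes this identity.\<close>

lemma partner_coeff_mirror:
  assumes p: "skew_matching p" and k: "k < 2 * n" and neq: "p k \<noteq> k"
  shows "own_coeff p k * partner_coeff p (mir (p k)) = partner_coeff p k * own_coeff p (mir (p k))"
proof -
  note pk = skew_matchingD[OF p k]
  have "p (mir (p k)) = mir k" using skew_matchingD(3)[OF p pk(1)] pk(2) by simp
  moreover have "mir (p k) < mir k \<longleftrightarrow> k < p k" "mir (p k) \<noteq> mir k" using k pk(1) neq by auto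
  ultimately show ?thesis using neq by (auto simp: own_coeff_def partner_coeff_def)
qed

text \<open>Columns k and l can pair nontrivially only if l is \<open>mir k\<close> or
  \<open>mir (p k)\<close>; the two preceding lemmas evaluate these cases.\<close>

lemma matching_mat_Sp:
  assumes p: "skew_matching p"
  shows "matching_mat p \<in> carrier (Sp n)"
proof -
  let ?g = "matching_mat p" and ?m = "2 * n"
  have c: "?g \<in> carrier_mat ?m ?m" "transpose_mat ?g \<in> carrier_mat ?m ?m" by auto
  have Og: "symp_form n * ?g \<in> carrier_mat ?m ?m" using c by simp
  have "transpose_mat ?g * (symp_form n * ?g) = symp_form n"
  proof (rule eq_matI)
    fix k l assume "k < dim_row (symp_form n)" "l < dim_col (symp_form n)"
    then have k: "k < ?m" and l: "l < ?m" by auto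
    note pk = skew_matchingD[OF p k] and pl = skew_matchingD[OF p l]
    have col: "?g $$ (i, k) = (if i = \<sigma> k then own_coeff p k else 0) + (if i = \<sigma> (p k) then partner_coeff p k else 0)"
      if "i < ?m" for i using that k by (simp add: matching_mat_def)
    have "(transpose_mat ?g * (symp_form n * ?g)) $$ (k, l) =
        (\<Sum>i<?m. transpose_mat ?g $$ (k, i) * (symp_form n * ?g) $$ (i, l))"
      by (rule index_mult_mat_sum[OF c(2) Og k l])
    also have "\<dots> = (\<Sum>i<?m. ?g $$ (i, k) * (form_sign n i * ?g $$ (mir i, l)))"
      by (rule sum.cong) (use k l in \<open>simp_all add: symp_form_mult_index[OF c(1)] carrier_matD[OF c(1)] del: index_mult_mat(1)\<close>)
    also have "\<dots> = (\<Sum>i<?m. (if i = \<sigma> k then own_coeff p k * (form_sign n (\<sigma> k) * ?g $$ (mir (\<sigma> k), l)) else 0) +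
        (if i = \<sigma> (p k) then partner_coeff p k * (form_sign n (\<sigma> (p k)) * ?g $$ (mir (\<sigma> (p k)), l)) else 0))"
      by (rule sum.cong) (use col in \<open>auto simp: distrib_right\<close>)
    also have "\<dots> = own_coeff p k * (form_sign n (\<sigma> k) * ?g $$ (mir (\<sigma> k), l)) +
        partner_coeff p k * (form_sign n (\<sigma> (p k)) * ?g $$ (mir (\<sigma> (p k)), l))"
      using \<sigma>_less[OF k] \<sigma>_less[OF pk(1)] by (simp add: sum.distrib)
    also have "\<dots> = own_coeff p k * (base_sign k * ?g $$ (\<sigma> (mir k), l)) +
        partner_coeff p k * (base_sign (p k) * ?g $$ (\<sigma> (mir (p k)), l))"
      by (simp add: form_sign_\<sigma> k pk(1) \<sigma>_mir)
    also have "\<dots> = base_sign k * own_coeff p k *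
          ((if mir k = l then own_coeff p l else 0) + (if mir k = p l then partner_coeff p l else 0)) +
        base_sign (p k) * partner_coeff p k *
          ((if mir (p k) = l then own_coeff p l else 0) + (if mir (p k) = p l then partner_coeff p l else 0))"
      using matching_mat_index[OF p mir_less[OF k] l] matching_mat_index[OF p mir_less[OF pk(1)] l]
      by (simp add: algebra_simps)
    also have "\<dots> = (if mir k = l then form_sign n k else 0)"
    proof (cases "mir k = l")
      case True
      then have pl': "p l = mir (p k)" using pk by simp
      have neq: "mir k = mir (p k) \<longleftrightarrow> p k = k" using mir_eq_iff[OF k pk(1)] by auto
      show ?thesis
      proof (cases "p k = k")
        case True
        then show ?thesis using \<open>mir k = l\<close> pl' own_coeff_mirror[OF p k] by (auto simp: partner_coeff_def)
      next
        case False
        then show ?thesis using \<open>mir k = l\<close> pl' neq own_coeff_mirror[OF p k] by auto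
      qed
    next
      case False
      have mk: "p (mir (p k)) = mir k" using skew_matchingD(2)[OF p mir_less[OF k]] pk(3) by simp
      have iff: "mir k = p l \<longleftrightarrow> mir (p k) = l"
        using mk pk(3) pl(2) by metis
      have "mir (p k) \<noteq> p l" using False mk pl(2) by metis
      show ?thesis
      proof (cases "mir (p k) = l")
        case True
        then have neq: "p k \<noteq> k" using False by auto
        have "base_sign (p k) = - base_sign k"
          using skew_matching_in_iff[OF p k neq] by (simp add: base_sign_def)
        then show ?thesis
          using True False iff \<open>mir (p k) \<noteq> p l\<close> partner_coeff_mirror[OF p k neq] by (simp add: mult.assoc)
      qed (use False iff \<open>mir (p k) \<noteq> p l\<close> in simp)
    qed
    also have "\<dots> = symp_form n $$ (k, l)" using k l by (auto simp: symp_form_index)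
    finally show "(transpose_mat ?g * (symp_form n * ?g)) $$ (k, l) = symp_form n $$ (k, l)" .
  qed (auto simp: matching_mat_def)
  then show ?thesis using c by (simp add: carrier_Sp mult_assoc_square[of _ ?m])
qed

section \<open>Monomial conjugates of the grading and disjointness of the orbits\<close>

lemma mult_involution_index:
  assumes p: "skew_matching p" and c: "c \<in> carrier_mat (2 * n) (2 * n)" and l: "l < 2 * n" and j: "j < 2 * n"
  shows "(c * involution_mat p) $$ (l, j) = c $$ (l, p j) * involution_coeff p j"
    "(involution_mat p * c) $$ (l, j) = involution_coeff p (p l) * c $$ (p l, j)"
proof -
  note pj = skew_matchingD[OF p j] and pl = skew_matchingD[OF p l]
  have "(c * involution_mat p) $$ (l, j) = (\<Sum>k<2 * n. c $$ (l, k) * involution_mat p $$ (k, j))"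
    by (rule index_mult_mat_sum[OF c _ l j]) simp
  also have "\<dots> = (\<Sum>k<2 * n. if k = p j then c $$ (l, p j) * involution_coeff p j else 0)"
    by (rule sum.cong) (use j in \<open>auto simp: involution_mat_def\<close>)
  finally show "(c * involution_mat p) $$ (l, j) = c $$ (l, p j) * involution_coeff p j"
    using pj by simp
  have "(involution_mat p * c) $$ (l, j) = (\<Sum>k<2 * n. involution_mat p $$ (l, k) * c $$ (k, j))"
    by (rule index_mult_mat_sum[OF _ c l j]) simp
  also have "\<dots> = (\<Sum>k<2 * n. if k = p l then involution_coeff p (p l) * c $$ (p l, j) else 0)"
    by (rule sum.cong) (use l pl skew_matchingD(2)[OF p] in \<open>auto simp: involution_mat_def\<close>)
  finally show "(involution_mat p * c) $$ (l, j) = involution_coeff p (p l) * c $$ (p l, j)"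
    using pl by simp
qed

text \<open>An unpaired column is an eigenvector of the grading. For k < p k the grading is -1 on
  the basis vector at \<open>\<sigma> k\<close> and 1 on that at \<open>\<sigma> (p k)\<close>, so
  it turns their sum into their difference up to sign. Hence it exchanges columns k and p k, both
  with the factor \<open>- form_sign n k\<close>.\<close>

lemma matching_involution:
  assumes p: "skew_matching p"
  shows "matching_mat p * involution_mat p = grading n * matching_mat p"
proof (rule eq_matI)
  fix i' k assume "i' < dim_row (grading n * matching_mat p)" "k < dim_col (grading n * matching_mat p)"
  then have i': "i' < 2 * n" and k: "k < 2 * n" by (auto simp: grading_def matching_mat_def)
  define i where "i = \<sigma> i'"
  have i: "i < 2 * n" "\<sigma> i = i'" using i' by (auto simp: i_def \<sigma>_less \<sigma>_\<sigma>)
  note pk = skew_matchingD[OF p k]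
  have "(matching_mat p * involution_mat p) $$ (\<sigma> i, k) = matching_mat p $$ (\<sigma> i, p k) * involution_coeff p k"
    by (rule mult_involution_index(1)[OF p _ \<sigma>_less[OF i(1)] k]) simp
  also have "\<dots> = base_sign i * matching_mat p $$ (\<sigma> i, k)"
    unfolding matching_mat_index[OF p i(1) pk(1)] matching_mat_index[OF p i(1) k] pk(2)
  proof -
    consider "p k = k" | "k < p k" | "p k < k" by linarith
    then show "((if i = p k then own_coeff p (p k) else 0) + (if i = k then partner_coeff p (p k) else 0)) *
          involution_coeff p k =
        base_sign i * ((if i = k then own_coeff p k else 0) + (if i = p k then partner_coeff p k else 0))"
    proof cases
      case 2
      then show ?thesis
        using pk by (auto simp: own_coeff_def partner_coeff_def involution_coeff_def base_sign_def min_def)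
    next
      case 3
      then show ?thesis
        using pk skew_matching_greater[OF p k]
        by (auto simp: own_coeff_def partner_coeff_def involution_coeff_def base_sign_def min_def mult.assoc[symmetric])
    qed (auto simp: partner_coeff_def involution_coeff_def)
  qed
  also have "\<dots> = (grading n * matching_mat p) $$ (\<sigma> i, k)"
    using grading_mult_index[of "matching_mat p" n "\<sigma> i" k] i' i k by (simp add: form_sign_\<sigma>[symmetric])
  finally show "(matching_mat p * involution_mat p) $$ (i', k) = (grading n * matching_mat p) $$ (i', k)"
    by (simp add: i)
qed (auto simp: grading_def matching_mat_def involution_mat_def)

abbreviation matching_inv :: "(nat \<Rightarrow> nat) \<Rightarrow> complex mat" where
  "matching_inv p \<equiv> symp_inv n (matching_mat p)"

lemma involution_matching_inv:
  assumes p: "skew_matching p"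
  shows "involution_mat p * matching_inv p = matching_inv p * grading n"
proof -
  let ?g = "matching_mat p" and ?h = "matching_inv p" and ?M = "involution_mat p" and ?m = "2 * n"
  have c: "?g \<in> carrier_mat ?m ?m" "?h \<in> carrier_mat ?m ?m" "?M \<in> carrier_mat ?m ?m" "grading n \<in> carrier_mat ?m ?m"
    by auto
  note inv = symp_inv_mult[OF matching_mat_Sp[OF p]]
  have "?M * ?h = (?h * ?g) * ?M * ?h" using c by (simp add: inv)
  also have "\<dots> = ?h * (?g * ?M) * ?h" using c by (simp add: mult_assoc_square[of _ ?m])
  also have "\<dots> = ?h * (grading n * (?g * ?h))"
    unfolding matching_involution[OF p] using c by (simp add: mult_assoc_square[of _ ?m])
  also have "\<dots> = ?h * grading n" using c by (simp add: inv)
  finally show ?thesis .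
qed

lemma clan_orbit_eq:
  assumes "skew_matching p" "clan_matching \<gamma> p" "\<gamma> \<in> clans_over n I"
  shows "clan_orbit n \<gamma> = {(b * matching_inv p) <#\<^bsub>Sp n\<^esub> siegel_levi n | b. b \<in> borel_subgroup n}"
  by (simp add: clan_orbit_def clan_mat_eq[OF assms] inv_Sp[OF matching_mat_Sp[OF assms(1)]])

text \<open>
  A relation \<open>M\<^sub>q c = c M\<^sub>p\<close> between monomial matrices with \<open>c\<close> upper triangular forces
  \<open>q \<le> p\<close>: compare the entries at \<open>(q j, j)\<close>.
\<close>

lemma monomial_intertwiner_le:
  assumes p: "skew_matching p" and q: "skew_matching q" and c: "c \<in> borel_subgroup n"
    and eq: "involution_mat q * c = c * involution_mat p" and j: "j < 2 * n"
  shows "q j \<le> p j"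
proof -
  note pj = skew_matchingD[OF p j] and qj = skew_matchingD[OF q j]
  have cc: "c \<in> carrier_mat (2 * n) (2 * n)" using c by (intro Sp_carrier_mat borel_Sp)
  have "involution_coeff q j * c $$ (j, j) = c $$ (q j, p j) * involution_coeff p j"
    using mult_involution_index(2)[OF q cc qj(1) j] mult_involution_index(1)[OF p cc qj(1) j] qj(2) eq by simp
  moreover have "c $$ (j, j) \<noteq> 0" by (rule borel_diagonal_nonzero[OF c j])
  ultimately have "c $$ (q j, p j) \<noteq> 0" by (metis involution_coeff_nonzero mult_eq_0_iff)
  then show ?thesis using c pj(1) qj(1) unfolding borel_index by blast
qed

text \<open>Equal cosets conjugate the grading to the same matrix. Cancelling b and b' leaves an
  intertwining relation between the two monomial matrices, with the Borel element b'^{-1} b.\<close>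

lemma matching_orbit_le:
  assumes p: "skew_matching p" and q: "skew_matching q" and b: "b \<in> borel_subgroup n" and b': "b' \<in> borel_subgroup n"
    and eq: "(b * matching_inv p) <#\<^bsub>Sp n\<^esub> siegel_levi n = (b' * matching_inv q) <#\<^bsub>Sp n\<^esub> siegel_levi n"
    and j: "j < 2 * n"
  shows "q j \<le> p j"
proof -
  let ?m = "2 * n" and ?c' = "symp_inv n b'" and ?D = "grading n"
  let ?hp = "matching_inv p" and ?hq = "matching_inv q" and ?Mp = "involution_mat p" and ?Mq = "involution_mat q"
  note Sp = borel_Sp[OF b] borel_Sp[OF b'] matching_mat_Sp[OF p] matching_mat_Sp[OF q]
  have c: "b \<in> carrier_mat ?m ?m" "b' \<in> carrier_mat ?m ?m" "?c' \<in> carrier_mat ?m ?m"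
    "?hp \<in> carrier_mat ?m ?m" "?hq \<in> carrier_mat ?m ?m" "?D \<in> carrier_mat ?m ?m" "?Mp \<in> carrier_mat ?m ?m"
    "?Mq \<in> carrier_mat ?m ?m" "matching_mat p \<in> carrier_mat ?m ?m"
    using Sp by (simp_all add: Sp_carrier_mat)
  note ac = mult_assoc_square[of _ ?m]
  note inv = symp_inv_mult[OF Sp(2)] symp_inv_mult[OF Sp(3)]
  have inv': "?c' * (b' * X) = X" "?hp * (matching_mat p * X) = X" if "X \<in> carrier_mat ?m ?m" for X
    using c that inv by (simp_all add: ac[symmetric])
  let ?X = "b' * ?Mq * ?c'"
  have X: "?X \<in> carrier_mat ?m ?m" using c by simp
  have "?X * (b' * ?hq) = b' * ?hq * ?D"
    using c by (simp add: ac inv' involution_matching_inv[OF q])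
  then have "?X * (b * ?hp) = b * ?hp * ?D"
    using levi_coset_eqD[OF Sp_mult_closed[OF Sp(1) symp_inv_closed[OF Sp(3)]]
        Sp_mult_closed[OF Sp(2) symp_inv_closed[OF Sp(4)]] X eq] by simp
  also have "\<dots> = b * ?Mp * ?hp" using c by (simp add: ac involution_matching_inv[OF p])
  finally have "?c' * (?X * (b * ?hp)) * matching_mat p = ?c' * (b * ?Mp * ?hp) * matching_mat p" by simp
  then have "?Mq * (?c' * b) = (?c' * b) * ?Mp" using c by (simp add: ac inv inv')
  moreover have "?c' * b \<in> borel_subgroup n" by (intro borel_mult borel_symp_inv b b')
  ultimately show ?thesis by (intro monomial_intertwiner_le[OF p q _ _ j])
qed

lemma disjoint_clan_orbits: "disjoint_family_on (clan_orbit n) (clans_over n I)"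
  unfolding disjoint_family_on_def
proof (intro ballI impI)
  fix \<gamma> \<delta> assume \<gamma>: "\<gamma> \<in> clans_over n I" and \<delta>: "\<delta> \<in> clans_over n I" and neq: "\<gamma> \<noteq> \<delta>"
  obtain p where p: "skew_matching p" "clan_matching \<gamma> p" using clan_matching_exists[OF \<gamma>] by blast
  obtain q where q: "skew_matching q" "clan_matching \<delta> q" using clan_matching_exists[OF \<delta>] by blast
  show "clan_orbit n \<gamma> \<inter> clan_orbit n \<delta> = {}"
  proof (rule ccontr)
    assume "clan_orbit n \<gamma> \<inter> clan_orbit n \<delta> \<noteq> {}"
    then obtain b b' where b: "b \<in> borel_subgroup n" "b' \<in> borel_subgroup n"
      and eq: "(b * matching_inv p) <#\<^bsub>Sp n\<^esub> siegel_levi n = (b' * matching_inv q) <#\<^bsub>Sp n\<^esub> siegel_levi n"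
      unfolding clan_orbit_eq[OF p \<gamma>] clan_orbit_eq[OF q \<delta>] by blast
    \<comment> \<open>Equality of cosets is symmetric, so the inequality is available in both
      directions.\<close>
    have pq: "p j = q j" if "j < 2 * n" for j
      using matching_orbit_le[OF p(1) q(1) b eq that] matching_orbit_le[OF q(1) p(1) b(2,1) eq[symmetric] that]
      by (rule antisym[rotated])
    then have "clan_matching \<delta> p"
      using q(2) unfolding clan_matching_def by (auto simp: set_eq_iff)
    then show False
      using clan_matching_unique[OF _ _ p(2)] \<gamma> \<delta> neq by (auto simp: clans_over_def)
  qed
qed

end

section \<open>Normal forms in the fibre over a Schubert cell\<close>

lemma grading_square: "grading n * grading n = 1\<^sub>m (2 * n)"
  by (simp add: grading_def mult_four_block_square[where n = n] uminus_zero_mat mult_2)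

lemma transpose_grading: "transpose_mat (grading n) = grading n"
proof (rule eq_matI)
  fix i j assume "i < dim_row (grading n)" "j < dim_col (grading n)"
  then have ij: "i < 2 * n" "j < 2 * n" by (auto simp: grading_def)
  then show "transpose_mat (grading n) $$ (i, j) = grading n $$ (i, j)"
    by (simp add: carrier_matD[OF grading_carrier] grading_index)
qed (auto simp: grading_def)

text \<open>The grading lies in the symplectic Lie algebra; \<open>grading_conjugate\<close> carries
  this over to its conjugates.\<close>

lemma grading_symp_form: "grading n * symp_form n = - (symp_form n * grading n)"
proof (rule eq_matI)
  fix i j assume "i < dim_row (- (symp_form n * grading n))" "j < dim_col (- (symp_form n * grading n))"
  then have ij: "i < 2 * n" "j < 2 * n" by (auto simp: grading_def)
  have "(grading n * symp_form n) $$ (i, j) = form_sign n i * symp_form n $$ (i, j)"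
    by (rule grading_mult_index[OF symp_form_carrier ij])
  moreover have "(symp_form n * grading n) $$ (i, j) = form_sign n i * grading n $$ (2 * n - Suc i, j)"
    by (rule symp_form_mult_index[OF grading_carrier ij])
  ultimately show "(grading n * symp_form n) $$ (i, j) = (- (symp_form n * grading n)) $$ (i, j)"
    using ij form_sign_mirror[OF ij(1)]
    by (auto simp: symp_form_index grading_index carrier_matD[OF grading_carrier] simp del: index_mult_mat(1))
qed (auto simp: grading_def)

lemma Sp_transpose_mult:
  assumes g: "g \<in> carrier (Sp n)"
  shows "transpose_mat g * symp_form n = symp_form n * symp_inv n g"
proof -
  let ?m = "2 * n" and ?O = "symp_form n"
  have c: "g \<in> carrier_mat ?m ?m" "symp_inv n g \<in> carrier_mat ?m ?m" "transpose_mat g \<in> carrier_mat ?m ?m" "?O \<in> carrier_mat ?m ?m"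
    using g by (simp_all add: Sp_carrier_mat)
  note ac = mult_assoc_square[of _ ?m]
  have "transpose_mat g * ?O = transpose_mat g * ?O * (g * symp_inv n g)"
    using c by (simp add: symp_inv_mult[OF g])
  also have "\<dots> = (transpose_mat g * ?O * g) * symp_inv n g" using c by (simp add: ac)
  also have "\<dots> = ?O * symp_inv n g" using g by (simp add: carrier_Sp)
  finally show ?thesis .
qed

lemma symp_inv_symp_inv:
  assumes "g \<in> carrier (Sp n)"
  shows "symp_inv n (symp_inv n g) = g"
  using Sp.inv_inv[OF assms] by (simp add: inv_Sp assms symp_inv_closed)

text \<open>Here X is the conjugate k D k^{-1}, so it inherits from D that it squares to 1 and lies
  in the symplectic Lie algebra.\<close>

lemma grading_conjugate:
  assumes k: "k \<in> carrier (Sp n)" and X: "X \<in> carrier_mat (2 * n) (2 * n)" and Xk: "X * k = k * grading n"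
  shows "X * X = 1\<^sub>m (2 * n)" "transpose_mat X * symp_form n = - (symp_form n * X)"
proof -
  let ?m = "2 * n" and ?O = "symp_form n" and ?D = "grading n" and ?T = "transpose_mat :: complex mat \<Rightarrow> complex mat"
  define k' where "k' = symp_inv n k"
  have k': "k' \<in> carrier (Sp n)" unfolding k'_def by (rule symp_inv_closed[OF k])
  have c: "k \<in> carrier_mat ?m ?m" "k' \<in> carrier_mat ?m ?m" "?T k \<in> carrier_mat ?m ?m" "?T k' \<in> carrier_mat ?m ?m"
    "?O \<in> carrier_mat ?m ?m" "?D \<in> carrier_mat ?m ?m"
    using k k' by (simp_all add: Sp_carrier_mat)
  note ac = mult_assoc_square[of _ ?m] and un = uminus_mult_square[of _ ?m]
  have kk: "k' * k = 1\<^sub>m ?m" "k * k' = 1\<^sub>m ?m" using symp_inv_mult[OF k] by (auto simp: k'_def)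
  have eq: "X = k * ?D * k'"
  proof -
    have "X = X * (k * k')" using X by (simp add: kk)
    also have "\<dots> = X * k * k'" using X c by (simp add: ac)
    finally show ?thesis by (simp add: Xk)
  qed
  have "X * X = k * ?D * (k' * k) * ?D * k'" using c by (simp add: eq ac)
  also have "\<dots> = k * (?D * ?D) * k'" using c by (simp add: kk ac)
  also have "\<dots> = 1\<^sub>m ?m" using c by (simp add: grading_square kk)
  finally show "X * X = 1\<^sub>m ?m" .
  have kO: "?T k * ?O = ?O * k'" "?T k' * ?O = ?O * k"
    using Sp_transpose_mult[OF k] Sp_transpose_mult[OF k'] by (simp_all add: k'_def symp_inv_symp_inv[OF k])
  have "?T X * ?O = ?T k' * ?D * (?T k * ?O)"
    using c by (simp add: eq transpose_mult[of _ ?m ?m _ ?m] transpose_grading ac)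
  also have "\<dots> = ?T k' * (?D * ?O) * k'" using c by (simp add: kO ac)
  also have "\<dots> = - ((?T k' * ?O) * ?D * k')" using c by (simp add: grading_symp_form un ac)
  also have "\<dots> = - (?O * X)" unfolding kO(2) using c by (simp add: eq ac)
  finally show "?T X * ?O = - (?O * X)" .
qed

lemma involution_blocks:
  fixes P Z Y C :: "complex mat"
  assumes c: "P \<in> carrier_mat n n" "Z \<in> carrier_mat n n" "Y \<in> carrier_mat n n" "C \<in> carrier_mat n n"
    and "four_block_mat P Z Y C * four_block_mat P Z Y C = 1\<^sub>m (2 * n)"
  shows "P * P + Z * Y = 1\<^sub>m n" "Y * Z + C * C = 1\<^sub>m n"
proof -
  have "four_block_mat (P * P + Z * Y) (P * Z + Z * C) (Y * P + C * Y) (Y * Z + C * C) =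
      four_block_mat (1\<^sub>m n) (0\<^sub>m n n) (0\<^sub>m n n) (1\<^sub>m n)"
    using assms(5) c by (simp add: mult_four_block_square[where n = n] mult_2)
  then show "P * P + Z * Y = 1\<^sub>m n" "Y * Z + C * C = 1\<^sub>m n"
    using c by (simp_all add: four_block_mat_eq_iff[where n = n] del: four_block_one_mat)
qed

text \<open>Both relations feed the normal form: the one for Y makes the lower unipotent matrix
  symplectic, the one for Z makes S symmetric.\<close>

lemma skew_blocks:
  fixes P Z Y C :: "complex mat"
  assumes c: "P \<in> carrier_mat n n" "Z \<in> carrier_mat n n" "Y \<in> carrier_mat n n" "C \<in> carrier_mat n n"
    and skew: "transpose_mat (four_block_mat P Z Y C) * symp_form n = - (symp_form n * four_block_mat P Z Y C)"
  shows "transpose_mat Y * antidiag n = antidiag n * Y" "transpose_mat Z * antidiag n = antidiag n * Z"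
proof -
  let ?J = "antidiag n" and ?T = "transpose_mat :: complex mat \<Rightarrow> complex mat"
  have tc: "?T P \<in> carrier_mat n n" "?T Z \<in> carrier_mat n n" "?T Y \<in> carrier_mat n n" "?T C \<in> carrier_mat n n"
    "?J \<in> carrier_mat n n"
    using c by auto
  have "- (four_block_mat (- (?T Y * ?J)) (?T P * ?J) (- (?T C * ?J)) (?T Z * ?J)) =
      - (?T (four_block_mat P Z Y C) * symp_form n)"
    unfolding transpose_four_block_mat[OF c] symp_form_def using c tc
    by (simp add: mult_four_block_square[where n = n] uminus_mult_square[of _ n])
  also have "\<dots> = four_block_mat (?J * Y) (?J * C) (- (?J * P)) (- (?J * Z))"
    unfolding skew uminus_uminus_mat unfolding symp_form_def using c tc
    by (simp add: mult_four_block_square[where n = n] uminus_mult_square[of _ n])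
  also have "- (four_block_mat (- (?T Y * ?J)) (?T P * ?J) (- (?T C * ?J)) (?T Z * ?J)) =
      four_block_mat (?T Y * ?J) (- (?T P * ?J)) (?T C * ?J) (- (?T Z * ?J))"
    using c tc by (intro eq_matI) (auto simp del: index_mult_mat(1))
  finally show "?T Y * ?J = ?J * Y" "?T Z * ?J = ?J * Z"
    using c tc by (simp_all add: four_block_mat_eq_iff[where n = n])
qed

context isotropic_set
begin

section \<open>The signed permutation matrix w\<close>

lemma skew_matching_id: "skew_matching (\<lambda>k. k)"
  by (simp add: skew_matching_def)

abbreviation base_mat :: "complex mat" where
  "base_mat \<equiv> matching_mat (\<lambda>k. k)"

abbreviation w :: "complex mat" where
  "w \<equiv> matching_inv (\<lambda>k. k)"

abbreviation orient :: "nat \<Rightarrow> complex" where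
  "orient \<equiv> own_coeff (\<lambda>k. k)"

lemma orient_square: "orient k * orient k = 1"
  by (simp add: own_coeff_def)

lemma orient_nonzero: "orient k \<noteq> 0"
  by (simp add: own_coeff_def)

lemma w_Sp: "w \<in> carrier (Sp n)"
  by (intro symp_inv_closed matching_mat_Sp skew_matching_id)

lemma base_mat_Sp: "base_mat \<in> carrier (Sp n)"
  by (intro matching_mat_Sp skew_matching_id)

lemmas w_base_mat = symp_inv_mult[OF base_mat_Sp]

lemma base_mat_entry: "i < 2 * n \<Longrightarrow> k < 2 * n \<Longrightarrow> base_mat $$ (i, k) = (if i = \<sigma> k then orient k else 0)"
  by (simp add: matching_mat_def partner_coeff_def)

lemma base_mat_mult_index:
  assumes "h \<in> carrier_mat (2 * n) c" "i < 2 * n" "j < c"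
  shows "(base_mat * h) $$ (i, j) = orient (\<sigma> i) * h $$ (\<sigma> i, j)"
proof -
  have "(base_mat * h) $$ (i, j) = (\<Sum>k<2 * n. base_mat $$ (i, k) * h $$ (k, j))"
    by (rule index_mult_mat_sum[OF matching_mat_carrier assms])
  also have "\<dots> = (\<Sum>k<2 * n. if k = \<sigma> i then orient (\<sigma> i) * h $$ (\<sigma> i, j) else 0)"
    by (rule sum.cong) (use assms \<sigma>_\<sigma> in \<open>auto simp: base_mat_entry\<close>)
  finally show ?thesis using assms \<sigma>_less by simp
qed

lemma mult_base_mat_index:
  assumes "h \<in> carrier_mat r (2 * n)" "i < r" "j < 2 * n"
  shows "(h * base_mat) $$ (i, j) = h $$ (i, \<sigma> j) * orient j"
proof -
  have "(h * base_mat) $$ (i, j) = (\<Sum>k<2 * n. h $$ (i, k) * base_mat $$ (k, j))"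
    by (rule index_mult_mat_sum[OF assms(1) matching_mat_carrier assms(2,3)])
  also have "\<dots> = (\<Sum>k<2 * n. if k = \<sigma> j then h $$ (i, \<sigma> j) * orient j else 0)"
    by (rule sum.cong) (use assms in \<open>auto simp: base_mat_entry\<close>)
  finally show ?thesis using assms \<sigma>_less by simp
qed

lemma w_entry:
  assumes "i < 2 * n" "k < 2 * n"
  shows "w $$ (i, k) = (if k = \<sigma> i then orient i else 0)"
proof -
  \<comment> \<open>Since \<open>\<sigma>\<close> is an involution, the inverse has the same
    underlying permutation; the signs square to 1, so this candidate is a left inverse of
    \<open>base_mat\<close>.\<close>
  define W where "W = mat (2 * n) (2 * n) (\<lambda>(i, k). if k = \<sigma> i then orient i else 0)"
  have c: "W \<in> carrier_mat (2 * n) (2 * n)" "w \<in> carrier_mat (2 * n) (2 * n)" by (auto simp: W_def)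
  have "W * base_mat = 1\<^sub>m (2 * n)"
  proof (rule eq_matI)
    fix i j assume "i < dim_row (1\<^sub>m (2 * n) :: complex mat)" "j < dim_col (1\<^sub>m (2 * n) :: complex mat)"
    then have ij: "i < 2 * n" "j < 2 * n" by auto
    show "(W * base_mat) $$ (i, j) = 1\<^sub>m (2 * n) $$ (i, j)"
      using ij by (subst mult_base_mat_index[OF c(1)]) (auto simp: W_def \<sigma>_less \<sigma>_eq_iff orient_square)
  qed (auto simp: matching_mat_def W_def)
  then have "W * (base_mat * w) = w"
    using c by (simp add: mult_assoc_square[OF c(1) matching_mat_carrier c(2), symmetric])
  then have "W = w" using c by (simp add: w_base_mat)
  then have "w $$ (i, k) = W $$ (i, k)" by simp
  then show ?thesis using assms by (simp add: W_def)
qed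

lemma w_mult_index:
  assumes "h \<in> carrier_mat (2 * n) c" "i < 2 * n" "j < c"
  shows "(w * h) $$ (i, j) = orient i * h $$ (\<sigma> i, j)"
proof -
  have "(w * h) $$ (i, j) = (\<Sum>k<2 * n. w $$ (i, k) * h $$ (k, j))"
    by (rule index_mult_mat_sum[OF _ assms]) simp
  also have "\<dots> = (\<Sum>k<2 * n. if k = \<sigma> i then orient i * h $$ (\<sigma> i, j) else 0)"
    by (rule sum.cong) (use assms in \<open>auto simp: w_entry\<close>)
  finally show ?thesis using assms \<sigma>_less by simp
qed

lemma mult_w_index:
  assumes "h \<in> carrier_mat r (2 * n)" "i < r" "j < 2 * n"
  shows "(h * w) $$ (i, j) = h $$ (i, \<sigma> j) * orient (\<sigma> j)"
proof -
  have "(h * w) $$ (i, j) = (\<Sum>k<2 * n. h $$ (i, k) * w $$ (k, j))"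
    by (rule index_mult_mat_sum[OF assms(1) _ assms(2,3)]) simp
  also have "\<dots> = (\<Sum>k<2 * n. if k = \<sigma> j then h $$ (i, \<sigma> j) * orient (\<sigma> j) else 0)"
    by (rule sum.cong) (use assms \<sigma>_\<sigma> in \<open>auto simp: w_entry\<close>)
  finally show ?thesis using assms \<sigma>_less by simp
qed

lemma translate_w: "translate w (base_lagrangian n) = coordinate_span n I"
proof -
  have sub: "{..<n} \<subseteq> {..<2 * n}" by auto
  have idx: "(w *\<^sub>v v) $ i = orient i * v $ \<sigma> i" if v: "v \<in> carrier_vec (2 * n)" and i: "i < 2 * n" for v i
  proof -
    have "(w *\<^sub>v v) $ i = (\<Sum>k<2 * n. w $$ (i, k) * v $ k)"
      by (rule index_mult_mat_vec_sum[OF _ v i]) simp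
    also have "\<dots> = (\<Sum>k<2 * n. if k = \<sigma> i then orient i * v $ \<sigma> i else 0)"
      by (rule sum.cong) (use i in \<open>auto simp: w_entry\<close>)
    finally show ?thesis using i \<sigma>_less by simp
  qed
  have wc: "w *\<^sub>v v \<in> carrier_vec (2 * n)" if "v \<in> carrier_vec (2 * n)" for v
    using that by (intro mult_mat_vec_carrier[of _ _ "2 * n"]) simp_all
  show ?thesis
  proof
    show "translate w (base_lagrangian n) \<subseteq> coordinate_span n I"
    proof
      fix u assume "u \<in> translate w (base_lagrangian n)"
      then obtain v where v: "v \<in> base_lagrangian n" "u = w *\<^sub>v v" by (auto simp: translate_def)
      then have vc: "v \<in> carrier_vec (2 * n)" using base_lagrangian_carrier by blast
      have "u $ i = 0" if "i < 2 * n" "i \<notin> I" for i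
        using v that idx[OF vc that(1)] \<sigma>_less_half_iff[of i] \<sigma>_less[of i] by (auto simp: coordinate_span_eq[OF sub])
      then show "u \<in> coordinate_span n I" using wc[OF vc] v(2) by (simp add: coordinate_span_eq[OF subset])
    qed
    show "coordinate_span n I \<subseteq> translate w (base_lagrangian n)"
    proof
      fix u assume "u \<in> coordinate_span n I"
      then have uc: "u \<in> carrier_vec (2 * n)" and u0: "\<And>i. i < 2 * n \<Longrightarrow> i \<notin> I \<Longrightarrow> u $ i = 0"
        by (auto simp: coordinate_span_eq[OF subset])
      let ?v = "vec (2 * n) (\<lambda>k. orient (\<sigma> k) * u $ \<sigma> k)"
      have vc: "?v \<in> carrier_vec (2 * n)" by simp
      have "?v \<in> base_lagrangian n"
        using u0 \<sigma>_less \<sigma>_in_iff by (auto simp: coordinate_span_eq[OF sub])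
      moreover have "w *\<^sub>v ?v = u"
      proof (rule eq_vecI)
        fix i assume "i < dim_vec u"
        then have i: "i < 2 * n" using uc by simp
        have "(w *\<^sub>v ?v) $ i = orient i * orient i * u $ i"
          using idx[OF vc i] \<sigma>_less[OF i] by (simp add: \<sigma>_\<sigma>[OF i] mult.assoc)
        then show "(w *\<^sub>v ?v) $ i = u $ i" by (simp add: orient_square)
      qed (use carrier_vecD[OF wc[OF vc]] uc in simp)
      ultimately show "u \<in> translate w (base_lagrangian n)" unfolding translate_def by (rule rev_image_eqI[OF _ sym])
    qed
  qed
qed

text \<open>Conjugation by w relabels rows and columns by \<open>\<sigma>\<close>. A factor to the
  right of w that is triangular in this order can thus be moved into B.\<close>

lemma borel_conjugate:
  assumes h: "h \<in> carrier (Sp n)"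
    and tri: "\<And>k l. k < 2 * n \<Longrightarrow> l < 2 * n \<Longrightarrow> h $$ (k, l) \<noteq> 0 \<Longrightarrow> \<sigma> k \<le> \<sigma> l"
  shows "w * h * base_mat \<in> borel_subgroup n"
  unfolding borel_index
proof (intro conjI allI impI)
  have c: "h \<in> carrier_mat (2 * n) (2 * n)" "w * h \<in> carrier_mat (2 * n) (2 * n)"
    using h by (simp_all add: Sp_carrier_mat)
  show "w * h * base_mat \<in> carrier (Sp n)" by (intro Sp_mult_closed w_Sp h base_mat_Sp)
  fix i j assume ij: "i < 2 * n" "j < 2 * n" and nz: "(w * h * base_mat) $$ (i, j) \<noteq> 0"
  have "(w * h * base_mat) $$ (i, j) = orient i * h $$ (\<sigma> i, \<sigma> j) * orient j"
    using ij c \<sigma>_less[OF ij(2)] by (subst mult_base_mat_index[OF c(2)]) (simp_all add: w_mult_index[OF c(1)] del: index_mult_mat(1))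
  then have "h $$ (\<sigma> i, \<sigma> j) \<noteq> 0" using nz by auto
  then show "i \<le> j" using tri[OF \<sigma>_less[OF ij(1)] \<sigma>_less[OF ij(2)]] ij by (simp add: \<sigma>_\<sigma>)
qed

section \<open>The action of the Borel subgroup on S\<close>

definition same_double_coset :: "complex mat \<Rightarrow> complex mat \<Rightarrow> bool" where
  "same_double_coset S T \<longleftrightarrow>
     (\<exists>b\<in>borel_subgroup n. \<exists>l\<in>siegel_levi n. w * unip n S = b * (w * unip n T) * l)"

lemma same_double_coset_trans:
  assumes "same_double_coset S T" "same_double_coset T U" "U \<in> carrier_mat n n"
  shows "same_double_coset S U"
proof -
  obtain b l where b: "b \<in> borel_subgroup n" "l \<in> siegel_levi n" "w * unip n S = b * (w * unip n T) * l"
    using assms(1) by (auto simp: same_double_coset_def)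
  obtain b' l' where b': "b' \<in> borel_subgroup n" "l' \<in> siegel_levi n" "w * unip n T = b' * (w * unip n U) * l'"
    using assms(2) by (auto simp: same_double_coset_def)
  have c: "b \<in> carrier_mat (2 * n) (2 * n)" "b' \<in> carrier_mat (2 * n) (2 * n)"
    "l \<in> carrier_mat (2 * n) (2 * n)" "l' \<in> carrier_mat (2 * n) (2 * n)"
    using b b' by (auto intro: Sp_carrier_mat borel_Sp siegel_levi_Sp)
  have "w * unip n S = (b * b') * (w * unip n U) * (l' * l)"
    unfolding b(3) b'(3) using c unip_carrier[OF assms(3)] by (simp add: mult_assoc_square[of _ "2 * n"])
  moreover have "b * b' \<in> borel_subgroup n" by (intro borel_mult b b')
  moreover have "l' * l \<in> siegel_levi n"
    using subgroup.m_closed[OF subgroup_siegel_levi b'(2) b(2)] by simp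
  ultimately show ?thesis unfolding same_double_coset_def by blast
qed

lemma levi_mat_index:
  assumes "A \<in> carrier_mat n n" "A' \<in> carrier_mat n n" "k < 2 * n" "l < 2 * n"
  shows "levi_mat n A A' $$ (k, l) =
    (if k < n \<and> l < n then A $$ (k, l) else if n \<le> k \<and> n \<le> l then A' $$ (mir l, mir k) else 0)"
proof -
  have J: "(antidiag n * B) $$ (i, j) = B $$ (n - Suc i, j)" if "B \<in> carrier_mat n n" "i < n" "j < n" for B i j
  proof -
    have "(antidiag n * B) $$ (i, j) = (\<Sum>m<n. antidiag n $$ (i, m) * B $$ (m, j))"
      by (rule index_mult_mat_sum[OF antidiag_carrier that])
    also have "\<dots> = (\<Sum>m<n. if m = n - Suc i then B $$ (n - Suc i, j) else 0)"
      by (rule sum.cong) (use that in \<open>auto simp: antidiag_def\<close>)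
    finally show ?thesis using that by simp
  qed
  have J': "(B * antidiag n) $$ (i, j) = B $$ (i, n - Suc j)" if "B \<in> carrier_mat n n" "i < n" "j < n" for B i j
  proof -
    have "(B * antidiag n) $$ (i, j) = (\<Sum>m<n. B $$ (i, m) * antidiag n $$ (m, j))"
      by (rule index_mult_mat_sum[OF that(1) antidiag_carrier that(2,3)])
    also have "\<dots> = (\<Sum>m<n. if m = n - Suc j then B $$ (i, n - Suc j) else 0)"
      by (rule sum.cong) (use that in \<open>auto simp: antidiag_def\<close>)
    finally show ?thesis using that by simp
  qed
  have "(antidiag n * transpose_mat A' * antidiag n) $$ (i, j) = A' $$ (n - Suc j, n - Suc i)"
    if "i < n" "j < n" for i j
    using that assms by (simp add: J J' carrier_matD[OF assms(2)] del: index_mult_mat(1))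
  then show ?thesis
    using assms by (auto simp: levi_mat_def simp del: index_mult_mat(1)) (auto intro!: arg_cong[of _ _ "($$) A'"])
qed

lemma triangular_congruent_sym:
  assumes "triangular_congruent n r S T" "S \<in> carrier_mat n n"
  shows "triangular_congruent n r T S"
proof -
  obtain A A' where A: "rank_triangular n r A" "rank_triangular n r A'" "A * A' = 1\<^sub>m n"
    and T: "T = A * S * transpose_mat A"
    using assms(1) by (auto simp: triangular_congruent_def)
  have c: "A \<in> carrier_mat n n" "A' \<in> carrier_mat n n" using A by (auto simp: rank_triangular_def)
  have inv: "A' * A = 1\<^sub>m n" by (rule mat_mult_left_right_inverse[OF c A(3)])
  have "A' * T * transpose_mat A' = (A' * A) * S * transpose_mat (A' * A)"
    unfolding T using c assms(2) by (simp add: transpose_mult[of _ n n _ n] mult_assoc_square[of _ n])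
  then have "S = A' * T * transpose_mat A'" using assms(2) by (simp add: inv)
  then show ?thesis unfolding triangular_congruent_def using A inv by blast
qed

text \<open>The Levi element built from A passes through u_S, replacing S by A S A^t. Its conjugate
  by w is absorbed into B and its inverse into L.\<close>

lemma same_double_coset_congruent:
  assumes S: "S \<in> carrier_mat n n" and con: "triangular_congruent n \<sigma> S T"
  shows "same_double_coset T S"
proof -
  obtain A A' where A: "rank_triangular n \<sigma> A" "rank_triangular n \<sigma> A'" "A * A' = 1\<^sub>m n"
    and T: "T = A * S * transpose_mat A"
    using con by (auto simp: triangular_congruent_def)
  have c: "A \<in> carrier_mat n n" "A' \<in> carrier_mat n n" using A by (auto simp: rank_triangular_def)
  then have Tc: "T \<in> carrier_mat n n" using S by (simp add: T)
  let ?l = "levi_mat n A A'" and ?l' = "symp_inv n (levi_mat n A A')"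
  have l: "?l \<in> siegel_levi n" by (rule levi_mat_in_levi[OF c A(3)])
  have l': "?l' \<in> siegel_levi n"
    using subgroup.m_inv_closed[OF subgroup_siegel_levi l] by (simp add: inv_Sp siegel_levi_Sp[OF l])
  have "w * ?l * base_mat \<in> borel_subgroup n"
  proof (rule borel_conjugate[OF siegel_levi_Sp[OF l]])
    fix k m assume km: "k < 2 * n" "m < 2 * n" and nz: "?l $$ (k, m) \<noteq> 0"
    consider "k < n" "m < n" "A $$ (k, m) \<noteq> 0" | "n \<le> k" "n \<le> m" "A' $$ (mir m, mir k) \<noteq> 0"
      using nz unfolding levi_mat_index[OF c km] by (auto split: if_splits)
    then show "\<sigma> k \<le> \<sigma> m"
    proof cases
      case 1
      then show ?thesis using A(1) by (simp add: rank_triangular_def)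
    next
      case 2
      \<comment> \<open>The lower block is a reflected copy of A', and reflection also reverses the
        order of the ranks; the two reversals cancel.\<close>
      then have "mir m < n" "mir k < n" using km by auto
      then have "mir (\<sigma> m) \<le> mir (\<sigma> k)" using A(2) 2 km by (simp add: rank_triangular_def \<sigma>_mir[symmetric])
      then show ?thesis using \<sigma>_less[OF km(1)] \<sigma>_less[OF km(2)] by linarith
    qed
  qed
  moreover have "w * unip n T = (w * ?l * base_mat) * (w * unip n S) * ?l'"
  proof -
    have cc: "?l \<in> carrier_mat (2 * n) (2 * n)" "?l' \<in> carrier_mat (2 * n) (2 * n)"
      using l l' by (auto intro: Sp_carrier_mat siegel_levi_Sp)
    note u = unip_carrier[OF S] unip_carrier[OF Tc]
    have "(w * ?l * base_mat) * (w * unip n S) * ?l' = w * ?l * (base_mat * w) * unip n S * ?l'"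
      using cc u by (simp add: mult_assoc_square[of _ "2 * n"])
    also have "\<dots> = w * (?l * unip n S) * ?l'"
      using cc u by (simp add: w_base_mat mult_assoc_square[of _ "2 * n"])
    also have "\<dots> = w * unip n T * (?l * ?l')"
      unfolding levi_mat_unip[OF c A(3) S] T[symmetric] using cc u by (simp add: mult_assoc_square[of _ "2 * n"])
    finally show ?thesis
      using u by (simp add: symp_inv_mult[OF siegel_levi_Sp[OF l]])
  qed
  ultimately show ?thesis unfolding same_double_coset_def using l' by blast
qed

lemma unip_index:
  assumes "S \<in> carrier_mat n n" "k < 2 * n" "l < 2 * n"
  shows "unip n S $$ (k, l) = (if k < n \<and> n \<le> l then S $$ (k, mir l) else if k = l then 1 else 0)"
proof -
  have "(S * antidiag n) $$ (i, j) = S $$ (i, n - Suc j)" if "i < n" "j < n" for i j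
  proof -
    have "(S * antidiag n) $$ (i, j) = (\<Sum>m<n. S $$ (i, m) * antidiag n $$ (m, j))"
      by (rule index_mult_mat_sum[OF assms(1) antidiag_carrier that])
    also have "\<dots> = (\<Sum>m<n. if m = n - Suc j then S $$ (i, n - Suc j) else 0)"
      by (rule sum.cong) (use that in \<open>auto simp: antidiag_def\<close>)
    finally show ?thesis using that by simp
  qed
  moreover have "n - Suc (l - n) = mir l" if "n \<le> l" using that by simp
  ultimately show ?thesis
    using assms by (auto simp: unip_def simp del: index_mult_mat(1))
qed

text \<open>Entry (k, l) of S sits in u_S at (k, \<open>mir l\<close>). After conjugation by w it is
  upper triangular when \<open>\<sigma> k \<le> mir (\<sigma> l)\<close>, that is, when the ranks
  sum to less than 2n. That part of S splits off as a unipotent factor in B.\<close>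

lemma same_double_coset_truncate:
  assumes S: "S \<in> carrier_mat n n" and sym: "\<And>k l. k < n \<Longrightarrow> l < n \<Longrightarrow> S $$ (k, l) = S $$ (l, k)"
  shows "same_double_coset S (mat n n (\<lambda>(k, l). if 2 * n \<le> \<sigma> k + \<sigma> l then S $$ (k, l) else 0))"
proof -
  let ?T = "mat n n (\<lambda>(k, l). if 2 * n \<le> \<sigma> k + \<sigma> l then S $$ (k, l) else 0)"
  let ?R = "mat n n (\<lambda>(k, l). if 2 * n \<le> \<sigma> k + \<sigma> l then 0 else S $$ (k, l))"
  have c: "?T \<in> carrier_mat n n" "?R \<in> carrier_mat n n" by auto
  have "transpose_mat ?R = ?R" by (rule eq_matI) (auto simp: add.commute sym)
  then have uR: "unip n ?R \<in> carrier (Sp n)" by (intro unip_Sp c)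
  have "w * unip n ?R * base_mat \<in> borel_subgroup n"
  proof (rule borel_conjugate[OF uR])
    fix k l assume kl: "k < 2 * n" "l < 2 * n" and nz: "unip n ?R $$ (k, l) \<noteq> 0"
    show "\<sigma> k \<le> \<sigma> l"
    proof (cases "k = l")
      case False
      then have k: "k < n" "n \<le> l" "?R $$ (k, mir l) \<noteq> 0"
        using nz unfolding unip_index[OF c(2) kl] by (auto split: if_splits)
      moreover have "mir l < n" using k kl by auto
      ultimately have "\<sigma> k + \<sigma> (mir l) < 2 * n" by (auto split: if_splits)
      then show ?thesis using \<sigma>_less[OF kl(2)] by (simp add: \<sigma>_mir[OF kl(2)])
    qed simp
  qed
  moreover have "w * unip n S = (w * unip n ?R * base_mat) * (w * unip n ?T) * 1\<^sub>m (2 * n)"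
  proof -
    note u = unip_carrier[OF c(1)] unip_carrier[OF c(2)]
    have "?R + ?T = S" by (rule eq_matI) (use S in auto)
    then have "w * unip n S = w * (unip n ?R * unip n ?T)" by (simp add: unip_mult[OF c(2,1)])
    also have "\<dots> = w * unip n ?R * (base_mat * w) * unip n ?T"
      using u by (simp add: w_base_mat mult_assoc_square[of _ "2 * n"])
    finally show ?thesis using u by (simp add: mult_assoc_square[of _ "2 * n"])
  qed
  moreover have "1\<^sub>m (2 * n) \<in> siegel_levi n"
    using subgroup.one_closed[OF subgroup_siegel_levi] by simp
  ultimately show ?thesis unfolding same_double_coset_def by blast
qed

section \<open>Normal form of a clan matrix\<close>

text \<open>
  In block form the base matrix conjugates the involution matrix to \<open>(P Z; Y C)\<close>. Conjugating this by
  the lower unipotent matrix with block \<open>Y\<close> gives \<open>(1 Z; 0 -1)\<close>, which is the conjugate of the grading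
  by \<open>u\<^sub>S\<close> for \<open>S J = -Z / 2\<close>.
\<close>

lemma normal_form_coset:
  assumes p: "skew_matching p"
  shows "\<exists>b\<in>borel_subgroup n. \<exists>S. S \<in> carrier_mat n n \<and> transpose_mat S = S \<and>
    (\<forall>k<n. \<forall>l<n. S $$ (k, l) \<noteq> 0 \<longleftrightarrow> \<sigma> k = p (mir (\<sigma> l))) \<and>
    matching_inv p <#\<^bsub>Sp n\<^esub> siegel_levi n = (b * (w * unip n S)) <#\<^bsub>Sp n\<^esub> siegel_levi n"
proof -
  let ?m = "2 * n" and ?J = "antidiag n" and ?D = "grading n" and ?O = "symp_form n"
  let ?T = "transpose_mat :: complex mat \<Rightarrow> complex mat"
  let ?h = "matching_inv p" and ?M = "involution_mat p"
  note ac = mult_assoc_square[of _ ?m] and an = mult_assoc_square[of _ n]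
  have car: "?h \<in> carrier_mat ?m ?m" "?M \<in> carrier_mat ?m ?m" "w \<in> carrier_mat ?m ?m"
    "base_mat \<in> carrier_mat ?m ?m" "?D \<in> carrier_mat ?m ?m" "?O \<in> carrier_mat ?m ?m" by auto
  have hSp: "?h \<in> carrier (Sp n)" by (intro symp_inv_closed matching_mat_Sp p)

  define M' where "M' = base_mat * ?M * w"
  have M'c: "M' \<in> carrier_mat ?m ?m" using car by (simp add: M'_def)
  have M'_entry: "M' $$ (i, j) = orient (\<sigma> i) * ?M $$ (\<sigma> i, \<sigma> j) * orient (\<sigma> j)" if ij: "i < ?m" "j < ?m" for i j
  proof -
    have c: "base_mat * ?M \<in> carrier_mat ?m ?m" using car by simp
    show ?thesis unfolding M'_def mult_w_index[OF c ij]
      using base_mat_mult_index[OF car(2) ij(1) \<sigma>_less[OF ij(2)]] by simp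
  qed
  have M'_supp: "M' $$ (i, j) \<noteq> 0 \<longleftrightarrow> \<sigma> i = p (\<sigma> j)" if ij: "i < ?m" "j < ?m" for i j
    using ij by (auto simp: M'_entry involution_mat_def \<sigma>_less orient_nonzero)

  have kSp: "base_mat * ?h \<in> carrier (Sp n)" by (intro Sp_mult_closed base_mat_Sp hSp)
  have "M' * (base_mat * ?h) = base_mat * ?h * ?D"
  proof -
    have "M' * (base_mat * ?h) = base_mat * ?M * (w * base_mat) * ?h" using car by (simp add: M'_def ac)
    also have "\<dots> = base_mat * (?M * ?h)" using car by (simp add: w_base_mat ac)
    also have "\<dots> = base_mat * ?h * ?D" using car by (simp add: involution_matching_inv[OF p] ac)
    finally show ?thesis .
  qed
  note M'_conj = grading_conjugate[OF kSp M'c this]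

  obtain P Z Y C where c: "P \<in> carrier_mat n n" "Z \<in> carrier_mat n n" "Y \<in> carrier_mat n n" "C \<in> carrier_mat n n"
    and blocks: "M' = four_block_mat P Z Y C"
    using M'c by (rule block_cases)
  have Jc: "?J \<in> carrier_mat n n" and JJ: "?J * ?J = 1\<^sub>m n" by (auto simp: antidiag_square)
  note sq = involution_blocks[OF c M'_conj(1)[unfolded blocks]]
  note sym = skew_blocks[OF c M'_conj(2)[unfolded blocks]]
  have Pe: "P $$ (i, j) = M' $$ (i, j)" and Ze: "Z $$ (i, j) = M' $$ (i, n + j)"
    and Ye: "Y $$ (i, j) = M' $$ (n + i, j)" and Ce: "C $$ (i, j) = M' $$ (n + i, n + j)" if "i < n" "j < n" for i j
    using that c by (auto simp: blocks)
  have fixpt: "a = b" if ab: "a < ?m" "b < ?m" "a = p b" "a \<in> I \<longleftrightarrow> b \<in> I" for a b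
    using skew_matching_in_iff[OF p ab(2)] ab by auto
  \<comment> \<open>Within a diagonal block both positions lie on the same side of I, so a nonzero
    entry forces a fixed point of p. Hence P is diagonal with entries 0 or 1, and C is diagonal with
    entries 0 or -1.\<close>
  have diag: "M' $$ (i, j) = 0 \<or> i = j \<and> M' $$ (i, j) = base_sign (\<sigma> i)"
    if ij: "i < ?m" "j < ?m" "i < n \<longleftrightarrow> j < n" for i j
  proof (cases "M' $$ (i, j) = 0")
    case False
    then have eq: "\<sigma> i = p (\<sigma> j)" using M'_supp ij by blast
    have "\<sigma> i = \<sigma> j"
      by (rule fixpt[OF \<sigma>_less[OF ij(1)] \<sigma>_less[OF ij(2)] eq]) (use ij in \<open>simp add: \<sigma>_in_iff\<close>)
    then have "i = j" using \<sigma>_eq_iff ij by blast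
    then have "p (\<sigma> i) = \<sigma> i" using eq by simp
    then have "?M $$ (\<sigma> i, \<sigma> i) = base_sign (\<sigma> i)"
      using \<sigma>_less[OF ij(1)] by (simp add: involution_mat_def involution_coeff_def)
    then have "M' $$ (i, i) = base_sign (\<sigma> i) * (orient (\<sigma> i) * orient (\<sigma> i))"
      using M'_entry[OF ij(1,1)] by simp
    then show ?thesis using \<open>i = j\<close> by (simp add: orient_square)
  qed simp
  have PP: "P * P = P"
  proof (rule eq_matI)
    fix i j assume "i < dim_row P" "j < dim_col P"
    then have ij: "i < n" "j < n" using c by auto
    have "(P * P) $$ (i, j) = (\<Sum>m<n. P $$ (i, m) * P $$ (m, j))"
      by (rule index_mult_mat_sum[OF c(1,1) ij])
    also have "\<dots> = (\<Sum>m<n. if m = i then P $$ (i, j) else 0)"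
    proof (rule sum.cong[OF refl])
      fix m assume m: "m \<in> {..<n}"
      show "P $$ (i, m) * P $$ (m, j) = (if m = i then P $$ (i, j) else 0)"
        using diag[of i m] diag[of i i] diag[of i j] \<sigma>_in_iff[of i] ij m by (auto simp: Pe base_sign_def)
    qed
    finally show "(P * P) $$ (i, j) = P $$ (i, j)" using ij by simp
  qed (use c in auto)
  have CC: "C * C = - C"
  proof (rule eq_matI)
    fix i j assume "i < dim_row (- C)" "j < dim_col (- C)"
    then have ij: "i < n" "j < n" using c by auto
    have "(C * C) $$ (i, j) = (\<Sum>m<n. C $$ (i, m) * C $$ (m, j))"
      by (rule index_mult_mat_sum[OF c(4,4) ij])
    also have "\<dots> = (\<Sum>m<n. if m = i then - C $$ (i, j) else 0)"
    proof (rule sum.cong[OF refl])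
      fix m assume m: "m \<in> {..<n}"
      show "C $$ (i, m) * C $$ (m, j) = (if m = i then - C $$ (i, j) else 0)"
        using diag[of "n + i" "n + m"] diag[of "n + i" "n + i"] diag[of "n + i" "n + j"] \<sigma>_in_iff[of "n + i"] ij m
        by (auto simp: Ce base_sign_def)
    qed
    finally show "(C * C) $$ (i, j) = (- C) $$ (i, j)" using ij c by simp
  qed (use c in auto)
  \<comment> \<open>A nonzero diagonal entry of C marks a fixed point of p, whereas a nonzero entry
    of Y in that row would match the same position with one in the other half.\<close>
  have CY: "C * Y = 0\<^sub>m n n"
  proof (rule eq_matI)
    fix i j assume "i < dim_row (0\<^sub>m n n :: complex mat)" "j < dim_col (0\<^sub>m n n :: complex mat)"
    then have ij: "i < n" "j < n" by auto
    have "(C * Y) $$ (i, j) = (\<Sum>m<n. C $$ (i, m) * Y $$ (m, j))"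
      by (rule index_mult_mat_sum[OF c(4,3) ij])
    also have "\<dots> = 0"
    proof (rule sum.neutral, rule ballI)
      fix m assume m: "m \<in> {..<n}"
      show "C $$ (i, m) * Y $$ (m, j) = 0"
      proof (rule ccontr)
        assume "C $$ (i, m) * Y $$ (m, j) \<noteq> 0"
        then have nz: "M' $$ (n + i, n + m) \<noteq> 0" "M' $$ (n + m, j) \<noteq> 0" using ij m by (auto simp: Ce Ye)
        have "i = m" using diag[of "n + i" "n + m"] nz ij m by auto
        then have "\<sigma> (n + m) = p (\<sigma> (n + m))" "\<sigma> (n + m) = p (\<sigma> j)"
          using nz M'_supp[of "n + i" "n + m"] M'_supp[of "n + m" j] ij m by auto
        moreover have "\<sigma> j < ?m" using \<sigma>_less ij by simp
        ultimately have "\<sigma> (n + m) = \<sigma> j"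
          using skew_matchingD(2)[OF p, of "\<sigma> j"] by simp
        then show False using \<sigma>_eq_iff[of "n + m" j] ij m by simp
      qed
    qed
    finally show "(C * Y) $$ (i, j) = 0\<^sub>m n n $$ (i, j)" using ij by simp
  qed (use c in auto)
  \<comment> \<open>Combining Y Z + C C = 1 with C C = -C; this is the lower right block required
    for M' H = H N.\<close>
  have YZ: "Y * Z - 1\<^sub>m n = C"
  proof -
    have "(Y * Z) $$ (i, j) + (C * C) $$ (i, j) = 1\<^sub>m n $$ (i, j)" if "i < n" "j < n" for i j
      using arg_cong[OF sq(2), of "\<lambda>X. X $$ (i, j)"] that c by (simp del: index_mult_mat(1))
    then show ?thesis
      unfolding CC using c by (intro eq_matI) (auto simp del: index_mult_mat(1) simp: algebra_simps)
  qed

  \<comment> \<open>Conjugating the grading by u_S gives upper right block -2 S J, which is to equal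
    Z.\<close>
  define S where "S = (- 1 / 2) \<cdot>\<^sub>m (Z * ?J)"
  have Sc: "S \<in> carrier_mat n n" using c Jc by (simp add: S_def)
  have TS: "?T S = S"
  proof -
    have "?T (Z * ?J) = ?J * ?T Z" using c Jc by (simp add: transpose_mult[of _ n n _ n] transpose_antidiag)
    also have "\<dots> = ?J * (?T Z * ?J) * ?J" using c Jc by (simp add: an JJ)
    also have "\<dots> = (?J * ?J) * Z * ?J" unfolding sym(2) using c Jc by (simp add: an)
    also have "\<dots> = Z * ?J" using c Jc by (simp add: JJ)
    finally have "?T (Z * ?J) = Z * ?J" .
    moreover have "?T ((- 1 / 2) \<cdot>\<^sub>m (Z * ?J)) = (- 1 / 2) \<cdot>\<^sub>m ?T (Z * ?J)"
      by (rule eq_matI) (simp_all del: index_mult_mat(1))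
    ultimately show ?thesis unfolding S_def by simp
  qed
  have SJ: "S * ?J = (- 1 / 2) \<cdot>\<^sub>m Z"
    unfolding S_def using c Jc by (subst mult_smult_assoc_mat[of _ n n _ n]) (simp_all add: an JJ)
  have S_entry: "S $$ (i, j) = - 1 / 2 * M' $$ (i, mir j)" if ij: "i < n" "j < n" for i j
  proof -
    have "(Z * ?J) $$ (i, j) = (\<Sum>m<n. Z $$ (i, m) * ?J $$ (m, j))"
      by (rule index_mult_mat_sum[OF c(2) Jc ij])
    also have "\<dots> = (\<Sum>m<n. if m = n - Suc j then Z $$ (i, n - Suc j) else 0)"
      by (rule sum.cong) (use ij in \<open>auto simp: antidiag_def\<close>)
    also have "\<dots> = M' $$ (i, n + (n - Suc j))" using ij by (simp add: Ze)
    also have "n + (n - Suc j) = mir j" using ij by simp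
    finally show ?thesis using ij c Jc by (simp add: S_def del: index_mult_mat(1))
  qed
  have S_supp: "S $$ (i, j) \<noteq> 0 \<longleftrightarrow> \<sigma> i = p (mir (\<sigma> j))" if ij: "i < n" "j < n" for i j
    using M'_supp[of i "mir j"] ij \<sigma>_mir[of j] by (auto simp: S_entry)

  define H where "H = four_block_mat (1\<^sub>m n) (0\<^sub>m n n) Y (1\<^sub>m n)"
  have HSp: "H \<in> carrier (Sp n)" unfolding H_def by (rule Sp_lower_unipotent[OF c(3) sym(1)])
  have "w * H * base_mat \<in> borel_subgroup n"
  proof (rule borel_conjugate[OF HSp])
    fix i j assume ij: "i < ?m" "j < ?m" and nz: "H $$ (i, j) \<noteq> 0"
    show "\<sigma> i \<le> \<sigma> j"
    proof (cases "i = j")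
      case False
      then have i: "n \<le> i" "j < n" "Y $$ (i - n, j) \<noteq> 0"
        using nz ij c by (auto simp: H_def split: if_splits)
      then have "M' $$ (i, j) \<noteq> 0" using Ye[of "i - n" j] ij by auto
      then have eq: "\<sigma> i = p (\<sigma> j)" using M'_supp ij by blast
      \<comment> \<open>Here the order condition on the matching enters: a position in I is never a
        first member, so p cannot move it upwards, and H is triangular in the order of
        \<open>\<sigma>\<close>.\<close>
      have "\<sigma> j \<in> I" using \<sigma>_in_iff[OF ij(2)] i by simp
      then have "\<not> \<sigma> j < p (\<sigma> j)" using skew_matchingD(4)[OF p \<sigma>_less[OF ij(2)]] by blast
      then show ?thesis using eq by simp
    qed simp
  qed
  \<comment> \<open>Both representatives are compared through the conjugate
    \<open>involution_mat p\<close> of the grading, so no Levi factor has to be exhibited.\<close>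
  moreover have "matching_inv p <#\<^bsub>Sp n\<^esub> siegel_levi n = (w * H * base_mat * (w * unip n S)) <#\<^bsub>Sp n\<^esub> siegel_levi n"
  proof (rule levi_coset_eqI[OF hSp _ car(2)])
    let ?u = "unip n S"
    have uSp: "?u \<in> carrier (Sp n)" by (rule unip_Sp[OF Sc TS])
    have uc: "?u \<in> carrier_mat ?m ?m" and Hc: "H \<in> carrier_mat ?m ?m" using uSp HSp by (auto intro: Sp_carrier_mat)
    show "w * H * base_mat * (w * ?u) \<in> carrier (Sp n)" by (intro Sp_mult_closed w_Sp base_mat_Sp HSp uSp)
    show "?M * ?h = ?h * ?D" by (rule involution_matching_inv[OF p])
    define N where "N = four_block_mat (1\<^sub>m n) Z (0\<^sub>m n n) (- 1\<^sub>m n)"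
    have Nc: "N \<in> carrier_mat ?m ?m" by (simp add: N_def)
    have HN: "M' * H = H * N"
    proof -
      have "M' * H = four_block_mat (P + Z * Y) Z (Y + C * Y) C"
        unfolding blocks H_def using c by (simp add: mult_four_block_square[where n = n])
      also have "\<dots> = four_block_mat (1\<^sub>m n) Z Y (Y * Z - 1\<^sub>m n)"
        using sq(1) c by (simp add: PP CY YZ)
      also have "\<dots> = H * N"
        unfolding H_def N_def using c by (simp add: mult_four_block_square[where n = n]) (auto simp: mat_eq_iff)
      finally show ?thesis .
    qed
    have Nu: "N * ?u = ?u * ?D"
    proof -
      have "S * ?J + Z = - (S * ?J)" unfolding SJ using c by (auto simp: mat_eq_iff)
      then show ?thesis unfolding N_def unip_def grading_def using c Sc Jc
        by (simp add: mult_four_block_square[where n = n])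
    qed
    have Mw: "?M * w = w * M'"
    proof -
      have "w * M' = (w * base_mat) * ?M * w" using car by (simp add: M'_def ac)
      then show ?thesis using car by (simp add: w_base_mat)
    qed
    have red: "w * H * base_mat * (w * ?u) = w * (H * ?u)"
    proof -
      have "w * H * base_mat * (w * ?u) = w * H * (base_mat * w) * ?u" using car uc Hc by (simp add: ac)
      then show ?thesis using car uc Hc by (simp add: w_base_mat ac)
    qed
    have "?M * (w * (H * ?u)) = (?M * w) * (H * ?u)" using car uc Hc by (simp add: ac)
    also have "\<dots> = w * (M' * H) * ?u" unfolding Mw using car uc Hc M'c by (simp add: ac)
    also have "\<dots> = w * H * (N * ?u)" unfolding HN using car uc Hc Nc by (simp add: ac)
    also have "\<dots> = w * (H * ?u) * ?D" unfolding Nu using car uc Hc by (simp add: ac)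
    finally show "?M * (w * H * base_mat * (w * ?u)) = w * H * base_mat * (w * ?u) * ?D" unfolding red .
  qed
  ultimately show ?thesis using Sc TS S_supp by blast
qed

section \<open>From reduced symmetric matrices to matchings\<close>

text \<open>Inverts the support rule of \<open>normal_form_coset\<close>: an entry (k, l) in the
  surviving staircase matches \<open>mir (\<sigma> l)\<close> with \<open>\<sigma> k\<close>.
  Symmetry of T gives the mirrored pair, and a diagonal entry matches a position with its own mirror
  image.\<close>

lemma matching_of_reduced:
  assumes T: "reduced_off n {} T"
  shows "\<exists>p. skew_matching p \<and>
    (\<forall>k<n. \<forall>l<n. T $$ (k, l) \<noteq> 0 \<and> 2 * n \<le> \<sigma> k + \<sigma> l \<longleftrightarrow> \<sigma> k = p (mir (\<sigma> l)))"
proof -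
  have sym: "\<And>k l. k < n \<Longrightarrow> l < n \<Longrightarrow> T $$ (k, l) = T $$ (l, k)"
    and uniq: "\<And>k l l'. k < n \<Longrightarrow> l < n \<Longrightarrow> l' < n \<Longrightarrow> T $$ (k, l) \<noteq> 0 \<Longrightarrow> T $$ (k, l') \<noteq> 0 \<Longrightarrow> l' = l"
    using T unfolding reduced_off_def by blast+
  \<comment> \<open>The support of T rewritten in positions of I. The matching sends i to
    \<open>mir j\<close> and \<open>mir i\<close> to j whenever \<open>R i j\<close>.\<close>
  define R where "R i j \<longleftrightarrow> i \<in> I \<and> j \<in> I \<and> T $$ (\<sigma> i, \<sigma> j) \<noteq> 0 \<and> 2 * n \<le> i + j" for i j
  have I_less: "i < 2 * n" "\<sigma> i < n" if "i \<in> I" for i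
    using that subset \<sigma>_less_half_iff[of i] by auto
  have R_sym: "R j i" if "R i j" for i j
    using that sym[of "\<sigma> i" "\<sigma> j"] I_less by (auto simp: R_def add.commute)
  have R_uniq: "j' = j" if "R i j" "R i j'" for i j j'
  proof -
    have "\<sigma> j' = \<sigma> j"
      using that uniq[of "\<sigma> i" "\<sigma> j" "\<sigma> j'"] I_less by (auto simp: R_def)
    then show ?thesis using that I_less \<sigma>_eq_iff by (auto simp: R_def)
  qed
  define p where "p i = (if \<exists>j. R i j then mir (THE j. R i j)
    else if \<exists>j. R (mir i) j then THE j. R (mir i) j else i)" for i
  have the: "(THE j. R i j) = j" if "R i j" for i j
    using that R_uniq by blast
  have R_I: "i \<in> I" "j \<in> I" "2 * n \<le> i + j" "i < 2 * n" "j < 2 * n" if "R i j" for i j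
    using that I_less by (auto simp: R_def)
  have p1: "p i = mir j" if "R i j" for i j
    using that the[OF that] by (auto simp: p_def)
  have p2: "p i = j" if R: "R (mir i) j" and i: "i < 2 * n" for i j
  proof -
    \<comment> \<open>The two clauses defining p exclude each other because only one of i and
      \<open>mir i\<close> lies in I.\<close>
    have "\<not> R i k" for k using R_I[OF R] R_I(1)[of i k] mirror_iff[OF i] by blast
    then show ?thesis using the[OF R] R by (auto simp: p_def)
  qed
  have p3: "p i = i" if "\<nexists>j. R i j" "\<nexists>j. R (mir i) j" for i using that by (auto simp: p_def)
  have "skew_matching p"
    unfolding skew_matching_def
  proof (intro allI impI)
    fix k assume k: "k < 2 * n"
    consider j where "R k j" | j where "R (mir k) j" | "\<nexists>j. R k j" "\<nexists>j. R (mir k) j" by blast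
    then show "p k < 2 * n \<and> p (p k) = k \<and> p (mir k) = mir (p k) \<and> (k < p k \<longrightarrow> k \<notin> I \<and> p k \<in> I)"
    proof cases
      case (1 j)
      note j = R_I[OF 1]
      have "p (mir j) = k" using p2[of "mir j" k] R_sym[OF 1] mir_mir[OF j(5)] mir_less[OF j(5)] by simp
      moreover have "p (mir k) = j" using p2[of "mir k" j] 1 mir_mir[OF k] mir_less[OF k] by simp
      \<comment> \<open>The bound 2n \<le> k + j places \<open>mir j\<close> below k, so the member
        in I comes second.\<close>
      moreover have "\<not> k < mir j" using j by linarith
      ultimately show ?thesis using p1[OF 1] mir_mir[OF j(5)] mir_less[OF j(5)] by simp
    next
      case (2 j)
      note j = R_I[OF 2]
      have "p j = k" using p1[OF R_sym[OF 2]] mir_mir[OF k] by simp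
      then show ?thesis using p2[OF 2 k] p1[OF 2] j mirror_iff[OF k] by simp
    next
      case 3
      have "p (mir k) = mir k" by (rule p3) (use 3 mir_mir[OF k] in auto)
      then show ?thesis using p3[OF 3] k by simp
    qed
  qed
  moreover have "T $$ (k, l) \<noteq> 0 \<and> 2 * n \<le> \<sigma> k + \<sigma> l \<longleftrightarrow> \<sigma> k = p (mir (\<sigma> l))" if kl: "k < n" "l < n" for k l
  proof -
    have s: "\<sigma> k \<in> I" "\<sigma> l \<in> I" "\<sigma> k < 2 * n" "\<sigma> l < 2 * n" "\<sigma> (\<sigma> k) = k" "\<sigma> (\<sigma> l) = l"
      using kl \<sigma>_in_iff[of k] \<sigma>_in_iff[of l] \<sigma>_less[of k] \<sigma>_less[of l] \<sigma>_\<sigma>[of k] \<sigma>_\<sigma>[of l] by auto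
    have R: "T $$ (k, l) \<noteq> 0 \<and> 2 * n \<le> \<sigma> k + \<sigma> l \<longleftrightarrow> R (\<sigma> l) (\<sigma> k)"
      using s sym[OF kl] by (auto simp: R_def)
    have m: "mir (\<sigma> l) < 2 * n" "mir (mir (\<sigma> l)) = \<sigma> l" "mir (\<sigma> l) \<notin> I"
      using s mirror_iff[of "\<sigma> l"] by auto
    show ?thesis
    proof
      assume "T $$ (k, l) \<noteq> 0 \<and> 2 * n \<le> \<sigma> k + \<sigma> l"
      then show "\<sigma> k = p (mir (\<sigma> l))" using p2[of "mir (\<sigma> l)" "\<sigma> k"] m R by simp
    next
      assume eq: "\<sigma> k = p (mir (\<sigma> l))"
      have no: "\<nexists>j. R (mir (\<sigma> l)) j" using R_I(1) m(3) by blast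
      then obtain j where "R (\<sigma> l) j" using p3[OF no] eq s(1) m(2,3) by fastforce
      then have "j = \<sigma> k" using p2[of "mir (\<sigma> l)" j] m eq by simp
      then show "T $$ (k, l) \<noteq> 0 \<and> 2 * n \<le> \<sigma> k + \<sigma> l" using \<open>R (\<sigma> l) j\<close> R by simp
    qed
  qed
  ultimately show ?thesis by blast
qed

text \<open>The chain runs from S through its reduced form T and the truncation T' to the matrix U
  belonging to the clan matrix of p. T' and U have the same support, so scaling joins them.\<close>

lemma exists_matching_form:
  assumes S: "S \<in> carrier_mat n n" and sym: "transpose_mat S = S"
  shows "\<exists>p. skew_matching p \<and> (\<exists>b\<in>borel_subgroup n. \<exists>l\<in>siegel_levi n. w * unip n S = b * matching_inv p * l)"
proof -
  have sym': "S $$ (k, l) = S $$ (l, k)" if "k < n" "l < n" for k l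
    using arg_cong[OF sym, of "\<lambda>X. X $$ (k, l)"] that S by simp
  have "inj_on \<sigma> {..<n}" using \<sigma>_eq_iff by (auto intro!: inj_onI)
  moreover have "reduced_off n {..<n} S" using S sym' by (auto simp: reduced_off_def)
  ultimately obtain T where con: "triangular_congruent n \<sigma> S T" and red: "reduced_off n {} T"
    using reduced_off_congruent[of \<sigma> n "{..<n}" S] by auto
  have Tc: "T \<in> carrier_mat n n" and Tsym: "\<And>k l. k < n \<Longrightarrow> l < n \<Longrightarrow> T $$ (k, l) = T $$ (l, k)"
    using red by (auto simp: reduced_off_def)
  define T' where "T' = mat n n (\<lambda>(k, l). if 2 * n \<le> \<sigma> k + \<sigma> l then T $$ (k, l) else 0)"
  have T'c: "T' \<in> carrier_mat n n" by (simp add: T'_def)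
  have T': "T' $$ (k, l) = (if 2 * n \<le> \<sigma> k + \<sigma> l then T $$ (k, l) else 0)" if "k < n" "l < n" for k l
    using that by (simp add: T'_def)
  \<comment> \<open>Truncation deletes entries symmetrically and creates none, so it preserves the
    reduced form.\<close>
  have red': "reduced_off n {} T'"
    using red unfolding reduced_off_def by (auto simp: T' T'c add.commute)
  obtain p where p: "skew_matching p"
    and supp: "\<And>k l. k < n \<Longrightarrow> l < n \<Longrightarrow> T $$ (k, l) \<noteq> 0 \<and> 2 * n \<le> \<sigma> k + \<sigma> l \<longleftrightarrow> \<sigma> k = p (mir (\<sigma> l))"
    using matching_of_reduced[OF red] by blast
  obtain b U where b: "b \<in> borel_subgroup n" and U: "U \<in> carrier_mat n n" "transpose_mat U = U"
    and Usupp: "\<And>k l. k < n \<Longrightarrow> l < n \<Longrightarrow> U $$ (k, l) \<noteq> 0 \<longleftrightarrow> \<sigma> k = p (mir (\<sigma> l))"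
    and coset: "matching_inv p <#\<^bsub>Sp n\<^esub> siegel_levi n = (b * (w * unip n U)) <#\<^bsub>Sp n\<^esub> siegel_levi n"
    using normal_form_coset[OF p] by blast
  have Usym: "U $$ (k, l) = U $$ (l, k)" if "k < n" "l < n" for k l
    using arg_cong[OF U(2), of "\<lambda>X. X $$ (k, l)"] that U(1) by simp
  have "triangular_congruent n \<sigma> T' U"
    by (rule reduced_scaling[OF red' U(1) Usym]) (use Usupp supp in \<open>auto simp: T'\<close>)
  then have "same_double_coset T' U"
    using same_double_coset_congruent[OF U(1) triangular_congruent_sym[OF _ T'c]] by blast
  moreover have "same_double_coset S T"
    using same_double_coset_congruent[OF Tc triangular_congruent_sym[OF con S]] .
  moreover have "same_double_coset T T'"
    unfolding T'_def by (rule same_double_coset_truncate[OF Tc Tsym])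
  ultimately have "same_double_coset S U"
    using same_double_coset_trans U(1) T'c by blast
  then obtain a l where a: "a \<in> borel_subgroup n" "l \<in> siegel_levi n" "w * unip n S = a * (w * unip n U) * l"
    by (auto simp: same_double_coset_def)
  have u: "unip n U \<in> carrier (Sp n)" by (rule unip_Sp[OF U])
  have h: "matching_inv p \<in> carrier (Sp n)" by (intro symp_inv_closed matching_mat_Sp p)
  have "b * (w * unip n U) \<in> carrier (Sp n)" by (intro Sp_mult_closed w_Sp u borel_Sp[OF b])
  then obtain l' where l': "l' \<in> siegel_levi n" "b * (w * unip n U) = matching_inv p * l'"
    using levi_coset_eq_iff[OF _ h] coset by metis
  have c: "a \<in> carrier_mat (2 * n) (2 * n)" "l \<in> carrier_mat (2 * n) (2 * n)" "b \<in> carrier_mat (2 * n) (2 * n)"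
    "l' \<in> carrier_mat (2 * n) (2 * n)" "symp_inv n b \<in> carrier_mat (2 * n) (2 * n)" "unip n U \<in> carrier_mat (2 * n) (2 * n)"
    using a b l' u by (simp_all add: Sp_carrier_mat borel_Sp siegel_levi_Sp)
  note ac = mult_assoc_square[of _ "2 * n"]
  have "w * unip n U = (symp_inv n b * b) * (w * unip n U)"
    using c by (simp add: symp_inv_mult[OF borel_Sp[OF b]])
  also have "\<dots> = symp_inv n b * (matching_inv p * l')"
    unfolding l'(2)[symmetric] using c by (simp add: ac)
  finally have "w * unip n S = (a * symp_inv n b) * matching_inv p * (l' * l)"
    unfolding a(3) using c by (simp add: ac)
  moreover have "a * symp_inv n b \<in> borel_subgroup n" by (intro borel_mult borel_symp_inv a b)
  moreover have "l' * l \<in> siegel_levi n"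
    using subgroup.m_closed[OF subgroup_siegel_levi l'(1) a(2)] by simp
  ultimately show ?thesis using p by blast
qed

section \<open>The fibre as a union of orbits\<close>

text \<open>Inside the fibre, P = U L reduces g to a symmetric S, and elimination finds the clan.
  Conversely, the normal form of a clan matrix places it in B w P.\<close>

lemma fibre_eq_orbits:
  assumes g: "g \<in> carrier (Sp n)"
  shows "levi_projection n (g <#\<^bsub>Sp n\<^esub> siegel_levi n) \<in> schubert_cell n I \<longleftrightarrow>
    (\<exists>\<gamma>\<in>clans_over n I. g <#\<^bsub>Sp n\<^esub> siegel_levi n \<in> clan_orbit n \<gamma>)"
proof -
  note ac = mult_assoc_square[of _ "2 * n"]
  have "(\<exists>b\<in>borel_subgroup n. \<exists>q\<in>siegel_parabolic n. g = b * w * q) \<longleftrightarrow>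
      (\<exists>\<gamma>\<in>clans_over n I. g <#\<^bsub>Sp n\<^esub> siegel_levi n \<in> clan_orbit n \<gamma>)"
  proof
    assume "\<exists>b\<in>borel_subgroup n. \<exists>q\<in>siegel_parabolic n. g = b * w * q"
    then obtain b q where b: "b \<in> borel_subgroup n" and q: "q \<in> siegel_parabolic n" and gbq: "g = b * w * q" by blast
    obtain S l where S: "S \<in> carrier_mat n n" "transpose_mat S = S" and l: "l \<in> siegel_levi n" and ql: "q = unip n S * l"
      using siegel_parabolic_decomp[OF q] by blast
    obtain p b' l' where p: "skew_matching p" and b': "b' \<in> borel_subgroup n" and l': "l' \<in> siegel_levi n"
      and eq: "w * unip n S = b' * matching_inv p * l'"
      using exists_matching_form[OF S] by blast
    have h: "matching_inv p \<in> carrier (Sp n)" by (intro symp_inv_closed matching_mat_Sp p)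
    have c: "b \<in> carrier_mat (2 * n) (2 * n)" "b' \<in> carrier_mat (2 * n) (2 * n)" "l \<in> carrier_mat (2 * n) (2 * n)"
      "l' \<in> carrier_mat (2 * n) (2 * n)" "unip n S \<in> carrier_mat (2 * n) (2 * n)"
      using b b' l l' by (simp_all add: Sp_carrier_mat borel_Sp siegel_levi_Sp unip_carrier[OF S(1)])
    have "g = b * (w * unip n S) * l" unfolding gbq ql using c by (simp add: ac)
    then have "g = (b * b' * matching_inv p) * (l' * l)" unfolding eq using c by (simp add: ac)
    moreover have "l' * l \<in> siegel_levi n"
      using subgroup.m_closed[OF subgroup_siegel_levi l' l] by simp
    moreover have bb: "b * b' \<in> borel_subgroup n" by (rule borel_mult[OF b b'])
    ultimately have "g <#\<^bsub>Sp n\<^esub> siegel_levi n = (b * b' * matching_inv p) <#\<^bsub>Sp n\<^esub> siegel_levi n"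
      using levi_coset_eq_iff[OF g Sp_mult_closed[OF borel_Sp[OF bb] h]] by blast
    moreover obtain \<gamma> where \<gamma>: "\<gamma> \<in> clans_over n I" "clan_matching \<gamma> p" using clan_of_matching[OF p] by blast
    ultimately show "\<exists>\<gamma>\<in>clans_over n I. g <#\<^bsub>Sp n\<^esub> siegel_levi n \<in> clan_orbit n \<gamma>"
      using bb clan_orbit_eq[OF p \<gamma>(2,1)] by blast
  next
    assume "\<exists>\<gamma>\<in>clans_over n I. g <#\<^bsub>Sp n\<^esub> siegel_levi n \<in> clan_orbit n \<gamma>"
    then obtain \<gamma> where \<gamma>: "\<gamma> \<in> clans_over n I" and orbit: "g <#\<^bsub>Sp n\<^esub> siegel_levi n \<in> clan_orbit n \<gamma>" by blast
    obtain p where p: "skew_matching p" "clan_matching \<gamma> p" using clan_matching_exists[OF \<gamma>] by blast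
    obtain b where b: "b \<in> borel_subgroup n"
      and gb: "g <#\<^bsub>Sp n\<^esub> siegel_levi n = (b * matching_inv p) <#\<^bsub>Sp n\<^esub> siegel_levi n"
      using orbit unfolding clan_orbit_eq[OF p \<gamma>] by blast
    have h: "matching_inv p \<in> carrier (Sp n)" by (intro symp_inv_closed matching_mat_Sp p)
    obtain l where l: "l \<in> siegel_levi n" "g = b * matching_inv p * l"
      using gb levi_coset_eq_iff[OF g Sp_mult_closed[OF borel_Sp[OF b] h]] by blast
    obtain b' S where b': "b' \<in> borel_subgroup n" and S: "S \<in> carrier_mat n n" "transpose_mat S = S"
      and coset: "matching_inv p <#\<^bsub>Sp n\<^esub> siegel_levi n = (b' * (w * unip n S)) <#\<^bsub>Sp n\<^esub> siegel_levi n"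
      using normal_form_coset[OF p(1)] by blast
    have u: "unip n S \<in> carrier (Sp n)" by (rule unip_Sp[OF S])
    obtain l' where l': "l' \<in> siegel_levi n" "matching_inv p = b' * (w * unip n S) * l'"
      using coset levi_coset_eq_iff[OF h Sp_mult_closed[OF borel_Sp[OF b'] Sp_mult_closed[OF w_Sp u]]] by blast
    have c: "b \<in> carrier_mat (2 * n) (2 * n)" "b' \<in> carrier_mat (2 * n) (2 * n)" "l \<in> carrier_mat (2 * n) (2 * n)"
      "l' \<in> carrier_mat (2 * n) (2 * n)" "unip n S \<in> carrier_mat (2 * n) (2 * n)"
      using b b' l l' u by (simp_all add: Sp_carrier_mat borel_Sp siegel_levi_Sp)
    have "g = (b * b') * w * (unip n S * (l' * l))"
      unfolding l(2) l'(2) using c by (simp add: ac)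
    moreover have "unip n S \<in> siegel_parabolic n"
      using u S(1) unfolding unip_def by (simp add: siegel_parabolic_block_iff)
    then have "unip n S * (l' * l) \<in> siegel_parabolic n"
      using subgroup.m_closed[OF subgroup_siegel_parabolic] l(1) l'(1) siegel_levi_subset_parabolic by simp blast
    moreover have "b * b' \<in> borel_subgroup n" by (rule borel_mult[OF b b'])
    ultimately show "\<exists>b\<in>borel_subgroup n. \<exists>q\<in>siegel_parabolic n. g = b * w * q" by blast
  qed
  then show ?thesis using levi_projection_schubert_iff[OF g w_Sp translate_w] by simp
qed

text \<open>The projection is a function on arbitrary sets of matrices, so it must be checked
  separately that orbits consist of genuine cosets of L.\<close>

lemma clan_orbit_subset:
  assumes \<gamma>: "\<gamma> \<in> clans_over n I"
  shows "clan_orbit n \<gamma> \<subseteq> lcosets\<^bsub>Sp n\<^esub> siegel_levi n"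
proof -
  obtain p where p: "skew_matching p" "clan_matching \<gamma> p" using clan_matching_exists[OF \<gamma>] by blast
  have "b * matching_inv p \<in> carrier (Sp n)" if "b \<in> borel_subgroup n" for b
    by (intro Sp_mult_closed borel_Sp[OF that] symp_inv_closed matching_mat_Sp p)
  then show ?thesis unfolding clan_orbit_eq[OF p \<gamma>] LCOSETS_def by blast
qed

end

theorem theorem5p7:
  fixes n :: nat and I :: "nat set"
  assumes "I \<subseteq> {..<2 * n}"
    and "card I = n"
    and "\<And>i. i \<in> I \<Longrightarrow> 2 * n - 1 - i \<notin> I"
  shows "levi_projection n -` schubert_cell n I \<inter> (lcosets\<^bsub>Sp n\<^esub> siegel_levi n)
           = (\<Union>\<gamma>\<in>clans_over n I. clan_orbit n \<gamma>)
         \<and> disjoint_family_on (clan_orbit n) (clans_over n I)"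
proof -
  have iso: "2 * n - Suc i \<notin> I" if "i \<in> I" for i using assms(3)[OF that] by simp
  interpret isotropic_set n I
    by standard (use assms(1) iso complementary_mirror[OF assms(1,2) iso] in blast)+
  have "X \<in> levi_projection n -` schubert_cell n I \<inter> (lcosets\<^bsub>Sp n\<^esub> siegel_levi n) \<longleftrightarrow>
      X \<in> (\<Union>\<gamma>\<in>clans_over n I. clan_orbit n \<gamma>)" for X
  proof (cases "X \<in> lcosets\<^bsub>Sp n\<^esub> siegel_levi n")
    case True
    then obtain g where "g \<in> carrier (Sp n)" "X = g <#\<^bsub>Sp n\<^esub> siegel_levi n" by (auto simp: LCOSETS_def)
    then show ?thesis using True fibre_eq_orbits by simp
  next
    case False
    then show ?thesis using clan_orbit_subset by auto
  qed
  then show ?thesis using disjoint_clan_orbits by blast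
qed

end
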